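(* Let $E$ be an lcHs over $\mathbb{K}$, let $\mathcal{F}(\Omega)$ and $\mathcal{F}(\Omega,E)$ be $\varepsilon$-into-compatible, $(T^{E}_{m},T^{\mathbb{K}}_{m})_{m\in M}$ a strong, consistent family for $(\mathcal{F},E)$, $\mathcal{F}(\Omega)$ a semi-Montel BC-space and $U$ a set of uniqueness for $(T^{\mathbb{K}}_{m},\mathcal{F})_{m\in M}$. If (i) $E$ is complete, or (ii) $E$ is sequentially complete and for every $f\in\mathcal{F}_{E'}(U,E)$ and $f'\in\mathcal{F}(\Omega)'$ there is a sequence $(f_{n}')_{n\in\mathbb{N}}$ in $\mathcal{F}(\Omega)'$ converging to $f'$ in $\mathcal{F}(\Omega)_{\kappa}'$ such that $\mathscr{R}_{f}^{t}(f_{n}')\in\mathcal{J}(E)$ for every $n\in\mathbb{N}$, then the restriction map \[ R_{U,E'}\colon S(\mathcal{F}(\Omega)\varepsilon E)\to\mathcal{F}_{E'}(U,E),\; f\mapsto(T^{E}_{m}(f)(x))_{(m,x)\in U}, \] is surjective.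
   Context: $\mathbb{K}=\mathbb{R}$ or $\mathbb{C}$. An lcHs is a non-trivial locally convex Hausdorff space over $\mathbb{K}$. For an lcHs $F$, $F'_{\kappa}$ is $F'$ with the topology of uniform convergence on absolutely convex compact subsets of $F$, and $F\varepsilon E:=L_{e}(F'_{\kappa},E)$ carries the topology of uniform convergence on equicontinuous subsets of $F'$. $\delta_x(f):=f(x)$. $\mathcal{F}(\Omega)\subset\mathbb{K}^{\Omega}$ and $\mathcal{F}(\Omega,E)\subset E^{\Omega}$ are lcHs of functions on a non-empty set $\Omega$ with $\delta_x\in\mathcal{F}(\Omega)'$ for all $x\in\Omega$; they are $\varepsilon$-into-compatible if $S\colon\mathcal{F}(\Omega)\varepsilon E\to\mathcal{F}(\Omega,E)$, $u\mapsto[x\mapsto u(\delta_x)]$, is a well-defined topological isomorphism onto its range. Let $(\omega_m)_{m\in M}$ be non-empty sets and $T^{\mathbb{K}}_m\colon\operatorname{dom}T^{\mathbb{K}}_m\to\mathbb{K}^{\omega_m}$, $T^{E}_m\colon\operatorname{dom}T^{E}_m\to E^{\omega_m}$ linear with $\mathcal{F}(\Omega)\subset\operatorname{dom}T^{\mathbb{K}}_m\subset\mathbb{K}^{\Omega}$, $\mathcal{F}(\Omega,E)\subset\operatorname{dom}T^{E}_m\subset E^{\Omega}$. Put $T^{\mathbb{K}}_{m,x}:=\delta_x\circ T^{\mathbb{K}}_m$. The family $(T^{E}_m,T^{\mathbb{K}}_m)_{m\in M}$ is consistent for $(\mathcal{F},E)$ if for all $u\in\mathcal{F}(\Omega)\varepsilon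 E$, $m\in M$, $x\in\omega_m$: $S(u)\in\mathcal{F}(\Omega,E)$, $T^{\mathbb{K}}_{m,x}\in\mathcal{F}(\Omega)'$ and $T^{E}_m(S(u))(x)=u(T^{\mathbb{K}}_{m,x})$. It is strong if for all $e'\in E'$, $f\in\mathcal{F}(\Omega,E)$, $m\in M$, $x\in\omega_m$: $e'\circ f\in\mathcal{F}(\Omega)$ and $T^{\mathbb{K}}_m(e'\circ f)(x)=e'(T^{E}_m(f)(x))$. $U\subset\bigcup_{m\in M}(\{m\}\times\omega_m)$ is a set of uniqueness for $(T^{\mathbb{K}}_m,\mathcal{F})_{m\in M}$ if $T^{\mathbb{K}}_{m,x}\in\mathcal{F}(\Omega)'$ for all $(m,x)\in U$, and $f\in\mathcal{F}(\Omega)$ with $T^{\mathbb{K}}_m(f)(x)=0$ for all $(m,x)\in U$ implies $f=0$. $\mathcal{F}_{E'}(U,E)$ is the space of functions $f\colon U\to E$ such that for every $e'\in E'$ there is a (necessarily unique) $f_{e'}\in\mathcal{F}(\Omega)$ with $T^{\mathbb{K}}_m(f_{e'})(x)=(e'\circ f)(m,x)$ for all $(m,x)\in U$. For such $f$, $\mathscr{R}_f^{t}\colon\mathcal{F}(\Omega)'\to E'^{\star}$, $\mathscr{R}_f^{t}(y)(e'):=y(f_{e'})$, where $E'^{\star}$ is the algebraic dual of $E'$, and $\mathcal{J}\colon E\to E'^{\star}$, $\mathcal{J}(x)(e'):=e'(x)$. An lcHs $F$ is a BC-space if every linear map with closed graph from a Banach space into $F$ is continuous. Semi-Montel: every bounded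 set is relatively compact. *)

theory Defs
  imports "HOL-Analysis.Analysis" "HOL-Library.Function_Algebras"
begin

section \<open>The scalar field\<close>

text \<open>
  The types of this class are, up to isometric isomorphism, exactly \<^typ>\<open>real\<close> and
  \<^typ>\<open>complex\<close>.
\<close>

class real_or_complex = real_normed_field +
  assumes real_or_complex:
    "(\<forall>z. \<exists>a. z = a *\<^sub>R 1) \<or>
     (\<exists>i. i * i = - 1 \<and> (\<forall>z. \<exists>a b. z = a *\<^sub>R 1 + b *\<^sub>R i) \<and>
          (\<forall>a b. norm (a *\<^sub>R 1 + b *\<^sub>R i) = sqrt (a * a + b * b)))"

instance real :: real_or_complex
proof
  have "\<forall>z::real. \<exists>a. z = a *\<^sub>R 1" by auto
  then show "(\<forall>z::real. \<exists>a. z = a *\<^sub>R 1) \<or>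
     (\<exists>i::real. i * i = - 1 \<and> (\<forall>z. \<exists>a b. z = a *\<^sub>R 1 + b *\<^sub>R i) \<and>
          (\<forall>a b. norm (a *\<^sub>R 1 + b *\<^sub>R i) = sqrt (a * a + b * b)))" ..
qed

instance complex :: real_or_complex
proof
  have "\<i> * \<i> = - 1"
    by simp
  moreover have "\<exists>a b. z = a *\<^sub>R 1 + b *\<^sub>R \<i>" for z
    by (rule exI[of _ "Re z"], rule exI[of _ "Im z"]) (simp add: complex_eq_iff)
  moreover have "norm (a *\<^sub>R 1 + b *\<^sub>R \<i>) = sqrt (a * a + b * b)" for a b
    by (simp add: cmod_def power2_eq_square)
  ultimately show "(\<forall>z::complex. \<exists>a. z = a *\<^sub>R 1) \<or>
     (\<exists>i::complex. i * i = - 1 \<and> (\<forall>z. \<exists>a b. z = a *\<^sub>R 1 + b *\<^sub>R i) \<and>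
          (\<forall>a b. norm (a *\<^sub>R 1 + b *\<^sub>R i) = sqrt (a * a + b * b)))"
    by blast
qed


section \<open>Locally convex Hausdorff spaces\<close>

text \<open>
  A space is given by a scalar multiplication \<open>s\<close> on an ambient vector space and a topology whose
  \<^const>\<open>topspace\<close> is a linear subspace of it, so that spaces of functions carry their own
  topologies. A map on such a carrier that is an element of a function space itself
  (a functional, an operator) is represented by the function that vanishes outside the carrier.
\<close>

definition fscale :: "('k \<Rightarrow> 'v \<Rightarrow> 'v) \<Rightarrow> 'k \<Rightarrow> ('a \<Rightarrow> 'v) \<Rightarrow> 'a \<Rightarrow> 'v" where
  "fscale s c f = (\<lambda>x. s c (f x))"

definition linear_on ::
  "('k \<Rightarrow> 'v \<Rightarrow> 'v) \<Rightarrow> ('k \<Rightarrow> 'w \<Rightarrow> 'w) \<Rightarrow> 'v set \<Rightarrow> ('v::plus \<Rightarrow> 'w::plus) \<Rightarrow> bool" where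
  "linear_on s s' V f \<longleftrightarrow>
     (\<forall>x\<in>V. \<forall>y\<in>V. f (x + y) = f x + f y) \<and> (\<forall>c. \<forall>x\<in>V. f (s c x) = s' c (f x))"

definition zero_ext :: "'v set \<Rightarrow> ('v \<Rightarrow> 'w::zero) \<Rightarrow> 'v \<Rightarrow> 'w" where
  "zero_ext V f = (\<lambda>x. if x \<in> V then f x else 0)"

definition convex_in :: "('k::real_or_complex \<Rightarrow> 'v::ab_group_add \<Rightarrow> 'v) \<Rightarrow> 'v set \<Rightarrow> bool" where
  "convex_in s C \<longleftrightarrow>
     (\<forall>x\<in>C. \<forall>y\<in>C. \<forall>t\<in>{0..1}. s (of_real t) x + s (of_real (1 - t)) y \<in> C)"

definition abs_convex_in :: "('k::real_or_complex \<Rightarrow> 'v::ab_group_add \<Rightarrow> 'v) \<Rightarrow> 'v set \<Rightarrow> bool" where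
  "abs_convex_in s C \<longleftrightarrow>
     (\<forall>x\<in>C. \<forall>y\<in>C. \<forall>a b. norm a + norm b \<le> 1 \<longrightarrow> s a x + s b y \<in> C)"

definition lcHs :: "('k::real_or_complex \<Rightarrow> 'v::ab_group_add \<Rightarrow> 'v) \<Rightarrow> 'v topology \<Rightarrow> bool" where
  "lcHs s T \<longleftrightarrow>
     vector_space s \<and> module.subspace s (topspace T) \<and> topspace T \<noteq> {0} \<and>
     continuous_map (prod_topology T T) T (\<lambda>(x, y). x + y) \<and>
     continuous_map (prod_topology euclidean T) T (\<lambda>(c, x). s c x) \<and>
     (\<forall>W. openin T W \<and> 0 \<in> W \<longrightarrow>
        (\<exists>C N. convex_in s C \<and> openin T N \<and> 0 \<in> N \<and> N \<subseteq> C \<and> C \<subseteq> W)) \<and>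
     Hausdorff_space T"

definition dual :: "('k::real_or_complex \<Rightarrow> 'v::ab_group_add \<Rightarrow> 'v) \<Rightarrow> 'v topology \<Rightarrow> ('v \<Rightarrow> 'k) set" where
  "dual s T = {\<phi>. linear_on s (*) (topspace T) \<phi> \<and> continuous_map T euclidean \<phi> \<and>
                  (\<forall>x. x \<notin> topspace T \<longrightarrow> \<phi> x = 0)}"

definition bounded_in :: "('k::real_or_complex \<Rightarrow> 'v::ab_group_add \<Rightarrow> 'v) \<Rightarrow> 'v topology \<Rightarrow> 'v set \<Rightarrow> bool" where
  "bounded_in s T B \<longleftrightarrow> B \<subseteq> topspace T \<and>
     (\<forall>W. openin T W \<and> 0 \<in> W \<longrightarrow> (\<exists>r>0. \<forall>c. r \<le> norm c \<longrightarrow> B \<subseteq> s c ` W))"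

definition semi_Montel :: "('k::real_or_complex \<Rightarrow> 'v::ab_group_add \<Rightarrow> 'v) \<Rightarrow> 'v topology \<Rightarrow> bool" where
  "semi_Montel s T \<longleftrightarrow> (\<forall>B. bounded_in s T B \<longrightarrow> compactin T (T closure_of B))"

definition Cauchy_filter_in :: "'v::ab_group_add topology \<Rightarrow> 'v filter \<Rightarrow> bool" where
  "Cauchy_filter_in T \<F> \<longleftrightarrow> \<F> \<noteq> bot \<and> (\<forall>\<^sub>F x in \<F>. x \<in> topspace T) \<and>
     (\<forall>W. openin T W \<and> 0 \<in> W \<longrightarrow>
        (\<exists>A. (\<forall>\<^sub>F x in \<F>. x \<in> A) \<and> (\<forall>x\<in>A. \<forall>y\<in>A. x - y \<in> W)))"

definition complete_in :: "'v::ab_group_add topology \<Rightarrow> bool" where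
  "complete_in T \<longleftrightarrow> (\<forall>\<F>. Cauchy_filter_in T \<F> \<longrightarrow> (\<exists>l. limitin T (\<lambda>x. x) l \<F>))"

definition Cauchy_seq_in :: "'v::ab_group_add topology \<Rightarrow> (nat \<Rightarrow> 'v) \<Rightarrow> bool" where
  "Cauchy_seq_in T X \<longleftrightarrow> range X \<subseteq> topspace T \<and>
     (\<forall>W. openin T W \<and> 0 \<in> W \<longrightarrow> (\<exists>N. \<forall>m\<ge>N. \<forall>n\<ge>N. X m - X n \<in> W))"

definition sequentially_complete_in :: "'v::ab_group_add topology \<Rightarrow> bool" where
  "sequentially_complete_in T \<longleftrightarrow>
     (\<forall>X. Cauchy_seq_in T X \<longrightarrow> (\<exists>l. limitin T X l sequentially))"


section \<open>BC-spaces\<close>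

text \<open>
  Norms vanish outside the carrier, so that \<open>\<lambda>x y. N (x - y)\<close> satisfies the axioms of
  \<^locale>\<open>Metric_space\<close>, some of which are not relativised to the carrier.
\<close>

definition banach_on :: "('k::real_or_complex \<Rightarrow> 'v::ab_group_add \<Rightarrow> 'v) \<Rightarrow> 'v set \<Rightarrow> ('v \<Rightarrow> real) \<Rightarrow> bool" where
  "banach_on s X N \<longleftrightarrow>
     vector_space s \<and> module.subspace s X \<and>
     (\<forall>x. x \<notin> X \<longrightarrow> N x = 0) \<and>
     (\<forall>x\<in>X. 0 \<le> N x \<and> (N x = 0 \<longrightarrow> x = 0)) \<and>
     (\<forall>x\<in>X. \<forall>y\<in>X. N (x + y) \<le> N x + N y) \<and>
     (\<forall>c. \<forall>x\<in>X. N (s c x) = norm c * N x) \<and>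
     Metric_space.mcomplete X (\<lambda>x y. N (x - y))"

definition norm_topology :: "'v::ab_group_add set \<Rightarrow> ('v \<Rightarrow> real) \<Rightarrow> 'v topology" where
  "norm_topology X N = Metric_space.mtopology X (\<lambda>x y. N (x - y))"

definition closed_graph ::
  "'v::ab_group_add set \<Rightarrow> ('v \<Rightarrow> real) \<Rightarrow> 'w topology \<Rightarrow> ('v \<Rightarrow> 'w) \<Rightarrow> bool" where
  "closed_graph X N F T \<longleftrightarrow>
     closedin (prod_topology (norm_topology X N) F) ((\<lambda>x. (x, T x)) ` X)"

text \<open>
  A definition cannot quantify over Banach spaces of every type, so here the Banach spaces are
  realised in the ambient vector space of \<open>F\<close>. This is no restriction: lemma
  \<open>BC_space_closed_graph\<close> below derives the closed graph property for Banach spaces of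
  arbitrary type (\<open>T\<close> factors through its range with the quotient norm).
\<close>

definition BC_space :: "('k::real_or_complex \<Rightarrow> 'v::ab_group_add \<Rightarrow> 'v) \<Rightarrow> 'v topology \<Rightarrow> bool" where
  "BC_space s F \<longleftrightarrow>
     (\<forall>X N T. banach_on s X N \<and> linear_on s s X T \<and> T ` X \<subseteq> topspace F \<and> closed_graph X N F T
        \<longrightarrow> continuous_map (norm_topology X N) F T)"

lemma banach_on_Metric_space:
  assumes "banach_on s X N"
  shows "Metric_space X (\<lambda>x y. N (x - y))"
proof -
  interpret vector_space s using assms by (simp add: banach_on_def)
  have sub: "subspace X" and out: "\<And>x. x \<notin> X \<Longrightarrow> N x = 0"
    and pos: "\<And>x. x \<in> X \<Longrightarrow> 0 \<le> N x" and def0: "\<And>x. x \<in> X \<Longrightarrow> N x = 0 \<Longrightarrow> x = 0"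
    and tri: "\<And>x y. x \<in> X \<Longrightarrow> y \<in> X \<Longrightarrow> N (x + y) \<le> N x + N y"
    and hom: "\<And>c x. x \<in> X \<Longrightarrow> N (s c x) = norm c * N x"
    using assms by (auto simp: banach_on_def)
  have neg: "N (- x) = N x" for x
  proof (cases "x \<in> X")
    case True
    then show ?thesis using hom[of x "- 1"] by simp
  next
    case False
    then have "- x \<notin> X" using subspace_neg[OF sub, of "- x"] by auto
    then show ?thesis using False out by simp
  qed
  have zero: "N 0 = 0" using hom[of 0 0] subspace_0[OF sub] by simp
  show ?thesis
  proof
    show "0 \<le> N (x - y)" for x y using pos out by (cases "x - y \<in> X") auto
    show "N (x - y) = N (y - x)" for x y using neg[of "x - y"] by simp
    show "N (x - y) = 0 \<longleftrightarrow> x = y" if "x \<in> X" "y \<in> X" for x y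
      using def0[of "x - y"] subspace_diff[OF sub that] zero by auto
    show "N (x - z) \<le> N (x - y) + N (y - z)" if "x \<in> X" "y \<in> X" "z \<in> X" for x y z
      using tri[of "x - y" "y - z"] subspace_diff[OF sub] that by simp
  qed
qed

lemma BC_space_closed_graph:
  fixes s :: "'k::real_or_complex \<Rightarrow> 'v::ab_group_add \<Rightarrow> 'v"
    and sX :: "'k \<Rightarrow> 'b::ab_group_add \<Rightarrow> 'b"
  assumes BC: "BC_space s F" and vs: "vector_space s"
    and ban: "banach_on sX X N" and lin: "linear_on sX s X T" and range: "T ` X \<subseteq> topspace F"
    and graph: "closed_graph X N F T"
  shows "continuous_map (norm_topology X N) F T"
proof -
  interpret VX: vector_space sX using ban by (simp add: banach_on_def)
  interpret V: vector_space s by (fact vs)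
  interpret MX: Metric_space X "\<lambda>x y. N (x - y)" by (rule banach_on_Metric_space[OF ban])
  have sub: "VX.subspace X"
    and pos: "\<And>x. x \<in> X \<Longrightarrow> 0 \<le> N x" and def0: "\<And>x. x \<in> X \<Longrightarrow> N x = 0 \<Longrightarrow> x = 0"
    and tri: "\<And>x y. x \<in> X \<Longrightarrow> y \<in> X \<Longrightarrow> N (x + y) \<le> N x + N y"
    and hom: "\<And>c x. x \<in> X \<Longrightarrow> N (sX c x) = norm c * N x"
    and compl: "MX.mcomplete"
    using ban by (auto simp: banach_on_def)
  have T_add: "T (x + y) = T x + T y" and T_scale: "T (sX c x) = s c (T x)"
    if "x \<in> X" "y \<in> X" for x y c
    using lin that by (auto simp: linear_on_def)
  have X0: "0 \<in> X" by (rule VX.subspace_0[OF sub])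
  have T0: "T 0 = 0" using T_scale[OF X0 X0, of 0] by simp
  have N0: "N 0 = 0" using hom[OF X0, of 0] by simp
  have T_diff: "T (x - y) = T x - T y" if "x \<in> X" "y \<in> X" for x y
    using T_add[of "x - y" y] VX.subspace_diff[OF sub] that by (simp add: eq_diff_eq)
  define Y where "Y = T ` X"
  have subY: "V.subspace Y"
    unfolding Y_def
  proof (rule V.subspaceI)
    show "0 \<in> T ` X" using T0 X0 by force
    show "y + y' \<in> T ` X" if "y \<in> T ` X" "y' \<in> T ` X" for y y'
      using that T_add VX.subspace_add[OF sub] by (force simp flip: T_add)
    show "s c y \<in> T ` X" if "y \<in> T ` X" for c y
      using that T_scale VX.subspace_scale[OF sub] by (force simp flip: T_scale)
  qed
  define Q where "Q y = (if y \<in> Y then Inf (N ` {x \<in> X. T x = y}) else 0)" for y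
  have bdd: "bdd_below (N ` {x \<in> X. T x = y})" for y
    using pos by (intro bdd_belowI[of _ 0]) auto
  have Q_le: "Q (T x) \<le> N x" if "x \<in> X" for x
    unfolding Q_def using that bdd by (auto simp: Y_def intro!: cInf_lower)
  have Q_ex: "\<exists>x\<in>X. T x = y \<and> N x < r" if "y \<in> Y" "Q y < r" for y r
  proof -
    have "N ` {x \<in> X. T x = y} \<noteq> {}" using that(1) by (auto simp: Y_def)
    from cInf_lessD[OF this, of r] that show ?thesis by (auto simp: Q_def)
  qed
  have Q_pos: "0 \<le> Q y" for y
  proof (cases "y \<in> Y")
    case True
    then have "N ` {x \<in> X. T x = y} \<noteq> {}" by (auto simp: Y_def)
    then have "0 \<le> Inf (N ` {x \<in> X. T x = y})" by (rule cInf_greatest) (use pos in auto)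
    then show ?thesis using True by (simp add: Q_def)
  qed (simp add: Q_def)
  have Q_tri: "Q (y + y') \<le> Q y + Q y'" if y: "y \<in> Y" "y' \<in> Y" for y y'
  proof (rule field_le_epsilon)
    fix e :: real assume "e > 0"
    obtain x where x: "x \<in> X" "T x = y" "N x < Q y + e / 2"
      using Q_ex[OF y(1), of "Q y + e / 2"] \<open>e > 0\<close> by auto
    obtain x' where x': "x' \<in> X" "T x' = y'" "N x' < Q y' + e / 2"
      using Q_ex[OF y(2), of "Q y' + e / 2"] \<open>e > 0\<close> by auto
    have "Q (y + y') \<le> N (x + x')"
      using Q_le[OF VX.subspace_add[OF sub x(1) x'(1)]] T_add x x' by simp
    then show "Q (y + y') \<le> Q y + Q y' + e" using tri[OF x(1) x'(1)] x(3) x'(3) by simp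
  qed
  have Q0: "Q 0 = 0" using Q_le[OF X0] Q_pos[of 0] T0 N0 by simp
  have Q_hom_le: "Q (s c y) \<le> norm c * Q y" if y: "y \<in> Y" for c y
  proof (rule field_le_epsilon)
    fix e :: real assume e: "e > 0"
    define d where "d = e / (norm c + 1)"
    have nc: "norm c + 1 > 0" using norm_ge_zero[of c] by linarith
    have "d > 0" using e nc by (simp add: d_def)
    then obtain x where x: "x \<in> X" "T x = y" "N x < Q y + d"
      using Q_ex[OF y, of "Q y + d"] by auto
    have "Q (s c y) \<le> N (sX c x)"
      using Q_le[OF VX.subspace_scale[OF sub x(1)]] T_scale[OF x(1) x(1)] x(2) by simp
    also have "\<dots> = norm c * N x" by (rule hom[OF x(1)])
    also have "\<dots> \<le> norm c * (Q y + d)" using x(3) by (intro mult_left_mono) auto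
    also have "\<dots> \<le> norm c * Q y + e"
    proof -
      have "norm c * d \<le> (norm c + 1) * d" using \<open>d > 0\<close> by (intro mult_right_mono) auto
      also have "\<dots> = e" using nc by (simp add: d_def)
      finally show ?thesis by (simp add: distrib_left)
    qed
    finally show "Q (s c y) \<le> norm c * Q y + e" .
  qed
  have Q_hom: "Q (s c y) = norm c * Q y" if y: "y \<in> Y" for c y
  proof (cases "c = 0")
    case True
    then show ?thesis using Q0 by simp
  next
    case False
    have "Q y \<le> norm (inverse c) * Q (s c y)"
      using Q_hom_le[of "s c y" "inverse c"] V.subspace_scale[OF subY y] False by simp
    then have "norm c * Q y \<le> norm c * (inverse (norm c) * Q (s c y))"
      by (intro mult_left_mono) (simp_all add: norm_inverse)
    then have "norm c * Q y \<le> Q (s c y)"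
      using False by (simp flip: mult.assoc)
    then show ?thesis using Q_hom_le[OF y, of c] by simp
  qed
  have closed: "closedin (prod_topology MX.mtopology F) ((\<lambda>x. (x, T x)) ` X)"
    using graph by (simp add: closed_graph_def norm_topology_def)
  \<comment> \<open>a point off the graph has a product neighbourhood that misses it\<close>
  have sep: "\<exists>r>0. \<exists>W. openin F W \<and> f \<in> W \<and> (\<forall>u\<in>X. N (x - u) < r \<longrightarrow> T u \<notin> W)"
    if "x \<in> X" "f \<in> topspace F" "f \<noteq> T x" for x f
  proof -
    define G where "G = topspace (prod_topology MX.mtopology F) - (\<lambda>x. (x, T x)) ` X"
    have "openin (prod_topology MX.mtopology F) G" unfolding G_def using closed by blast
    moreover have "(x, f) \<in> G" using that by (auto simp: G_def)
    ultimately have "\<exists>A W. openin MX.mtopology A \<and> openin F W \<and> x \<in> A \<and> f \<in> W \<and> A \<times> W \<subseteq> G"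
      by (rule openin_prod_topology_alt[THEN iffD1, rule_format])
    then obtain A W where AW: "openin MX.mtopology A" "openin F W" "x \<in> A" "f \<in> W" "A \<times> W \<subseteq> G"
      by (elim exE conjE)
    then obtain r where r: "r > 0" "MX.mball x r \<subseteq> A" unfolding MX.openin_mtopology by blast
    have "T u \<notin> W" if u: "u \<in> X" "N (x - u) < r" for u
    proof
      assume "T u \<in> W"
      moreover have "u \<in> A" using r(2) u \<open>x \<in> X\<close> by (intro subsetD[OF r(2)]) simp
      ultimately have "(u, T u) \<in> G" using AW(5) by blast
      then show False using u(1) by (simp add: G_def)
    qed
    then show ?thesis using r(1) AW(2,4) by blast
  qed
  have Q_def0: "y = 0" if y: "y \<in> Y" "Q y = 0" for y
  proof (rule ccontr)
    assume "y \<noteq> 0"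
    moreover have "y \<in> topspace F" using y(1) range by (auto simp: Y_def)
    ultimately obtain r W where r: "r > 0" "y \<in> W"
      "\<And>u. u \<in> X \<Longrightarrow> N (0 - u) < r \<Longrightarrow> T u \<notin> W"
      using sep[OF X0, of y] T0 by metis
    obtain x where "x \<in> X" "T x = y" "N x < r" using Q_ex[OF y(1), of r] y(2) r(1) by auto
    then show False using r(2) r(3)[of x] MX.commute[of 0 x] by auto
  qed
  have Q_neg: "Q (- y) = Q y" if "y \<in> Y" for y
    using Q_hom[OF that, of "- 1"] by simp
  interpret MY: Metric_space Y "\<lambda>x y. Q (x - y)"
  proof
    show "0 \<le> Q (x - y)" for x y by (rule Q_pos)
    show "Q (x - y) = Q (y - x)" for x y
    proof (cases "x - y \<in> Y")
      case True
      then show ?thesis using Q_neg[of "x - y"] by simp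
    next
      case False
      then have "y - x \<notin> Y" using V.subspace_neg[OF subY, of "y - x"] by auto
      then show ?thesis using False by (simp add: Q_def)
    qed
    show "Q (x - y) = 0 \<longleftrightarrow> x = y" if "x \<in> Y" "y \<in> Y" for x y
      using Q_def0[of "x - y"] V.subspace_diff[OF subY that] Q0 by auto
    show "Q (x - z) \<le> Q (x - y) + Q (y - z)" if "x \<in> Y" "y \<in> Y" "z \<in> Y" for x y z
      using Q_tri[of "x - y" "y - z"] V.subspace_diff[OF subY] that by simp
  qed
  have complY: "MY.mcomplete"
    unfolding MY.mcomplete_def
  proof (intro allI impI)
    fix \<sigma> assume cau: "MY.MCauchy \<sigma>"
    then have \<sigma>Y: "\<sigma> n \<in> Y" for n by (auto simp: MY.MCauchy_def)
    have "\<exists>M. \<forall>n n'. M \<le> n \<longrightarrow> M \<le> n' \<longrightarrow> Q (\<sigma> n - \<sigma> n') < (1/2) ^ k" for k :: nat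
      using cau unfolding MY.MCauchy_def by simp
    then obtain M where M: "\<And>k n n'. M k \<le> n \<Longrightarrow> M k \<le> n' \<Longrightarrow> Q (\<sigma> n - \<sigma> n') < (1/2) ^ k"
      by metis
    define r where "r k = (\<Sum>i\<le>k. M i) + k" for k :: nat
    have r: "strict_mono r" by (rule strict_monoI_Suc) (simp add: r_def)
    have Mr: "M k \<le> r k" for k
      unfolding r_def by (intro trans_le_add1 member_le_sum) auto
    have "\<exists>z\<in>X. T z = \<sigma> (r (Suc k)) - \<sigma> (r k) \<and> N z < (1/2) ^ k" for k
    proof (rule Q_ex)
      show "\<sigma> (r (Suc k)) - \<sigma> (r k) \<in> Y" by (intro V.subspace_diff[OF subY] \<sigma>Y)
      have "M k \<le> r (Suc k)" using Mr[of k] strict_monoD[OF r, of k "Suc k"] by simp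
      then show "Q (\<sigma> (r (Suc k)) - \<sigma> (r k)) < (1/2) ^ k" by (intro M Mr)
    qed
    then obtain z where z: "\<And>k. z k \<in> X" "\<And>k. T (z k) = \<sigma> (r (Suc k)) - \<sigma> (r k)"
      "\<And>k. N (z k) < (1/2) ^ k" by metis
    define S where "S n = (\<Sum>k<n. z k)" for n
    have SX: "S n \<in> X" for n unfolding S_def by (intro VX.subspace_sum[OF sub] z)
    have TS: "T (S n) = \<sigma> (r n) - \<sigma> (r 0)" for n
    proof (induction n)
      case 0
      then show ?case using T0 by (simp add: S_def)
    next
      case (Suc n)
      have "T (S (Suc n)) = T (S n) + T (z n)" using T_add[OF SX z(1)] by (simp add: S_def)
      then show ?case using Suc z(2) by simp
    qed
    have step: "N (S (n + j) - S n) \<le> 2 * (1/2) ^ n - 2 * (1/2) ^ (n + j)" for n j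
    proof (induction j)
      case 0
      then show ?case using N0 by simp
    next
      case (Suc j)
      have "S (n + Suc j) - S n = (S (n + j) - S n) + z (n + j)"
        by (simp add: S_def)
      then have "N (S (n + Suc j) - S n) \<le> N (S (n + j) - S n) + N (z (n + j))"
        by (simp only: tri[OF VX.subspace_diff[OF sub SX SX] z(1)])
      also have "\<dots> \<le> 2 * (1/2) ^ n - 2 * (1/2) ^ (n + j) + (1/2) ^ (n + j)"
        using Suc z(3)[of "n + j"] by simp
      also have "\<dots> = 2 * (1/2) ^ n - 2 * (1/2) ^ (n + Suc j)" by simp
      finally show ?case .
    qed
    have le: "N (S m - S n) \<le> 2 * (1/2) ^ n" if "n \<le> m" for m n
    proof -
      have "(0 :: real) \<le> (1/2) ^ m" by simp
      moreover have "N (S m - S n) \<le> 2 * (1/2) ^ n - 2 * (1/2) ^ m"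
        using step[of n "m - n"] that by simp
      ultimately show ?thesis by linarith
    qed
    have "MX.MCauchy S"
      unfolding MX.MCauchy_def
    proof (intro conjI allI impI)
      show "range S \<subseteq> X" using SX by auto
      fix e :: real assume "e > 0"
      then obtain K where K: "(1/2) ^ K < e / 2" using real_arch_pow_inv[of "e/2" "1/2"] by auto
      have bound: "N (S m - S n) < e" if "K \<le> n" "n \<le> m" for m n
      proof -
        have "(1/2 :: real) ^ n \<le> (1/2) ^ K" using that by (intro power_decreasing) auto
        then show ?thesis using le[OF that(2)] K by linarith
      qed
      have "N (S n - S n') < e" if "K \<le> n" "K \<le> n'" for n n'
        using bound[of n n'] bound[of n' n] that MX.commute[of "S n" "S n'"] by (cases "n \<le> n'") auto
      then show "\<exists>K. \<forall>n n'. K \<le> n \<longrightarrow> K \<le> n' \<longrightarrow> N (S n - S n') < e" by blast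
    qed
    then obtain x where "limitin MX.mtopology S x sequentially"
      using compl unfolding MX.mcomplete_def by blast
    then have x: "x \<in> X" "\<And>e. e > 0 \<Longrightarrow> \<forall>\<^sub>F n in sequentially. S n \<in> X \<and> N (S n - x) < e"
      by (auto simp: MX.limitin_metric)
    define l where "l = \<sigma> (r 0) + T x"
    have lY: "l \<in> Y" unfolding l_def using x(1) by (intro V.subspace_add[OF subY] \<sigma>Y) (simp add: Y_def)
    have "limitin MY.mtopology (\<sigma> \<circ> r) l sequentially"
      unfolding MY.limitin_metric
    proof (intro conjI allI impI lY)
      fix e :: real assume "e > 0"
      from x(2)[OF this]
      show "\<forall>\<^sub>F n in sequentially. (\<sigma> \<circ> r) n \<in> Y \<and> Q ((\<sigma> \<circ> r) n - l) < e"
      proof eventually_elim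
        case (elim n)
        have "T (S n - x) = (\<sigma> \<circ> r) n - l" using T_diff[OF SX x(1)] TS by (simp add: l_def)
        then show ?case using Q_le[OF VX.subspace_diff[OF sub SX x(1)], of n] elim \<sigma>Y by simp
      qed
    qed
    then show "\<exists>l. limitin MY.mtopology \<sigma> l sequentially"
      using MY.MCauchy_convergent_subsequence[OF cau r] by blast
  qed
  have banY: "banach_on s Y Q"
  proof -
    have "\<forall>y. y \<notin> Y \<longrightarrow> Q y = 0" by (simp add: Q_def)
    then show ?thesis
      unfolding banach_on_def using vs subY Q_pos Q_def0 Q_tri Q_hom complY by blast
  qed
  have closedY: "closed_graph Y Q F (\<lambda>y. y)"
  proof -
    let ?G = "(\<lambda>y. (y, y)) ` Y" and ?P = "prod_topology MY.mtopology F"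
    have "openin ?P (topspace ?P - ?G)"
      unfolding openin_prod_topology_alt
    proof (intro allI impI)
      fix y f assume "(y, f) \<in> topspace ?P - ?G"
      then have y: "y \<in> Y" and f: "f \<in> topspace F" "f \<noteq> y" by auto
      obtain x where x: "x \<in> X" "T x = y" using y by (auto simp: Y_def)
      obtain r W where r: "r > 0" "openin F W" "f \<in> W"
        "\<And>u. u \<in> X \<Longrightarrow> N (x - u) < r \<Longrightarrow> T u \<notin> W"
        using sep[OF x(1) f(1)] f(2) x(2) by auto
      have "y' \<notin> W" if y': "y' \<in> Y" "Q (y - y') < r" for y'
      proof -
        obtain z where z: "z \<in> X" "T z = y - y'" "N z < r"
          using Q_ex[OF V.subspace_diff[OF subY y y'(1)] y'(2)] by blast
        have "T (x - z) = y'" using T_diff[OF x(1) z(1)] x(2) z(2) by simp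
        then show ?thesis using r(4)[of "x - z"] VX.subspace_diff[OF sub x(1) z(1)] z(3) by simp
      qed
      then have "MY.mball y r \<times> W \<subseteq> topspace ?P - ?G"
        using openin_subset[OF r(2)] by auto
      then show "\<exists>U V. openin MY.mtopology U \<and> openin F V \<and> y \<in> U \<and> f \<in> V \<and>
                   U \<times> V \<subseteq> topspace ?P - ?G"
        using r(1-3) y
        by - (rule exI[of _ "MY.mball y r"], rule exI[of _ W], simp add: Q0)
    qed
    moreover have "?G \<subseteq> topspace ?P"
      using range unfolding Y_def[symmetric] by auto
    ultimately show ?thesis by (simp add: closed_graph_def norm_topology_def closedin_def)
  qed
  have "continuous_map (norm_topology Y Q) F (\<lambda>y. y)"
    using BC[unfolded BC_space_def, rule_format, of Y Q "\<lambda>y. y"] banY closedY range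
    by (auto simp: linear_on_def Y_def)
  moreover have "continuous_map (norm_topology X N) (norm_topology Y Q) T"
    unfolding norm_topology_def MX.metric_continuous_map[OF MY.Metric_space_axioms]
  proof (intro conjI ballI allI impI)
    show "T ` X \<subseteq> Y" by (simp add: Y_def)
    fix a and e :: real assume a: "a \<in> X" and "e > 0"
    have "Q (T a - T x) < e" if "x \<in> X" "N (a - x) < e" for x
      using Q_le[OF VX.subspace_diff[OF sub a that(1)]] T_diff[OF a that(1)] that(2) by simp
    then show "\<exists>d>0. \<forall>x. x \<in> X \<and> N (a - x) < d \<longrightarrow> Q (T a - T x) < e"
      using \<open>e > 0\<close> by blast
  qed
  ultimately have "continuous_map (norm_topology X N) F ((\<lambda>y. y) \<circ> T)"
    by (rule continuous_map_compose[rotated])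
  then show ?thesis by (simp add: comp_def)
qed

section \<open>Spaces of functionals and operators, and the epsilon product\<close>

text \<open>
  The topology on a set \<open>H\<close> of maps into \<open>Y\<close> of uniform convergence on the members of \<open>\<S>\<close>:
  the sets \<open>{v \<in> H. \<forall>x\<in>\<Union>\<A>. v x - u x \<in> V}\<close>, for finite \<open>\<A> \<subseteq> \<S>\<close> and zero neighbourhoods
  \<open>V\<close> of \<open>Y\<close>, form a neighbourhood base of \<open>u\<close>. (They need not be open, hence are not used as a
  subbase.)
\<close>

definition unif_topology ::
  "('a \<Rightarrow> 'y::ab_group_add) set \<Rightarrow> 'a set set \<Rightarrow> 'y topology \<Rightarrow> ('a \<Rightarrow> 'y) topology" where
  "unif_topology H \<S> Y = topology (\<lambda>W. W \<subseteq> H \<and>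
     (\<forall>u\<in>W. \<exists>\<A> V. finite \<A> \<and> \<A> \<subseteq> \<S> \<and> openin Y V \<and> 0 \<in> V \<and>
        {v \<in> H. \<forall>x\<in>\<Union>\<A>. v x - u x \<in> V} \<subseteq> W))"

lemma openin_unif_topology:
  "openin (unif_topology H \<S> Y) W \<longleftrightarrow> W \<subseteq> H \<and>
     (\<forall>u\<in>W. \<exists>\<A> V. finite \<A> \<and> \<A> \<subseteq> \<S> \<and> openin Y V \<and> 0 \<in> V \<and>
        {v \<in> H. \<forall>x\<in>\<Union>\<A>. v x - u x \<in> V} \<subseteq> W)"
proof -
  define B where "B \<A> V u = {v \<in> H. \<forall>x\<in>\<Union>\<A>. v x - u x \<in> V}" for \<A> V and u :: "'a \<Rightarrow> 'b"
  define P where "P W u \<longleftrightarrow> (\<exists>\<A> V. finite \<A> \<and> \<A> \<subseteq> \<S> \<and> openin Y V \<and> 0 \<in> V \<and> B \<A> V u \<subseteq> W)"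
    for W u
  have B_Int: "B (\<A> \<union> \<A>') (V \<inter> V') u \<subseteq> B \<A> V u \<inter> B \<A>' V' u" for \<A> \<A>' V V' u
    unfolding B_def by blast
  have int: "P (W \<inter> W') u" if W: "P W u" and W': "P W' u" for W W' u
  proof -
    obtain \<A> V where 1: "finite \<A>" "\<A> \<subseteq> \<S>" "openin Y V" "0 \<in> V" "B \<A> V u \<subseteq> W"
      using W unfolding P_def by blast
    obtain \<A>' V' where 2: "finite \<A>'" "\<A>' \<subseteq> \<S>" "openin Y V'" "0 \<in> V'" "B \<A>' V' u \<subseteq> W'"
      using W' unfolding P_def by blast
    have "B (\<A> \<union> \<A>') (V \<inter> V') u \<subseteq> W \<inter> W'"
      using B_Int 1(5) 2(5) by blast
    moreover have "finite (\<A> \<union> \<A>')" "\<A> \<union> \<A>' \<subseteq> \<S>" "openin Y (V \<inter> V')" "0 \<in> V \<inter> V'"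
      using 1(1-4) 2(1-4) by auto
    ultimately show ?thesis
      unfolding P_def by blast
  qed
  have mono: "P W' u" if "P W u" "W \<subseteq> W'" for W W' u
    using that unfolding P_def by blast
  have "istopology (\<lambda>W. W \<subseteq> H \<and> (\<forall>u\<in>W. P W u))"
    unfolding istopology_def
  proof (rule conjI; intro allI impI)
    fix W W' assume "W \<subseteq> H \<and> (\<forall>u\<in>W. P W u)" "W' \<subseteq> H \<and> (\<forall>u\<in>W'. P W' u)"
    then show "W \<inter> W' \<subseteq> H \<and> (\<forall>u\<in>W \<inter> W'. P (W \<inter> W') u)"
      using int by blast
  next
    fix \<K> assume "\<forall>K\<in>\<K>. K \<subseteq> H \<and> (\<forall>u\<in>K. P K u)"
    then show "\<Union>\<K> \<subseteq> H \<and> (\<forall>u\<in>\<Union>\<K>. P (\<Union>\<K>) u)"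
      using mono by (meson Sup_least UnionE Union_upper)
  qed
  then have "openin (topology (\<lambda>W. W \<subseteq> H \<and> (\<forall>u\<in>W. P W u))) W \<longleftrightarrow> W \<subseteq> H \<and> (\<forall>u\<in>W. P W u)"
    by (simp only: topology_inverse')
  then show ?thesis
    unfolding unif_topology_def P_def B_def .
qed

lemma topspace_unif_topology:
  assumes "0 \<in> topspace Y"
  shows "topspace (unif_topology H \<S> Y) = H"
proof
  show "topspace (unif_topology H \<S> Y) \<subseteq> H"
    using openin_unif_topology[of H \<S> Y "topspace (unif_topology H \<S> Y)"] by simp
  have "openin (unif_topology H \<S> Y) H"
    unfolding openin_unif_topology using assms
    by (intro conjI ballI exI[of _ "{}"] exI[of _ "topspace Y"]) auto
  then show "H \<subseteq> topspace (unif_topology H \<S> Y)" by (rule openin_subset)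
qed

definition equicontinuous_on_space :: "'v topology \<Rightarrow> ('v \<Rightarrow> 'k::real_or_complex) set \<Rightarrow> bool" where
  "equicontinuous_on_space T H \<longleftrightarrow>
     (\<forall>x\<in>topspace T. \<forall>e>0. \<exists>W. openin T W \<and> x \<in> W \<and> (\<forall>\<phi>\<in>H. \<forall>y\<in>W. norm (\<phi> y - \<phi> x) < e))"

definition dual_kappa ::
  "('k::real_or_complex \<Rightarrow> 'v::ab_group_add \<Rightarrow> 'v) \<Rightarrow> 'v topology \<Rightarrow> ('v \<Rightarrow> 'k) topology" where
  "dual_kappa s T = unif_topology (dual s T) {C. abs_convex_in s C \<and> compactin T C} euclidean"

definition eps_carrier ::
  "('k::real_or_complex \<Rightarrow> 'v::ab_group_add \<Rightarrow> 'v) \<Rightarrow> 'v topology \<Rightarrow>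
   ('k \<Rightarrow> 'e::ab_group_add \<Rightarrow> 'e) \<Rightarrow> 'e topology \<Rightarrow> (('v \<Rightarrow> 'k) \<Rightarrow> 'e) set" where
  "eps_carrier s F sE E = {u. linear_on (fscale (*)) sE (dual s F) u \<and>
     continuous_map (dual_kappa s F) E u \<and> (\<forall>\<phi>. \<phi> \<notin> dual s F \<longrightarrow> u \<phi> = 0)}"

definition eps_product ::
  "('k::real_or_complex \<Rightarrow> 'v::ab_group_add \<Rightarrow> 'v) \<Rightarrow> 'v topology \<Rightarrow>
   ('k \<Rightarrow> 'e::ab_group_add \<Rightarrow> 'e) \<Rightarrow> 'e topology \<Rightarrow> (('v \<Rightarrow> 'k) \<Rightarrow> 'e) topology" where
  "eps_product s F sE E =
     unif_topology (eps_carrier s F sE E) {H. H \<subseteq> dual s F \<and> equicontinuous_on_space F H} E"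


section \<open>Compatible function spaces\<close>

text \<open>
  From here on \<open>F\<close> is the topology of the scalar-valued function space and \<open>FE\<close> that of the
  \<open>E\<close>-valued one. The domain of the functions is the (non-empty) type \<open>'w\<close>; the vector space
  \<open>E\<close> is a whole type.
\<close>

abbreviation fun_dual :: "('w \<Rightarrow> 'k::real_or_complex) topology \<Rightarrow> (('w \<Rightarrow> 'k) \<Rightarrow> 'k) set" where
  "fun_dual F \<equiv> dual (fscale (*)) F"

abbreviation fun_eps ::
  "('w \<Rightarrow> 'k::real_or_complex) topology \<Rightarrow> ('k \<Rightarrow> 'e::ab_group_add \<Rightarrow> 'e) \<Rightarrow> 'e topology \<Rightarrow>
   ((('w \<Rightarrow> 'k) \<Rightarrow> 'k) \<Rightarrow> 'e) topology" where
  "fun_eps F sE E \<equiv> eps_product (fscale (*)) F sE E"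

definition point_eval :: "('w \<Rightarrow> 'k::real_or_complex) topology \<Rightarrow> 'w \<Rightarrow> ('w \<Rightarrow> 'k) \<Rightarrow> 'k" where
  "point_eval F x = zero_ext (topspace F) (\<lambda>f. f x)"

definition S_map ::
  "('w \<Rightarrow> 'k::real_or_complex) topology \<Rightarrow> ((('w \<Rightarrow> 'k) \<Rightarrow> 'k) \<Rightarrow> 'e) \<Rightarrow> 'w \<Rightarrow> 'e" where
  "S_map F u = (\<lambda>x. u (point_eval F x))"

definition eps_into_compatible ::
  "('k::real_or_complex \<Rightarrow> 'e::ab_group_add \<Rightarrow> 'e) \<Rightarrow> 'e topology \<Rightarrow>
   ('w \<Rightarrow> 'k) topology \<Rightarrow> ('w \<Rightarrow> 'e) topology \<Rightarrow> bool" where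
  "eps_into_compatible sE E F FE \<longleftrightarrow>
     lcHs (fscale (*)) F \<and> lcHs (fscale sE) FE \<and>
     (\<forall>x. point_eval F x \<in> fun_dual F) \<and>
     linear_on (fscale sE) (fscale sE) (topspace (fun_eps F sE E)) (S_map F) \<and>
     embedding_map (fun_eps F sE E) FE (S_map F)"


section \<open>Families of operators and sets of uniqueness\<close>

text \<open>
  \<open>T m f x\<close> is \<open>T\<^sub>m(f)(x)\<close>; it is only meaningful for \<open>f \<in> D m\<close>, the domain of \<open>T\<^sub>m\<close>,
  and \<open>x \<in> \<omega> m\<close>.
\<close>

definition linear_family ::
  "('k::real_or_complex \<Rightarrow> 'v::ab_group_add \<Rightarrow> 'v) \<Rightarrow> 'm set \<Rightarrow> ('m \<Rightarrow> 'x set) \<Rightarrow>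
   ('m \<Rightarrow> ('w \<Rightarrow> 'v) set) \<Rightarrow> ('m \<Rightarrow> ('w \<Rightarrow> 'v) \<Rightarrow> 'x \<Rightarrow> 'v) \<Rightarrow> bool" where
  "linear_family s M \<omega> D T \<longleftrightarrow>
     (\<forall>m\<in>M. module.subspace (fscale s) (D m) \<and>
        (\<forall>x\<in>\<omega> m. linear_on (fscale s) s (D m) (\<lambda>f. T m f x)))"

definition T_at ::
  "('w \<Rightarrow> 'k::real_or_complex) topology \<Rightarrow> ('m \<Rightarrow> ('w \<Rightarrow> 'k) \<Rightarrow> 'x \<Rightarrow> 'k) \<Rightarrow> 'm \<Rightarrow> 'x \<Rightarrow>
   ('w \<Rightarrow> 'k) \<Rightarrow> 'k" where
  "T_at F TK m x = zero_ext (topspace F) (\<lambda>f. TK m f x)"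

definition consistent_family ::
  "('k::real_or_complex \<Rightarrow> 'e::ab_group_add \<Rightarrow> 'e) \<Rightarrow> 'e topology \<Rightarrow>
   ('w \<Rightarrow> 'k) topology \<Rightarrow> ('w \<Rightarrow> 'e) topology \<Rightarrow> 'm set \<Rightarrow> ('m \<Rightarrow> 'x set) \<Rightarrow>
   ('m \<Rightarrow> ('w \<Rightarrow> 'k) \<Rightarrow> 'x \<Rightarrow> 'k) \<Rightarrow> ('m \<Rightarrow> ('w \<Rightarrow> 'e) \<Rightarrow> 'x \<Rightarrow> 'e) \<Rightarrow> bool" where
  "consistent_family sE E F FE M \<omega> TK TE \<longleftrightarrow>
     (\<forall>u\<in>topspace (fun_eps F sE E). \<forall>m\<in>M. \<forall>x\<in>\<omega> m.
        S_map F u \<in> topspace FE \<and> T_at F TK m x \<in> fun_dual F \<and>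
        TE m (S_map F u) x = u (T_at F TK m x))"

definition strong_family ::
  "('k::real_or_complex \<Rightarrow> 'e::ab_group_add \<Rightarrow> 'e) \<Rightarrow> 'e topology \<Rightarrow>
   ('w \<Rightarrow> 'k) topology \<Rightarrow> ('w \<Rightarrow> 'e) topology \<Rightarrow> 'm set \<Rightarrow> ('m \<Rightarrow> 'x set) \<Rightarrow>
   ('m \<Rightarrow> ('w \<Rightarrow> 'k) \<Rightarrow> 'x \<Rightarrow> 'k) \<Rightarrow> ('m \<Rightarrow> ('w \<Rightarrow> 'e) \<Rightarrow> 'x \<Rightarrow> 'e) \<Rightarrow> bool" where
  "strong_family sE E F FE M \<omega> TK TE \<longleftrightarrow>
     (\<forall>e'\<in>dual sE E. \<forall>f\<in>topspace FE. \<forall>m\<in>M. \<forall>x\<in>\<omega> m.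
        e' \<circ> f \<in> topspace F \<and> TK m (e' \<circ> f) x = e' (TE m f x))"

definition set_of_uniqueness ::
  "('w \<Rightarrow> 'k::real_or_complex) topology \<Rightarrow> 'm set \<Rightarrow> ('m \<Rightarrow> 'x set) \<Rightarrow>
   ('m \<Rightarrow> ('w \<Rightarrow> 'k) \<Rightarrow> 'x \<Rightarrow> 'k) \<Rightarrow> ('m \<times> 'x) set \<Rightarrow> bool" where
  "set_of_uniqueness F M \<omega> TK U \<longleftrightarrow>
     U \<subseteq> Sigma M \<omega> \<and> (\<forall>(m, x)\<in>U. T_at F TK m x \<in> fun_dual F) \<and>
     (\<forall>f\<in>topspace F. (\<forall>(m, x)\<in>U. TK m f x = 0) \<longrightarrow> f = 0)"


section \<open>Weakly extensible functions and the restriction map\<close>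

definition extends_weakly ::
  "('w \<Rightarrow> 'k::real_or_complex) topology \<Rightarrow> ('m \<Rightarrow> ('w \<Rightarrow> 'k) \<Rightarrow> 'x \<Rightarrow> 'k) \<Rightarrow> ('m \<times> 'x) set \<Rightarrow>
   ('m \<times> 'x \<Rightarrow> 'e) \<Rightarrow> ('e \<Rightarrow> 'k) \<Rightarrow> ('w \<Rightarrow> 'k) \<Rightarrow> bool" where
  "extends_weakly F TK U f e' g \<longleftrightarrow>
     g \<in> topspace F \<and> (\<forall>(m, x)\<in>U. TK m g x = (e' \<circ> f) (m, x))"

definition weak_function_space ::
  "('k::real_or_complex \<Rightarrow> 'e::ab_group_add \<Rightarrow> 'e) \<Rightarrow> 'e topology \<Rightarrow> ('w \<Rightarrow> 'k) topology \<Rightarrow>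
   ('m \<Rightarrow> ('w \<Rightarrow> 'k) \<Rightarrow> 'x \<Rightarrow> 'k) \<Rightarrow> ('m \<times> 'x) set \<Rightarrow> ('m \<times> 'x \<Rightarrow> 'e) set" where
  "weak_function_space sE E F TK U =
     {f \<in> U \<rightarrow>\<^sub>E topspace E. \<forall>e'\<in>dual sE E. \<exists>g. extends_weakly F TK U f e' g}"

definition weak_extension ::
  "('w \<Rightarrow> 'k::real_or_complex) topology \<Rightarrow> ('m \<Rightarrow> ('w \<Rightarrow> 'k) \<Rightarrow> 'x \<Rightarrow> 'k) \<Rightarrow> ('m \<times> 'x) set \<Rightarrow>
   ('m \<times> 'x \<Rightarrow> 'e) \<Rightarrow> ('e \<Rightarrow> 'k) \<Rightarrow> 'w \<Rightarrow> 'k" where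
  "weak_extension F TK U f e' = (THE g. extends_weakly F TK U f e' g)"

definition R_transpose ::
  "('k::real_or_complex \<Rightarrow> 'e::ab_group_add \<Rightarrow> 'e) \<Rightarrow> 'e topology \<Rightarrow> ('w \<Rightarrow> 'k) topology \<Rightarrow>
   ('m \<Rightarrow> ('w \<Rightarrow> 'k) \<Rightarrow> 'x \<Rightarrow> 'k) \<Rightarrow> ('m \<times> 'x) set \<Rightarrow> ('m \<times> 'x \<Rightarrow> 'e) \<Rightarrow>
   (('w \<Rightarrow> 'k) \<Rightarrow> 'k) \<Rightarrow> ('e \<Rightarrow> 'k) \<Rightarrow> 'k" where
  "R_transpose sE E F TK U f y = zero_ext (dual sE E) (\<lambda>e'. y (weak_extension F TK U f e'))"

definition J_map ::
  "('k::real_or_complex \<Rightarrow> 'e::ab_group_add \<Rightarrow> 'e) \<Rightarrow> 'e topology \<Rightarrow> 'e \<Rightarrow> ('e \<Rightarrow> 'k) \<Rightarrow> 'k" where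
  "J_map sE E x = zero_ext (dual sE E) (\<lambda>e'. e' x)"

definition restriction_map ::
  "('m \<Rightarrow> ('w \<Rightarrow> 'e) \<Rightarrow> 'x \<Rightarrow> 'e) \<Rightarrow> ('m \<times> 'x) set \<Rightarrow> ('w \<Rightarrow> 'e) \<Rightarrow> 'm \<times> 'x \<Rightarrow> 'e" where
  "restriction_map TE U f = (\<lambda>(m, x)\<in>U. TE m f x)"

end

theory Submission
  imports Defs
begin

text \<open>
  For \<open>f \<in> \<F>\<^sub>E\<^sub>'(U, E)\<close> the map \<open>R: e' \<mapsto> f\<^sub>e\<^sub>'\<close> is linear by uniqueness. On the functionals dominated
  by a continuous seminorm \<open>p\<close> of \<open>E\<close>, a Banach space, it has closed graph, hence is continuous since
  \<open>\<F>(\<Omega>)\<close> is a BC-space; as \<open>\<F>(\<Omega>)\<close> is semi-Montel, \<open>R\<close> maps the polar \<open>{e'. \<bar>e'\<bar> \<le> p}\<close> into an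
  absolutely convex compact set. If every \<open>y \<circ> R\<close> with \<open>y \<in> \<F>(\<Omega>)'\<close> is evaluation at a point \<open>u(y)\<close>
  of \<open>E\<close>, this compactness makes \<open>u\<close> continuous on \<open>\<F>(\<Omega>)'\<^sub>\<kappa>\<close>, and \<open>S(u)\<close> restricts to \<open>f\<close>. The point
  \<open>u(y)\<close> is a limit of points representing functionals that converge to \<open>y\<close> on absolutely convex
  compact sets: those of hypothesis (ii), or, if \<open>E\<close> is complete, linear combinations of the
  \<open>T\<^sub>m\<^sub>,\<^sub>x\<close> with \<open>(m, x) \<in> U\<close>, which are represented by the same combinations of the \<open>f(m, x)\<close>.
\<close>

text \<open>The dual of \<open>E\<close> need not carry a Banach norm, so \<open>R\<close> is
  studied on one space of dominated functionals at a time. The closed unit ball of that space is the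
  polar ball of \<open>p\<close>, and by the Hahn-Banach theorem \<open>p x\<close> is the largest
  modulus at \<open>x\<close> of its members. An estimate in \<open>E\<close> is thus an estimate
  uniform on a polar ball, and since \<open>R\<close> maps this ball into a compact set, uniform
  convergence on compact sets of \<open>F\<close> supplies it.

  For complete \<open>E\<close> an arbitrary functional has to be approximated by combinations of
  the \<open>T_at\<close> uniformly on a compact set, that is, their span has to be dense for
  \<open>dual_kappa\<close>. Instead of identifying the dual of that space, the proof uses
  compactness to reduce to finitely many coordinates and separates there. Both uses of the
  Hahn-Banach theorem prescribe lower bounds on a cone instead of values on a subspace, which
  determines the form in which it is proved. The approximants depend on the seminorm and form no
  sequence, so they are collected in a filter.\<close>

section \<open>The scalar field\<close>

text \<open>Taking \<open>i = 0\<close> over the reals lets one formula recover a scalar from real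
  parts over both fields; over the complex numbers the imaginary part of \<open>z\<close> is
  \<open>- re (i * z)\<close>.\<close>

lemma real_part_exists:
  obtains re :: "'k::real_or_complex \<Rightarrow> real" and i :: 'k where
    "linear re" "re 1 = 1" "\<And>z. \<bar>re z\<bar> \<le> norm z" "i = 0 \<or> i * i = - 1"
    "\<And>z. z = of_real (re z) - of_real (re (i * z)) * i"
proof -
  from real_or_complex[where 'a = 'k] show thesis
  proof
    assume "\<forall>z::'k. \<exists>a. z = a *\<^sub>R 1"
    then obtain re :: "'k \<Rightarrow> real" where re: "\<And>z. z = of_real (re z)"
      unfolding of_real_def by metis
    have inj: "re z = a" if "z = of_real a" for z a
      using re[of z] that by (metis of_real_eq_iff)
    have "linear re"
    proof
      show "re (x + y) = re x + re y" for x y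
        by (rule inj) (metis re of_real_add)
      show "re (r *\<^sub>R x) = r *\<^sub>R re x" for r x
        by (rule inj) (metis re of_real_mult real_scaleR_def scaleR_conv_of_real)
    qed
    moreover have "\<bar>re z\<bar> \<le> norm z" for z
      by (subst (2) re[of z]) (simp del: of_real_eq_iff)
    ultimately show thesis
      using that[of re 0] re inj[of 1 1] by simp
  next
    assume "\<exists>i::'k. i * i = - 1 \<and> (\<forall>z. \<exists>a b. z = a *\<^sub>R 1 + b *\<^sub>R i) \<and>
          (\<forall>a b. norm (a *\<^sub>R 1 + b *\<^sub>R i) = sqrt (a * a + b * b))"
    then obtain i :: 'k where i: "i * i = - 1" and ex: "\<And>z. \<exists>a b. z = a *\<^sub>R 1 + b *\<^sub>R i"
      and nrm: "\<And>a b. norm (a *\<^sub>R 1 + b *\<^sub>R i) = sqrt (a * a + b * b)"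
      by blast
    obtain re im :: "'k \<Rightarrow> real" where z: "\<And>z. z = re z *\<^sub>R 1 + im z *\<^sub>R i"
      using ex by metis
    \<comment> \<open>The norm formula makes \<open>1\<close> and \<open>i\<close> linearly
      independent over the reals, so the chosen coordinates are the only ones and inherit
      linearity.\<close>
    have uniq: "re z = a \<and> im z = b" if "z = a *\<^sub>R 1 + b *\<^sub>R i" for z a b
    proof -
      have "(re z - a) *\<^sub>R 1 + (im z - b) *\<^sub>R i = 0"
        using z[of z] that by (simp add: algebra_simps)
      then have "sqrt ((re z - a) * (re z - a) + (im z - b) * (im z - b)) = 0"
        using nrm by (metis norm_zero)
      then show ?thesis
        by (simp add: sum_squares_eq_zero_iff)
    qed
    have "linear re"
    proof
      show "re (x + y) = re x + re y" for x y
        using uniq[of "x + y" "re x + re y" "im x + im y"] z[of x] z[of y]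
        by (metis (no_types, lifting) add.assoc add.left_commute scaleR_add_left)
      show "re (r *\<^sub>R x) = r *\<^sub>R re x" for r x
        using uniq[of "r *\<^sub>R x" "r * re x" "r * im x"] z[of x]
        by (metis real_scaleR_def scaleR_add_right scaleR_scaleR)
    qed
    moreover have "re 1 = 1"
      using uniq[of 1 1 0] by simp
    moreover have "\<bar>re w\<bar> \<le> norm w" for w
    proof -
      have "norm w = sqrt (re w * re w + im w * im w)"
        by (subst z[of w]) (rule nrm)
      then show ?thesis
        using real_sqrt_sum_squares_ge1[of "re w" "im w"] abs_le_square_iff
        by (metis power2_eq_square real_sqrt_abs real_sqrt_le_iff le_add_same_cancel1 zero_le_square)
    qed
    moreover have "im w = - re (i * w)" for w
    proof -
      have "i * w = i * (re w *\<^sub>R 1 + im w *\<^sub>R i)" using z[of w] by simp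
      also have "\<dots> = (- im w) *\<^sub>R 1 + re w *\<^sub>R i"
        using i by (simp add: algebra_simps)
      finally have "re (i * w) = - im w" using uniq by blast
      then show ?thesis by simp
    qed
    then have "w = of_real (re w) - of_real (re (i * w)) * i" for w
      using z[of w] by (simp add: of_real_def)
    ultimately show thesis
      using that[of re i] i by blast
  qed
qed

text \<open>Both \<open>re z\<close> and \<open>re (i * z)\<close> are bounded linear in
  \<open>z\<close>, and \<open>z\<close> is recovered continuously from them, so completeness is
  inherited from the reals.\<close>

lemma real_or_complex_Cauchy_convergent:
  fixes X :: "nat \<Rightarrow> 'k::real_or_complex"
  assumes "Cauchy X"
  shows "convergent X"
proof -
  obtain re :: "'k \<Rightarrow> real" and i :: 'k where re: "linear re" "\<And>z. \<bar>re z\<bar> \<le> norm z"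
    and z: "\<And>z. z = of_real (re z) - of_real (re (i * z)) * i"
    using real_part_exists[where 'k = 'k] by metis
  have bl: "bounded_linear re"
    using re by (intro linear_conv_bounded_linear[THEN iffD1] bounded_linear_intro[of _ 1])
      (auto simp: linear_add linear_scale)
  have "convergent (\<lambda>n. re (X n))"
    using bounded_linear.Cauchy[OF bl assms] by (simp add: Cauchy_convergent)
  moreover have "convergent (\<lambda>n. re (i * X n))"
    using bounded_linear.Cauchy[OF bl bounded_linear.Cauchy[OF bounded_linear_mult_right assms]]
    by (simp add: Cauchy_convergent)
  ultimately obtain a b where "(\<lambda>n. re (X n)) \<longlonglongrightarrow> a" "(\<lambda>n. re (i * X n)) \<longlonglongrightarrow> b"
    unfolding convergent_def by blast
  then have "(\<lambda>n. of_real (re (X n)) - of_real (re (i * X n)) * i) \<longlonglongrightarrow> of_real a - of_real b * i"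
    by (intro tendsto_intros)
  then show ?thesis
    unfolding z[symmetric] by (rule convergentI)
qed

text \<open>The functional \<open>f(x) - f(ix) i\<close>, where \<open>i = 0\<close> for real scalars.\<close>

lemma complexification:
  fixes s :: "'k::real_or_complex \<Rightarrow> 'v::ab_group_add \<Rightarrow> 'v" and f :: "'v \<Rightarrow> real"
  assumes "vector_space s" and add: "\<And>x y. f (x + y) = f x + f y"
    and scale: "\<And>t x. f (s (of_real t) x) = t * f x"
    and p: "\<And>x. f x \<le> p x" and p_scale: "\<And>c x. p (s c x) = norm c * p x"
    and re: "linear re" "re (1::'k) = 1" "i = 0 \<or> i * i = - 1"
      "\<And>z. z = of_real (re z) - of_real (re (i * z)) * i"
  obtains \<phi> where "linear_on s (*) UNIV \<phi>" "\<And>x. re (\<phi> x) = f x" "\<And>x. norm (\<phi> x) \<le> p x"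
proof -
  interpret vector_space s by fact
  define \<phi> where "\<phi> x = of_real (f x) - of_real (f (s i x)) * i" for x
  have re_of_real: "re (of_real a * z) = a * re z" for a z
    using re(1) by (metis linear_scale real_scaleR_def scaleR_conv_of_real)
  have re_mult: "re z = a" if "z = of_real a - of_real b * i" for z a b
  proof (cases "i = 0")
    case True
    then show ?thesis using that re_of_real[of a 1] re(2) by simp
  next
    case False
    then have ii: "i * i = - 1" using re(3) by simp
    \<comment> \<open>The decomposition applied to \<open>i\<close> itself reads
      \<open>i = re i + i\<close>, which forces \<open>re i = 0\<close>.\<close>
    have "i = of_real (re i) - of_real (re (- 1)) * i"
      using re(4)[of i] ii by simp
    moreover have "re (- 1) = - 1" using re(1,2) by (simp add: linear_neg)
    ultimately have "re i = 0" by simp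
    moreover have "re z = a * re 1 - b * re i"
      using that re_of_real[of a 1] re_of_real[of b i] by (simp add: linear_diff[OF re(1)])
    ultimately show ?thesis using re(2) by simp
  qed
  have \<phi>_add: "\<phi> (x + y) = \<phi> x + \<phi> y" for x y
    by (simp add: \<phi>_def add scale_right_distrib algebra_simps)
  have \<phi>_real: "\<phi> (s (of_real t) x) = of_real t * \<phi> x" for t x
  proof -
    have "s i (s (of_real t) x) = s (of_real t) (s i x)" by (simp add: mult.commute)
    then show ?thesis by (simp only: \<phi>_def scale of_real_mult right_diff_distrib mult.assoc)
  qed
  have \<phi>_i: "\<phi> (s i x) = i * \<phi> x" for x
  proof (cases "i = 0")
    case True
    then show ?thesis using scale[of 0 0] by (simp add: \<phi>_def)
  next
    case False
    then have ii: "i * i = - 1" using re(3) by simp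
    then have "s i (s i x) = s (of_real (- 1)) x" by simp
    then have "\<phi> (s i x) = of_real (f (s i x)) + of_real (f x) * i"
      by (simp only: \<phi>_def scale) simp
    also have "\<dots> = of_real (f x) * i - of_real (f (s i x)) * (i * i)"
      by (simp add: ii)
    also have "\<dots> = i * \<phi> x"
      by (simp only: \<phi>_def right_diff_distrib mult.assoc mult.left_commute mult.commute)
    finally show ?thesis .
  qed
  have \<phi>_neg: "\<phi> (- x) = - \<phi> x" for x
    using \<phi>_real[of "- 1" x] by simp
  have \<phi>_scale: "\<phi> (s c x) = c * \<phi> x" for c x
  proof -
    have "s c x = s (of_real (re c)) x - s (of_real (re (i * c))) (s i x)"
      by (subst re(4)[of c]) (simp only: scale_left_diff_distrib scale_scale)
    then have "\<phi> (s c x) = of_real (re c) * \<phi> x - of_real (re (i * c)) * (i * \<phi> x)"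
      using \<phi>_add[of "s (of_real (re c)) x" "- s (of_real (re (i * c))) (s i x)"]
      by (simp only: \<phi>_real \<phi>_i \<phi>_neg diff_conv_add_uminus)
    also have "\<dots> = c * \<phi> x"
      by (subst (3) re(4)[of c]) (simp add: algebra_simps)
    finally show ?thesis .
  qed
  have re_\<phi>: "re (\<phi> x) = f x" for x
    by (rule re_mult[OF \<phi>_def])
  have "norm (\<phi> x) \<le> p x" for x
  proof (cases "\<phi> x = 0")
    case True
    \<comment> \<open>Nonnegativity of \<open>p\<close> comes from \<open>f x + f (- x) = 0\<close>,
      since \<open>p\<close> dominates \<open>f\<close> and takes the same value at \<open>x\<close>
      and \<open>- x\<close>.\<close>
    have "0 \<le> p x + p (s (- 1) x)"
      using p[of x] p[of "s (- 1) x"] add[of x "s (- 1) x"] scale[of 0 0] by simp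
    then show ?thesis using True p_scale[of "- 1" x] by simp
  next
    case False
    \<comment> \<open>Multiplying \<open>x\<close> by this scalar of modulus 1 makes the value of
      the functional real and nonnegative, and there it equals \<open>f\<close>, which
      \<open>p\<close> dominates.\<close>
    define c where "c = of_real (norm (\<phi> x)) / \<phi> x"
    have c: "norm c = 1" "\<phi> (s c x) = of_real (norm (\<phi> x))"
      using False by (simp_all add: c_def \<phi>_scale norm_divide)
    have "norm (\<phi> x) = re (\<phi> (s c x))"
      using re_of_real[of "norm (\<phi> x)" 1] re(2) c(2) by simp
    also have "\<dots> \<le> p x"
      using p[of "s c x"] p_scale[of c x] c(1) re_\<phi> by simp
    finally show ?thesis .
  qed
  then show thesis
    using that[of \<phi>] \<phi>_add \<phi>_scale re_\<phi> by (simp add: linear_on_def)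
qed


section \<open>The Hahn--Banach theorem\<close>

definition sublinear :: "(real \<Rightarrow> 'v \<Rightarrow> 'v) \<Rightarrow> ('v::ab_group_add \<Rightarrow> real) \<Rightarrow> bool" where
  "sublinear s p \<longleftrightarrow> (\<forall>x y. p (x + y) \<le> p x + p y) \<and> (\<forall>t>0. \<forall>x. p (s t x) = t * p x)"

text \<open>A pair \<open>(v, r)\<close> in \<open>G\<close> is a demand that a functional be at
  least \<open>r\<close> at \<open>v\<close>. The witness \<open>q x = inf (p (x + v) - r)\<close>
  is the largest sublinear functional below \<open>p\<close> with \<open>q (- v) \<le> - r\<close>
  on \<open>G\<close>; a linear functional below \<open>q\<close> then meets every demand, because
  its value at \<open>v\<close> is minus its value at \<open>- v\<close>.\<close>

lemma sublinear_cone_envelope: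
  fixes s :: "real \<Rightarrow> 'v::ab_group_add \<Rightarrow> 'v"
  assumes "vector_space s" and p: "sublinear s p"
    and G0: "(0, 0) \<in> G"
    and G_add: "\<And>v r w q. (v, r) \<in> G \<Longrightarrow> (w, q) \<in> G \<Longrightarrow> (v + w, r + q) \<in> G"
    and G_scale: "\<And>t v r. t > 0 \<Longrightarrow> (v, r) \<in> G \<Longrightarrow> (s t v, t * r) \<in> G"
    and G_le: "\<And>v r. (v, r) \<in> G \<Longrightarrow> r \<le> p v"
  obtains q where "sublinear s q" "q \<le> p" "\<And>v r. (v, r) \<in> G \<Longrightarrow> q (- v) \<le> - r"
proof -
  interpret vector_space s by fact
  have p_add: "p (x + y) \<le> p x + p y" and p_scale: "t > 0 \<Longrightarrow> p (s t x) = t * p x" for x y t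
    using p by (auto simp: sublinear_def)
  have p0: "p 0 = 0" using p_scale[of 2 0] by simp
  define q where "q x = (INF (v, r)\<in>G. p (x + v) - r)" for x
  \<comment> \<open>This keeps the infimum finite:
    \<open>r \<le> p v \<le> p (x + v) + p (- x)\<close>.\<close>
  have lower: "- p (- x) \<le> p (x + v) - r" if "(v, r) \<in> G" for x v r
    using p_add[of "x + v" "- x"] G_le[OF that] by simp
  have bdd: "bdd_below ((\<lambda>(v, r). p (x + v) - r) ` G)" for x
    using lower by (intro bdd_belowI2[of _ "- p (- x)"]) auto
  have q_le: "q x \<le> p (x + v) - r" if "(v, r) \<in> G" for x v r
    unfolding q_def using cINF_lower[OF bdd that] by simp
  have q_ex: "\<exists>(v, r)\<in>G. p (x + v) - r < a" if "q x < a" for x a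
    using cINF_less_iff[OF _ bdd, of x a] that G0 unfolding q_def by (fastforce simp: case_prod_beta)
  have q_scale_le: "q (s t x) \<le> t * q x" if "t > 0" for t x
  proof (rule field_le_epsilon)
    fix e :: real assume "e > 0"
    then obtain v r where vr: "(v, r) \<in> G" "p (x + v) - r < q x + e / t"
      using q_ex[of x "q x + e / t"] \<open>t > 0\<close> by auto
    have "q (s t x) \<le> p (s t x + s t v) - t * r"
      by (rule q_le[OF G_scale[OF \<open>t > 0\<close> vr(1)]])
    also have "\<dots> = t * (p (x + v) - r)"
      using p_scale[OF \<open>t > 0\<close>] by (simp add: algebra_simps flip: scale_right_distrib)
    also have "\<dots> \<le> t * (q x + e / t)"
      using vr(2) \<open>t > 0\<close> by (intro mult_left_mono) auto
    finally show "q (s t x) \<le> t * q x + e"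
      using \<open>t > 0\<close> by (simp add: algebra_simps)
  qed
  have "sublinear s q"
    unfolding sublinear_def
  proof (intro conjI allI impI)
    show "q (x + y) \<le> q x + q y" for x y
    proof (rule field_le_epsilon)
      fix e :: real assume "e > 0"
      obtain v r where vr: "(v, r) \<in> G" "p (x + v) - r < q x + e / 2"
        using q_ex[of x "q x + e / 2"] \<open>e > 0\<close> by auto
      obtain w r' where wr: "(w, r') \<in> G" "p (y + w) - r' < q y + e / 2"
        using q_ex[of y "q y + e / 2"] \<open>e > 0\<close> by auto
      show "q (x + y) \<le> q x + q y + e"
        using q_le[OF G_add[OF vr(1) wr(1)], of "x + y"] p_add[of "x + v" "y + w"] vr(2) wr(2)
        by (simp add: algebra_simps)
    qed
    show "q (s t x) = t * q x" if "t > 0" for t x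
    proof (rule antisym)
      show "q (s t x) \<le> t * q x" using that by (rule q_scale_le)
      have "q x \<le> inverse t * q (s t x)"
        using q_scale_le[of "inverse t" "s t x"] that by simp
      then show "t * q x \<le> q (s t x)" using that by (simp add: field_simps)
    qed
  qed
  moreover have "q \<le> p"
    using q_le[OF G0] by (simp add: le_fun_def)
  moreover have "q (- v) \<le> - r" if "(v, r) \<in> G" for v r
    using q_le[OF that, of "- v"] p0 by simp
  ultimately show thesis using that by blast
qed

text \<open>Zorn's lemma for the reversed pointwise order. The pointwise infimum of a chain is
  finite because sublinear functionals below \<open>p\<close> are bounded below at \<open>x\<close>
  by \<open>- p (- x)\<close>.\<close>

lemma minimal_sublinear_exists:
  fixes s :: "real \<Rightarrow> 'v::ab_group_add \<Rightarrow> 'v"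
  assumes p: "sublinear s p"
  obtains q where "sublinear s q" "q \<le> p" "\<And>q'. sublinear s q' \<Longrightarrow> q' \<le> q \<Longrightarrow> q' = q"
proof -
  define A where "A = {q. sublinear s q \<and> q \<le> p}"
  have "\<exists>m\<in>A. \<forall>a\<in>A. m \<ge> a \<longrightarrow> a = m"
  proof (rule predicate_Zorn)
    show "partial_order_on A (relation_of (\<ge>) A)"
      by (rule partial_order_on_relation_ofI) auto
    fix C assume C: "C \<in> Chains (relation_of (\<ge>) A)"
    then have CA: "C \<subseteq> A" and lin: "\<And>q q'. q \<in> C \<Longrightarrow> q' \<in> C \<Longrightarrow> q \<le> q' \<or> q' \<le> q"
      by (auto simp: Chains_def relation_of_def)
    show "\<exists>u\<in>A. \<forall>a\<in>C. a \<ge> u"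
    proof (cases "C = {}")
      case True
      then show ?thesis using p by (auto simp: A_def)
    next
      case False
      define u where "u x = (INF q\<in>C. q x)" for x
      have Cadd: "q (x + y) \<le> q x + q y" and Cscale: "t > 0 \<Longrightarrow> q (s t x) = t * q x"
        and Cp: "q x \<le> p x" if "q \<in> C" for q x y t
        using CA that by (auto simp: A_def sublinear_def le_fun_def)
      have lower: "- p (- x) \<le> q x" if "q \<in> C" for q x
      proof -
        have "q 0 \<le> q 0 + q 0" using Cadd[OF that, of 0 0] by simp
        then show ?thesis
          using Cadd[OF that, of x "- x"] Cp[OF that, of "- x"] by simp
      qed
      have bdd: "bdd_below ((\<lambda>q. q x) ` C)" for x
        using lower by (intro bdd_belowI2)
      have u_le: "u x \<le> q x" if "q \<in> C" for q x
        unfolding u_def using cINF_lower[OF bdd that] .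
      have u_ex: "\<exists>q\<in>C. q x < a" if "u x < a" for x a
        using cINF_less_iff[OF False bdd] that unfolding u_def by simp
      have "sublinear s u"
        unfolding sublinear_def
      proof (intro conjI allI impI)
        show "u (x + y) \<le> u x + u y" for x y
        proof (rule field_le_epsilon)
          fix e :: real assume "e > 0"
          then obtain q q' where q: "q \<in> C" "q x < u x + e / 2" "q' \<in> C" "q' y < u y + e / 2"
            using u_ex[of x "u x + e / 2"] u_ex[of y "u y + e / 2"] by auto
          \<comment> \<open>Of two members of a chain the smaller one is nearly optimal at both
            points, so subadditivity can be used for a single functional.\<close>
          from lin[OF q(1,3)] obtain m where "m \<in> C" "m x \<le> q x" "m y \<le> q' y"
            using q(1,3) by (auto simp: le_fun_def)
          then show "u (x + y) \<le> u x + u y + e"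
            using u_le[of m "x + y"] Cadd[of m x y] q(2,4) by simp
        qed
        show "u (s t x) = t * u x" if "t > 0" for t x
        proof (rule antisym)
          have "u (s t x) / t \<le> u x"
            unfolding u_def[of x]
          proof (rule cINF_greatest[OF False])
            show "u (s t x) / t \<le> q x" if "q \<in> C" for q
              using u_le[OF that, of "s t x"] Cscale[OF that \<open>t > 0\<close>] \<open>t > 0\<close>
              by (simp add: field_simps)
          qed
          then show "u (s t x) \<le> t * u x" using that by (simp add: field_simps)
          show "t * u x \<le> u (s t x)"
            unfolding u_def[of "s t x"]
          proof (rule cINF_greatest[OF False])
            show "t * u x \<le> q (s t x)" if "q \<in> C" for q
              using u_le[OF that, of x] Cscale[OF that \<open>t > 0\<close>] \<open>t > 0\<close> by simp
          qed
        qed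
      qed
      moreover have "u \<le> p"
        using False u_le Cp by (fastforce simp: le_fun_def intro: order_trans)
      ultimately show ?thesis
        using u_le by (auto simp: A_def le_fun_def)
    qed
  qed
  then obtain q where "q \<in> A" "\<And>a. a \<in> A \<Longrightarrow> a \<le> q \<Longrightarrow> a = q" by blast
  then show thesis using that[of q] by (auto simp: A_def)
qed

text \<open>A minimal sublinear functional below the envelope of \<open>G\<close> is already linear.
  The set \<open>G\<close> need not be the graph of a function, which allows lower bounds indexed by
  the points of a compact set.\<close>

theorem Hahn_Banach_cone:
  fixes s :: "real \<Rightarrow> 'v::ab_group_add \<Rightarrow> 'v"
  assumes vs: "vector_space s" and p: "sublinear s p"
    and G0: "(0, 0) \<in> G"
    and G_add: "\<And>v r w q. (v, r) \<in> G \<Longrightarrow> (w, q) \<in> G \<Longrightarrow> (v + w, r + q) \<in> G"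
    and G_scale: "\<And>t v r. t > 0 \<Longrightarrow> (v, r) \<in> G \<Longrightarrow> (s t v, t * r) \<in> G"
    and G_le: "\<And>v r. (v, r) \<in> G \<Longrightarrow> r \<le> p v"
  obtains f where "\<And>x y. f (x + y) = f x + f y" "\<And>t x. f (s t x) = t * f x"
    "\<And>x. f x \<le> p x" "\<And>v r. (v, r) \<in> G \<Longrightarrow> r \<le> f v"
proof -
  interpret vector_space s by fact
  obtain q where q: "sublinear s q" "q \<le> p" "\<And>v r. (v, r) \<in> G \<Longrightarrow> q (- v) \<le> - r"
    using sublinear_cone_envelope[OF assms] by blast
  obtain f where f: "sublinear s f" "f \<le> q" "\<And>f'. sublinear s f' \<Longrightarrow> f' \<le> f \<Longrightarrow> f' = f"
    using minimal_sublinear_exists[OF q(1)] by blast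
  have f_add: "f (x + y) \<le> f x + f y" and f_scale: "t > 0 \<Longrightarrow> f (s t x) = t * f x" for x y t
    using f(1) by (auto simp: sublinear_def)
  have f0: "f 0 = 0" using f_scale[of 2 0] by simp
  have neg: "f (- y) \<le> - f y" for y
  proof -
    \<comment> \<open>The envelope of \<open>f\<close> for the ray through \<open>(y, f y)\<close>
      lies below \<open>f\<close>, hence equals \<open>f\<close> by minimality; its defining bound
      at \<open>- y\<close> is the missing inequality.\<close>
    define H where "H = {(s t y, t * f y) | t. t \<ge> 0}"
    have "(0, 0) \<in> H" by (auto simp: H_def intro!: exI[of _ 0])
    moreover have "(v + w, r + r') \<in> H" if vw: "(v, r) \<in> H" "(w, r') \<in> H" for v w r r'
    proof -
      obtain t where "t \<ge> 0" "v = s t y" "r = t * f y"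
        using vw(1) by (auto simp: H_def)
      moreover obtain t' where "t' \<ge> 0" "w = s t' y" "r' = t' * f y"
        using vw(2) by (auto simp: H_def)
      ultimately show ?thesis
        by (auto simp: H_def scale_left_distrib distrib_right intro!: exI[of _ "t + t'"])
    qed
    moreover have "(s t v, t * r) \<in> H" if "t > 0" and v: "(v, r) \<in> H" for t v r
    proof -
      obtain t' where "t' \<ge> 0" "v = s t' y" "r = t' * f y" using v by (auto simp: H_def)
      then show ?thesis using \<open>t > 0\<close> by (auto simp: H_def intro!: exI[of _ "t * t'"])
    qed
    moreover have "r \<le> f v" if v: "(v, r) \<in> H" for v r
    proof -
      obtain t where "t \<ge> 0" "v = s t y" "r = t * f y" using v by (auto simp: H_def)
      then show ?thesis using f_scale[of t y] f0 by (cases "t = 0") auto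
    qed
    ultimately obtain g where g: "sublinear s g" "g \<le> f" "\<And>v r. (v, r) \<in> H \<Longrightarrow> g (- v) \<le> - r"
      using sublinear_cone_envelope[OF vs f(1)] by blast
    have "(y, f y) \<in> H" by (auto simp: H_def intro!: exI[of _ 1])
    then show ?thesis using f(3)[OF g(1,2)] g(3) by blast
  qed
  have f_neg: "f (- y) = - f y" for y
    using neg[of y] f_add[of y "- y"] f0 by simp
  have add: "f (x + y) = f x + f y" for x y
    using f_add[of x y] f_add[of "- x" "- y"] f_neg[of x] f_neg[of y] f_neg[of "x + y"]
    by (simp add: algebra_simps)
  have "f (s t x) = t * f x" for t x
  proof (cases t "0 :: real" rule: linorder_cases)
    case less
    then have "f (s (- t) x) = - t * f x" using f_scale[of "- t" x] by simp
    then show ?thesis using f_neg[of "s t x"] by simp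
  qed (use f_scale f0 in auto)
  moreover have "f x \<le> p x" for x
    using f(2) q(2) by (meson le_fun_def order_trans)
  moreover have "r \<le> f v" if "(v, r) \<in> G" for v r
  proof -
    have "f (- v) \<le> q (- v)" using f(2) by (simp add: le_fun_def)
    then show ?thesis using q(3)[OF that] f_neg[of v] by simp
  qed
  ultimately show thesis using that[of f] add by blast
qed


section \<open>Continuous seminorms\<close>

lemma lcHs_add:
  assumes "lcHs s T" "continuous_map X T f" "continuous_map X T g"
  shows "continuous_map X T (\<lambda>x. f x + g x)"
proof -
  have "continuous_map X T ((\<lambda>(x, y). x + y) \<circ> (\<lambda>x. (f x, g x)))"
    using assms by (intro continuous_map_compose[of _ "prod_topology T T"] continuous_map_pairedI)
      (simp_all add: lcHs_def)
  then show ?thesis by (simp add: comp_def)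
qed

lemma lcHs_scale:
  assumes "lcHs s T" "continuous_map X euclidean c" "continuous_map X T f"
  shows "continuous_map X T (\<lambda>x. s (c x) (f x))"
proof -
  have "continuous_map X T ((\<lambda>(c, x). s c x) \<circ> (\<lambda>x. (c x, f x)))"
    using assms by (intro continuous_map_compose[of _ "prod_topology euclidean T"] continuous_map_pairedI)
      (simp_all add: lcHs_def)
  then show ?thesis by (simp add: comp_def)
qed

lemma vector_space_of_real:
  fixes s :: "'k::real_or_complex \<Rightarrow> 'v::ab_group_add \<Rightarrow> 'v"
  assumes "vector_space s"
  shows "vector_space (\<lambda>t. s (of_real t))"
proof -
  interpret vector_space s by fact
  show ?thesis by unfold_locales (simp_all add: scale_right_distrib scale_left_distrib)
qed

lemma continuous_map_metric_iff:
  fixes f :: "'a \<Rightarrow> 'b::metric_space"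
  shows "continuous_map X euclidean f \<longleftrightarrow>
    (\<forall>x\<in>topspace X. \<forall>e>0. \<exists>W. openin X W \<and> x \<in> W \<and> (\<forall>y\<in>W. dist (f x) (f y) < e))"
  using Met_TC.continuous_map_to_metric[of X f] by simp

text \<open>The balls are taken in the whole type because the definition is meant for spaces whose
  carrier is a whole type. Nonnegativity follows from the first two clauses.\<close>

definition continuous_seminorm ::
  "('k::real_or_complex \<Rightarrow> 'v::ab_group_add \<Rightarrow> 'v) \<Rightarrow> 'v topology \<Rightarrow> ('v \<Rightarrow> real) \<Rightarrow> bool" where
  "continuous_seminorm s T p \<longleftrightarrow> (\<forall>x y. p (x + y) \<le> p x + p y) \<and>
     (\<forall>c x. p (s c x) = norm c * p x) \<and> (\<forall>r>0. openin T {x. p x < r})"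

lemma continuous_seminorm_nonneg:
  assumes "vector_space s" "continuous_seminorm s T p"
  shows "p 0 = 0" "0 \<le> p x"
proof -
  interpret vector_space s by fact
  have tri: "p (x + y) \<le> p x + p y" and hom: "p (s c x) = norm c * p x" for x y c
    using assms(2) by (auto simp: continuous_seminorm_def)
  show "p 0 = 0" using hom[of 0 0] by simp
  then show "0 \<le> p x" using tri[of x "- x"] hom[of "- 1" x] by simp
qed

lemma continuous_seminorm_max:
  assumes "continuous_seminorm s T p" "continuous_seminorm s T q"
  shows "continuous_seminorm s T (\<lambda>x. max (p x) (q x))"
proof -
  have "{x. max (p x) (q x) < r} = {x. p x < r} \<inter> {x. q x < r}" for r by auto
  then have "openin T {x. max (p x) (q x) < r}" if "r > 0" for r
    using assms that by (auto simp: continuous_seminorm_def)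
  moreover have "max (p (x + y)) (q (x + y)) \<le> max (p x) (q x) + max (p y) (q y)" for x y
  proof -
    have "p (x + y) \<le> p x + p y" "q (x + y) \<le> q x + q y"
      using assms by (auto simp: continuous_seminorm_def)
    then show ?thesis by linarith
  qed
  moreover have "max (p (s c x)) (q (s c x)) = norm c * max (p x) (q x)" for c x
    using assms by (simp add: continuous_seminorm_def max_mult_distrib_left)
  ultimately show ?thesis by (simp add: continuous_seminorm_def)
qed

lemma continuous_seminorm_mult:
  assumes "continuous_seminorm s T p" "a > 0"
  shows "continuous_seminorm s T (\<lambda>x. a * p x)"
proof -
  have "{x. a * p x < r} = {x. p x < r / a}" for r using assms(2) by (auto simp: field_simps)
  moreover have "a * p (x + y) \<le> a * p x + a * p y" for x y
    using assms by (simp add: continuous_seminorm_def flip: distrib_left)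
  ultimately show ?thesis
    using assms by (simp add: continuous_seminorm_def)
qed

lemma openin_seminorm_ball:
  assumes lc: "lcHs s T" and T: "topspace T = UNIV" and p: "continuous_seminorm s T p" and r: "r > 0"
  shows "openin T {y. p (y - x) < r}"
proof -
  have "continuous_map T T (\<lambda>y. y + - x)"
    using T by (intro lcHs_add[OF lc]) auto
  from openin_continuous_map_preimage[OF this, of "{x. p x < r}"] p r T
  show ?thesis by (simp add: continuous_seminorm_def)
qed

text \<open>The seminorm is the Minkowski gauge of a convex and balanced zero neighbourhood
  contained in \<open>W\<close>.\<close>

lemma continuous_seminorm_below:
  fixes s :: "'k::real_or_complex \<Rightarrow> 'v::ab_group_add \<Rightarrow> 'v"
  assumes lc: "lcHs s T" and T: "topspace T = UNIV" and W: "openin T W" "0 \<in> W"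
  obtains p where "continuous_seminorm s T p" "{x. p x < 1} \<subseteq> W"
proof -
  interpret vector_space s using lc by (simp add: lcHs_def)
  have pre: "openin T {x. s c (x + a) \<in> O'}" if "openin T O'" for O' c a
  proof -
    have "continuous_map T T (\<lambda>x. s c (x + a))"
      using T by (intro lcHs_scale[OF lc] lcHs_add[OF lc]) auto
    from openin_continuous_map_preimage[OF this that] T show ?thesis by simp
  qed
  obtain C N where C: "convex_in s C" "openin T N" "0 \<in> N" "N \<subseteq> C" "C \<subseteq> W"
    using lc W unfolding lcHs_def by blast
  \<comment> \<open>Convex neighbourhoods need not be balanced; passing to the balanced core
    \<open>D\<close> of \<open>C\<close> makes the gauge absolutely homogeneous.\<close>
  define D where "D = {x. \<forall>c. norm c \<le> 1 \<longrightarrow> s c x \<in> C}"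
  have D_bal: "s c x \<in> D" if "x \<in> D" "norm c \<le> 1" for c x
  proof -
    have "norm (a * c) \<le> 1" if "norm a \<le> 1" for a
      using mult_mono[OF that \<open>norm c \<le> 1\<close>] by (simp add: norm_mult)
    then show ?thesis using that by (auto simp: D_def)
  qed
  have D_conv: "s (of_real t) x + s (of_real (1 - t)) y \<in> D" if "x \<in> D" "y \<in> D" "0 \<le> t" "t \<le> 1" for t x y
    unfolding D_def
  proof (intro CollectI allI impI)
    fix c :: 'k assume "norm c \<le> 1"
    then have "s c x \<in> C" "s c y \<in> C" using that by (auto simp: D_def)
    then have "s (of_real t) (s c x) + s (of_real (1 - t)) (s c y) \<in> C"
      using C(1) that unfolding convex_in_def by (meson atLeastAtMost_iff)
    then show "s c (s (of_real t) x + s (of_real (1 - t)) y) \<in> C"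
      by (simp only: scale_right_distrib scale_left_commute[of _ c])
  qed
  have "D \<subseteq> C" by (auto simp: D_def dest: spec[of _ 1])
  obtain O' where O': "openin T O'" "0 \<in> O'" "O' \<subseteq> D"
  proof -
    have "continuous_map (prod_topology euclidean T) T (\<lambda>(c, x). s c x)"
      using lc by (simp add: lcHs_def)
    from openin_continuous_map_preimage[OF this C(2)]
    have "openin (prod_topology euclidean T) {z. (case z of (c, x) \<Rightarrow> s c x) \<in> N}"
      by (simp add: T)
    moreover have "(0, 0) \<in> {z. (case z of (c, x) \<Rightarrow> s c x) \<in> N}" using C(3) by simp
    ultimately have "\<exists>A B. openin euclidean A \<and> openin T B \<and> 0 \<in> A \<and> 0 \<in> B \<and>
        A \<times> B \<subseteq> {z. (case z of (c, x) \<Rightarrow> s c x) \<in> N}"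
      by (rule openin_prod_topology_alt[THEN iffD1, rule_format])
    then obtain A B where AB: "open A" "openin T B" "0 \<in> A" "0 \<in> B"
        "\<And>c x. c \<in> A \<Longrightarrow> x \<in> B \<Longrightarrow> s c x \<in> N"
      by force
    obtain d where d: "d > 0" "ball 0 d \<subseteq> A" using AB(1,3) openE by blast
    \<comment> \<open>Joint continuity at \<open>(0, 0)\<close> gives a radius \<open>d\<close> with
      \<open>c B \<subseteq> N\<close> whenever \<open>norm c < d\<close>. Hence the dilate
      \<open>c0 B\<close> lies in \<open>D\<close>, as scalars of modulus at most 1 keep
      \<open>c * c0\<close> below \<open>d\<close>.\<close>
    define c0 :: 'k where "c0 = of_real (d / 2)"
    have c0: "c0 \<noteq> 0" "norm c0 < d" using d(1) by (simp_all add: c0_def)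
    have "x \<in> D" if x: "s (inverse c0) (x + 0) \<in> B" for x
      unfolding D_def
    proof (intro CollectI allI impI)
      fix c :: 'k assume "norm c \<le> 1"
      then have "norm (c * c0) < d"
        using mult_right_mono[of "norm c" 1 "norm c0"] c0(2) by (simp add: norm_mult)
      then have "s (c * c0) (s (inverse c0) x) \<in> N"
        using AB(5)[of "c * c0" "s (inverse c0) x"] d(2) x by (auto simp del: scale_scale)
      moreover have "c * c0 * inverse c0 = c" using c0(1) by simp
      ultimately show "s c x \<in> C" using C(4) by auto
    qed
    moreover have "openin T {x. s (inverse c0) (x + 0) \<in> B}" by (rule pre[OF AB(2)])
    ultimately show thesis using that[of "{x. s (inverse c0) (x + 0) \<in> B}"] AB(4) by auto
  qed
  \<comment> \<open>The factors \<open>t\<close> with \<open>x\<close> in \<open>t D\<close>; their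
    infimum is the gauge of \<open>D\<close>.\<close>
  define S where "S x = {t. t > 0 \<and> s (of_real (inverse t)) x \<in> D}" for x
  define p where "p x = Inf (S x)" for x
  have S_ne: "S x \<noteq> {}" for x
  proof -
    have "continuous_map euclidean T (\<lambda>c. s c x)"
      using T by (intro lcHs_scale[OF lc]) auto
    from openin_continuous_map_preimage[OF this O'(1)]
    have "open {c. s c x \<in> O'}" by simp
    moreover have "0 \<in> {c. s c x \<in> O'}" using O'(2) by simp
    ultimately obtain d where d: "d > 0" "ball 0 d \<subseteq> {c. s c x \<in> O'}" using openE by blast
    have "of_real (d / 2) \<in> ball (0::'k) d" using d(1) by simp
    then have "s (of_real (d / 2)) x \<in> D" using d(2) O'(3) by blast
    then have "inverse (d / 2) \<in> S x" using d(1) by (simp add: S_def)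
    then show ?thesis by blast
  qed
  have S_pos: "t \<in> S x \<Longrightarrow> 0 < t" for t x by (simp add: S_def)
  have bdd: "bdd_below (S x)" for x by (rule bdd_belowI[of _ 0]) (simp add: S_def)
  have p_le: "p x \<le> t" if "t \<in> S x" for t x unfolding p_def using cInf_lower[OF that bdd] .
  have p_ex: "\<exists>t\<in>S x. t < a" if "p x < a" for x a
    using cInf_less_iff[OF S_ne bdd] that unfolding p_def by simp
  have S_up: "t' \<in> S x" if "t \<in> S x" "t \<le> t'" for t t' x
  proof -
    have pos: "0 < t" "0 < t'" using that by (auto simp: S_def)
    have "s (of_real (t / t')) (s (of_real (inverse t)) x) \<in> D"
      by (rule D_bal) (use that pos in \<open>auto simp: S_def norm_divide simp del: scale_scale\<close>)
    moreover have "of_real (t / t') * of_real (inverse t) = (of_real (inverse t') :: 'k)"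
      using pos by (simp add: field_simps)
    ultimately show ?thesis using pos by (simp add: S_def)
  qed
  have p_add: "p (x + y) \<le> p x + p y" for x y
  proof (rule field_le_epsilon)
    fix e :: real assume "e > 0"
    obtain t where t: "t \<in> S x" "t < p x + e / 2" using p_ex[of x "p x + e / 2"] \<open>e > 0\<close> by auto
    obtain t' where t': "t' \<in> S y" "t' < p y + e / 2" using p_ex[of y "p y + e / 2"] \<open>e > 0\<close> by auto
    have pos: "0 < t" "0 < t'" using t t' by (auto simp: S_def)
    \<comment> \<open>With this weight \<open>(x + y) / (t + t')\<close> is a convex combination of
      \<open>x / t\<close> and \<open>y / t'\<close>.\<close>
    define l where "l = t / (t + t')"
    have l: "0 \<le> l" "l \<le> 1" "l * inverse t = inverse (t + t')" "(1 - l) * inverse t' = inverse (t + t')"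
      using pos by (auto simp: l_def field_simps)
    have "s (of_real l) (s (of_real (inverse t)) x) + s (of_real (1 - l)) (s (of_real (inverse t')) y) \<in> D"
      using t t' l by (intro D_conv) (auto simp: S_def)
    then have "s (of_real (inverse (t + t'))) (x + y) \<in> D"
      by (simp only: scale_scale of_real_mult[symmetric] l scale_right_distrib)
    then have "t + t' \<in> S (x + y)" using pos by (simp add: S_def)
    then show "p (x + y) \<le> p x + p y + e" using p_le t(2) t'(2) by fastforce
  qed
  have p0: "p 0 = 0"
  proof -
    have "0 \<in> D" using O' by blast
    then have "S 0 = {0<..}" by (auto simp: S_def)
    then show ?thesis by (simp add: p_def)
  qed
  have p_le_scale: "p (s c x) \<le> norm c * p x" if "c \<noteq> 0" for c x
  proof (rule field_le_epsilon)
    fix e :: real assume "e > 0"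
    have nc: "norm c > 0" using that by simp
    obtain t where t: "t \<in> S x" "t < p x + e / norm c"
      using p_ex[of x "p x + e / norm c"] \<open>e > 0\<close> nc by auto
    have "s (c / of_real (norm c)) (s (of_real (inverse t)) x) \<in> D"
      by (rule D_bal) (use t(1) nc in \<open>auto simp: S_def norm_divide simp del: scale_scale\<close>)
    moreover have "c / of_real (norm c) * of_real (inverse t) = of_real (inverse (norm c * t)) * c"
      by (simp add: field_simps)
    ultimately have "norm c * t \<in> S (s c x)"
      using nc S_pos[OF t(1)] by (simp add: S_def)
    then have "p (s c x) \<le> norm c * t" by (rule p_le)
    also have "\<dots> \<le> norm c * (p x + e / norm c)" using t(2) by (intro mult_left_mono) auto
    finally show "p (s c x) \<le> norm c * p x + e" using nc by (simp add: distrib_left)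
  qed
  have p_scale: "p (s c x) = norm c * p x" for c x
  proof (cases "c = 0")
    case True
    then show ?thesis using p0 by simp
  next
    case False
    then have "p x \<le> inverse (norm c) * p (s c x)"
      using p_le_scale[of "inverse c" "s c x"] by (simp add: norm_inverse)
    then have "norm c * p x \<le> p (s c x)" using False by (simp add: field_simps)
    then show ?thesis using p_le_scale[OF False, of x] by simp
  qed
  have p_open: "openin T {x. p x < r}" for r
  proof (subst openin_subopen, intro ballI)
    fix x assume "x \<in> {x. p x < r}"
    then have r: "p x < r" by simp
    \<comment> \<open>A gauge value only satisfies \<open>p (y - x) \<le> d\<close>, so half of the
      gap is used to keep \<open>p y < r\<close> strict.\<close>
    define d where "d = (r - p x) / 2"
    have d: "d > 0" using r by (simp add: d_def)
    let ?O = "{y. s (of_real (inverse d)) (y + - x) \<in> O'}"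
    have "p y < r" if "y \<in> ?O" for y
    proof -
      have "d \<in> S (y - x)" using that O'(3) d by (auto simp: S_def)
      then have "p (y - x) \<le> d" by (rule p_le)
      moreover have "p y \<le> p (y - x) + p x" using p_add[of "y - x" x] by simp
      ultimately show ?thesis using r by (simp add: d_def)
    qed
    moreover have "x \<in> ?O" using O'(2) by simp
    ultimately show "\<exists>A. openin T A \<and> x \<in> A \<and> A \<subseteq> {x. p x < r}"
      using pre[OF O'(1), of "of_real (inverse d)" "- x"] by (intro exI[of _ ?O]) blast
  qed
  have "x \<in> W" if px: "p x < 1" for x
  proof -
    obtain t where "t \<in> S x" "t < 1" using p_ex[OF px] by blast
    then have "1 \<in> S x" using S_up[of t x 1] by simp
    then show ?thesis using \<open>D \<subseteq> C\<close> C(5) by (auto simp: S_def)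
  qed
  then show thesis
    using that[of p] p_add p_scale p_open by (auto simp: continuous_seminorm_def)
qed


section \<open>Functionals dominated by a seminorm\<close>

lemma dualD:
  assumes "\<phi> \<in> dual s T"
  shows "x \<in> topspace T \<Longrightarrow> y \<in> topspace T \<Longrightarrow> \<phi> (x + y) = \<phi> x + \<phi> y"
    "x \<in> topspace T \<Longrightarrow> \<phi> (s c x) = c * \<phi> x" "continuous_map T euclidean \<phi>"
    "x \<notin> topspace T \<Longrightarrow> \<phi> x = 0"
  using assms by (auto simp: dual_def linear_on_def)

lemma bounded_functional_in_dual:
  assumes lc: "lcHs s T" and T: "topspace T = UNIV" and p: "continuous_seminorm s T p"
    and lin: "linear_on s (*) UNIV \<phi>" and le: "\<And>x. norm (\<phi> x) \<le> a * p x"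
  shows "\<phi> \<in> dual s T"
proof -
  interpret vector_space s using lc by (simp add: lcHs_def)
  \<comment> \<open>The constant \<open>a\<close> may be zero or negative, while the tolerance has
    to be divided by a positive number.\<close>
  define b where "b = \<bar>a\<bar> + 1"
  have b: "b > 0" by (simp add: b_def)
  have le_b: "norm (\<phi> x) \<le> b * p x" for x
    using le[of x] mult_right_mono[of a b "p x"] continuous_seminorm_nonneg(2)[OF vector_space_axioms p, of x]
    by (auto simp: b_def intro: order_trans)
  have add: "\<phi> (x + y) = \<phi> x + \<phi> y" for x y using lin by (simp add: linear_on_def)
  have diff: "\<phi> (x - y) = \<phi> x - \<phi> y" for x y using add[of "x - y" y] by simp
  have "continuous_map T euclidean \<phi>"
    unfolding continuous_map_metric_iff
  proof (intro ballI allI impI)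
    fix x and e :: real assume "e > 0"
    have "dist (\<phi> x) (\<phi> y) < e" if "p (y - x) < e / b" for y
    proof -
      have "dist (\<phi> x) (\<phi> y) = norm (\<phi> (y - x))" by (simp add: diff dist_norm norm_minus_commute)
      also have "\<dots> \<le> b * p (y - x)" by (rule le_b)
      also have "\<dots> < e" using that b by (simp add: field_simps)
      finally show ?thesis .
    qed
    moreover have "openin T {y. p (y - x) < e / b}"
      using \<open>e > 0\<close> b by (intro openin_seminorm_ball[OF lc T p]) simp
    moreover have "x \<in> {y. p (y - x) < e / b}"
      using \<open>e > 0\<close> b continuous_seminorm_nonneg(1)[OF vector_space_axioms p] by simp
    ultimately show "\<exists>W. openin T W \<and> x \<in> W \<and> (\<forall>y\<in>W. dist (\<phi> x) (\<phi> y) < e)"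
      by blast
  qed
  then show ?thesis using lin T by (simp add: dual_def)
qed

lemma norming_functional:
  fixes s :: "'k::real_or_complex \<Rightarrow> 'v::ab_group_add \<Rightarrow> 'v"
  assumes lc: "lcHs s T" and T: "topspace T = UNIV" and p: "continuous_seminorm s T p"
  obtains \<phi> where "\<phi> \<in> dual s T" "\<And>y. norm (\<phi> y) \<le> p y" "p x \<le> norm (\<phi> x)"
proof -
  interpret vector_space s using lc by (simp add: lcHs_def)
  let ?s = "\<lambda>t. s (of_real t)"
  have tri: "p (x + y) \<le> p x + p y" and hom: "p (s c x) = norm c * p x" for x y c
    using p by (auto simp: continuous_seminorm_def)
  \<comment> \<open>The demands \<open>t * p x\<close> along the ray through \<open>x\<close> force
    the real functional to reach \<open>p x\<close> at \<open>x\<close>; they are dominated by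
    \<open>p\<close> with equality.\<close>
  define G where "G = {(?s t x, t * p x) | t. t \<ge> 0}"
  obtain f where f: "\<And>x y. f (x + y) = f x + f y" "\<And>t x. f (?s t x) = t * f x"
    "\<And>x. f x \<le> p x" "\<And>v r. (v, r) \<in> G \<Longrightarrow> r \<le> f v"
  proof (rule Hahn_Banach_cone[OF vector_space_of_real[OF vector_space_axioms], of p G])
    show "sublinear ?s p" by (simp add: sublinear_def tri hom)
    show "(0, 0) \<in> G" by (auto simp: G_def intro!: exI[of _ 0])
    show "(v + w, r + q) \<in> G" if vw: "(v, r) \<in> G" "(w, q) \<in> G" for v r w q
    proof -
      obtain t where "t \<ge> 0" "v = ?s t x" "r = t * p x" using vw(1) by (auto simp: G_def)
      moreover obtain t' where "t' \<ge> 0" "w = ?s t' x" "q = t' * p x" using vw(2) by (auto simp: G_def)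
      ultimately show ?thesis
        by (auto simp: G_def scale_left_distrib distrib_right intro!: exI[of _ "t + t'"])
    qed
    show "(?s t v, t * r) \<in> G" if "t > 0" and v: "(v, r) \<in> G" for t v r
    proof -
      obtain t' where "t' \<ge> 0" "v = ?s t' x" "r = t' * p x" using v by (auto simp: G_def)
      then show ?thesis using \<open>t > 0\<close> by (auto simp: G_def intro!: exI[of _ "t * t'"])
    qed
    show "r \<le> p v" if v: "(v, r) \<in> G" for v r
      using v by (auto simp: G_def hom)
  qed blast
  obtain re :: "'k \<Rightarrow> real" and i where re: "linear re" "re 1 = 1" "i = 0 \<or> i * i = - 1"
    "\<And>z. z = of_real (re z) - of_real (re (i * z)) * i" and re_le: "\<And>z. \<bar>re z\<bar> \<le> norm z"
    using real_part_exists[where 'k = 'k] by metis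
  obtain \<phi> where \<phi>: "linear_on s (*) UNIV \<phi>" "\<And>x. re (\<phi> x) = f x" "\<And>x. norm (\<phi> x) \<le> p x"
    using complexification[OF vector_space_axioms f(1,2,3) hom re] by blast
  have "(x, p x) \<in> G" by (auto simp: G_def intro!: exI[of _ 1])
  then have "p x \<le> norm (\<phi> x)" using f(4) \<phi>(2)[of x] re_le[of "\<phi> x"] by force
  moreover have "\<phi> \<in> dual s T"
    using bounded_functional_in_dual[OF lc T p \<phi>(1), of 1] \<phi>(3) by simp
  ultimately show thesis using that \<phi>(3) by blast
qed

lemma dual_seminorm:
  assumes T: "topspace T = UNIV" and \<phi>: "\<phi> \<in> dual s T"
  shows "continuous_seminorm s T (\<lambda>x. norm (\<phi> x))"
proof -
  have "openin T {x. norm (\<phi> x) < r}" for r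
    using openin_continuous_map_preimage[OF dualD(3)[OF \<phi>], of "ball 0 r"] T by simp
  then show ?thesis
    using dualD(1,2)[OF \<phi>] T by (simp add: continuous_seminorm_def norm_triangle_ineq norm_mult)
qed

text \<open>For distinct points the Hausdorff property gives a zero neighbourhood that misses
  \<open>x - y\<close>. A continuous seminorm fitting into it is at least 1 at \<open>x - y\<close>,
  and its norming functional tells the points apart.\<close>

lemma dual_separates:
  fixes s :: "'k::real_or_complex \<Rightarrow> 'v::ab_group_add \<Rightarrow> 'v"
  assumes lc: "lcHs s T" and T: "topspace T = UNIV" and eq: "\<And>\<phi>. \<phi> \<in> dual s T \<Longrightarrow> \<phi> x = \<phi> y"
  shows "x = y"
proof (rule ccontr)
  assume "x \<noteq> y"
  interpret vector_space s using lc by (simp add: lcHs_def)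
  have "Hausdorff_space T" using lc by (simp add: lcHs_def)
  then obtain W W' where W: "openin T W" "openin T W'" "0 \<in> W" "x - y \<in> W'" "disjnt W W'"
    using \<open>x \<noteq> y\<close> T unfolding Hausdorff_space_def by (metis UNIV_I eq_iff_diff_eq_0)
  obtain p where p: "continuous_seminorm s T p" "{x. p x < 1} \<subseteq> W"
    using continuous_seminorm_below[OF lc T W(1,3)] by blast
  have "x - y \<notin> W" using W(4,5) by (auto simp: disjnt_iff)
  then have "1 \<le> p (x - y)"
    using p(2) by (metis mem_Collect_eq not_less subsetD)
  moreover obtain \<phi> where \<phi>: "\<phi> \<in> dual s T" "p (x - y) \<le> norm (\<phi> (x - y))"
    using norming_functional[OF lc T p(1), of "x - y"] by blast
  moreover have "\<phi> (x - y) = 0"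
    using dualD(1)[OF \<phi>(1), of "x - y" y] eq[OF \<phi>(1)] T by simp
  ultimately show False by simp
qed

lemma vector_space_fscale:
  assumes "vector_space s"
  shows "vector_space (fscale s)"
proof -
  interpret vector_space s by fact
  show ?thesis
    by unfold_locales (simp_all add: fscale_def fun_eq_iff scale_right_distrib scale_left_distrib)
qed

lemma vector_space_field: "vector_space ((*) :: 'k::field \<Rightarrow> 'k \<Rightarrow> 'k)"
  by unfold_locales (simp_all add: algebra_simps)

lemma continuous_map_scalar_mult:
  fixes f :: "'a \<Rightarrow> 'k::real_normed_algebra"
  assumes "continuous_map X euclidean f"
  shows "continuous_map X euclidean (\<lambda>x. c * f x)"
  using assms by (simp add: continuous_map_atin tendsto_mult_left)

lemma subspace_dual: "module.subspace (fscale (*)) (dual s T)"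
proof -
  interpret vector_space "fscale (*) :: 'k \<Rightarrow> ('v \<Rightarrow> 'k) \<Rightarrow> 'v \<Rightarrow> 'k::real_or_complex"
    by (intro vector_space_fscale vector_space_field)
  show ?thesis
  proof (rule subspaceI)
    show "0 \<in> dual s T" by (simp add: dual_def linear_on_def zero_fun_def)
    show "\<phi> + \<psi> \<in> dual s T" if "\<phi> \<in> dual s T" "\<psi> \<in> dual s T" for \<phi> \<psi>
      using that by (auto simp: dual_def linear_on_def plus_fun_def algebra_simps intro!: continuous_map_add)
    show "fscale (*) c \<phi> \<in> dual s T" if "\<phi> \<in> dual s T" for c \<phi>
      using that by (auto simp: dual_def linear_on_def fscale_def algebra_simps intro!: continuous_map_scalar_mult)
  qed
qed

section \<open>The Banach space of functionals dominated by a seminorm\<close>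

lemma banach_onI:
  fixes s :: "'k::real_or_complex \<Rightarrow> 'v::ab_group_add \<Rightarrow> 'v"
  assumes vs: "vector_space s" and sub: "module.subspace s X"
    and out: "\<And>x. x \<notin> X \<Longrightarrow> N x = 0"
    and pos: "\<And>x. x \<in> X \<Longrightarrow> 0 \<le> N x" and def0: "\<And>x. x \<in> X \<Longrightarrow> N x = 0 \<Longrightarrow> x = 0"
    and tri: "\<And>x y. x \<in> X \<Longrightarrow> y \<in> X \<Longrightarrow> N (x + y) \<le> N x + N y"
    and hom: "\<And>c x. x \<in> X \<Longrightarrow> N (s c x) = norm c * N x"
    and compl: "\<And>\<sigma> :: nat \<Rightarrow> 'v. range \<sigma> \<subseteq> X \<Longrightarrow> \<forall>e>0. \<exists>M. \<forall>n\<ge>M. \<forall>m\<ge>M. N (\<sigma> n - \<sigma> m) < e \<Longrightarrow>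
      \<exists>l\<in>X. \<forall>e>0. \<exists>M. \<forall>n\<ge>M. N (\<sigma> n - l) < e"
  shows "banach_on s X N"
proof -
  interpret vector_space s by fact
  have N0: "N 0 = 0" using hom[of 0 0] subspace_0[OF sub] by simp
  have neg: "N (- x) = N x" for x
  proof (cases "x \<in> X")
    case True
    then show ?thesis using hom[of x "- 1"] by simp
  next
    case False
    then have "- x \<notin> X" using subspace_neg[OF sub, of "- x"] by auto
    then show ?thesis using False out by simp
  qed
  interpret M: Metric_space X "\<lambda>x y. N (x - y)"
  proof
    show "0 \<le> N (x - y)" for x y using pos out by (cases "x - y \<in> X") auto
    show "N (x - y) = N (y - x)" for x y using neg[of "x - y"] by simp
    show "N (x - y) = 0 \<longleftrightarrow> x = y" if "x \<in> X" "y \<in> X" for x y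
      using def0[of "x - y"] subspace_diff[OF sub that] N0 by auto
    show "N (x - z) \<le> N (x - y) + N (y - z)" if "x \<in> X" "y \<in> X" "z \<in> X" for x y z
      using tri[of "x - y" "y - z"] subspace_diff[OF sub] that by simp
  qed
  have "M.mcomplete"
    unfolding M.mcomplete_def M.MCauchy_def
  proof (intro allI impI, elim conjE)
    fix \<sigma> :: "nat \<Rightarrow> 'v" assume \<sigma>: "range \<sigma> \<subseteq> X"
      and cau: "\<forall>e>0. \<exists>M. \<forall>n n'. M \<le> n \<longrightarrow> M \<le> n' \<longrightarrow> N (\<sigma> n - \<sigma> n') < e"
    have "\<forall>e>0. \<exists>M. \<forall>n\<ge>M. \<forall>m\<ge>M. N (\<sigma> n - \<sigma> m) < e" using cau by meson
    from compl[OF \<sigma> this] obtain l where "l \<in> X" "\<forall>e>0. \<exists>M. \<forall>n\<ge>M. N (\<sigma> n - l) < e" by blast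
    then have "limitin M.mtopology \<sigma> l sequentially"
      using \<sigma> unfolding M.limitin_metric eventually_sequentially by blast
    then show "\<exists>x. limitin M.mtopology \<sigma> x sequentially" by blast
  qed
  then show ?thesis
    unfolding banach_on_def using assms by blast
qed

text \<open>This is the dual of the normed space obtained from \<open>p\<close> by dividing out its
  kernel, equivalently the linear span of the polar of the unit ball of \<open>p\<close>. The norm
  defined next is the dual norm, set to 0 off the carrier as \<open>banach_on\<close>
  requires.\<close>

definition dominated_dual ::
  "('k::real_or_complex \<Rightarrow> 'v::ab_group_add \<Rightarrow> 'v) \<Rightarrow> 'v topology \<Rightarrow> ('v \<Rightarrow> real) \<Rightarrow> ('v \<Rightarrow> 'k) set" where
  "dominated_dual s T p = {\<phi> \<in> dual s T. \<exists>a\<ge>0. \<forall>x. norm (\<phi> x) \<le> a * p x}"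

definition dominated_norm ::
  "('k::real_or_complex \<Rightarrow> 'v::ab_group_add \<Rightarrow> 'v) \<Rightarrow> 'v topology \<Rightarrow> ('v \<Rightarrow> real) \<Rightarrow> ('v \<Rightarrow> 'k) \<Rightarrow> real" where
  "dominated_norm s T p \<phi> =
     (if \<phi> \<in> dominated_dual s T p then Inf {a. 0 \<le> a \<and> (\<forall>x. norm (\<phi> x) \<le> a * p x)} else 0)"

context
  fixes s :: "'k::real_or_complex \<Rightarrow> 'v::ab_group_add \<Rightarrow> 'v" and T :: "'v topology" and p :: "'v \<Rightarrow> real"
  assumes lc: "lcHs s T" and T: "topspace T = UNIV" and p: "continuous_seminorm s T p"
begin

lemma dominated_norm_le:
  assumes "\<phi> \<in> dual s T" "0 \<le> a" "\<And>x. norm (\<phi> x) \<le> a * p x"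
  shows "\<phi> \<in> dominated_dual s T p" "dominated_norm s T p \<phi> \<le> a"
proof -
  show 1: "\<phi> \<in> dominated_dual s T p" using assms by (auto simp: dominated_dual_def)
  have "bdd_below {a. 0 \<le> a \<and> (\<forall>x. norm (\<phi> x) \<le> a * p x)}" by (rule bdd_belowI[of _ 0]) auto
  then show "dominated_norm s T p \<phi> \<le> a"
    using 1 assms by (auto simp: dominated_norm_def intro: cInf_lower)
qed

lemma dominated_norm_nonneg: "0 \<le> dominated_norm s T p \<phi>"
proof (cases "\<phi> \<in> dominated_dual s T p")
  case True
  then have "{a. 0 \<le> a \<and> (\<forall>x. norm (\<phi> x) \<le> a * p x)} \<noteq> {}" by (auto simp: dominated_dual_def)
  then show ?thesis using True by (auto simp: dominated_norm_def intro: cInf_greatest)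
qed (simp add: dominated_norm_def)

text \<open>The infimum in the norm is attained: where \<open>p x > 0\<close> one divides by it, and
  where \<open>p x = 0\<close> any admissible constant forces the value 0.\<close>

lemma norm_le_dominated_norm:
  assumes \<phi>: "\<phi> \<in> dominated_dual s T p"
  shows "norm (\<phi> x) \<le> dominated_norm s T p \<phi> * p x"
proof -
  have vs: "vector_space s" using lc by (simp add: lcHs_def)
  have ne: "{a. 0 \<le> a \<and> (\<forall>x. norm (\<phi> x) \<le> a * p x)} \<noteq> {}" using \<phi> by (auto simp: dominated_dual_def)
  show ?thesis
  proof (cases "p x = 0")
    case True
    obtain a where "\<forall>x. norm (\<phi> x) \<le> a * p x" using ne by auto
    then show ?thesis using True by (metis mult_zero_right)
  next
    case False
    then have px: "p x > 0" using continuous_seminorm_nonneg(2)[OF vs p, of x] by simp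
    have "norm (\<phi> x) / p x \<le> Inf {a. 0 \<le> a \<and> (\<forall>x. norm (\<phi> x) \<le> a * p x)}"
      by (rule cInf_greatest[OF ne]) (use px in \<open>auto simp: field_simps\<close>)
    then show ?thesis using \<phi> px by (simp add: dominated_norm_def field_simps)
  qed
qed

lemma subspace_dominated_dual: "module.subspace (fscale (*)) (dominated_dual s T p)"
proof -
  interpret V: vector_space "fscale (*) :: 'k \<Rightarrow> ('v \<Rightarrow> 'k) \<Rightarrow> 'v \<Rightarrow> 'k"
    by (intro vector_space_fscale vector_space_field)
  note sub = subspace_dual[of s T]
  show ?thesis
  proof (rule V.subspaceI)
    show "0 \<in> dominated_dual s T p"
      by (rule dominated_norm_le(1)[of _ 0]) (simp_all add: V.subspace_0[OF sub])
    show "\<phi> + \<psi> \<in> dominated_dual s T p" if \<phi>: "\<phi> \<in> dominated_dual s T p" "\<psi> \<in> dominated_dual s T p" for \<phi> \<psi>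
    proof (rule dominated_norm_le(1))
      show "\<phi> + \<psi> \<in> dual s T"
        using \<phi> by (intro V.subspace_add[OF sub]) (auto simp: dominated_dual_def)
      show "norm ((\<phi> + \<psi>) x) \<le> (dominated_norm s T p \<phi> + dominated_norm s T p \<psi>) * p x" for x
        using norm_triangle_ineq[of "\<phi> x" "\<psi> x"] norm_le_dominated_norm[OF \<phi>(1), of x]
          norm_le_dominated_norm[OF \<phi>(2), of x] by (simp add: distrib_right)
    qed (simp add: dominated_norm_nonneg)
    show "fscale (*) c \<phi> \<in> dominated_dual s T p" if \<phi>: "\<phi> \<in> dominated_dual s T p" for c \<phi>
    proof (rule dominated_norm_le(1))
      show "fscale (*) c \<phi> \<in> dual s T"
        using \<phi> by (intro V.subspace_scale[OF sub]) (auto simp: dominated_dual_def)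
      show "norm (fscale (*) c \<phi> x) \<le> (norm c * dominated_norm s T p \<phi>) * p x" for x
        using norm_le_dominated_norm[OF \<phi>, of x]
        by (simp add: fscale_def norm_mult mult.assoc mult_left_mono)
    qed (simp add: dominated_norm_nonneg)
  qed
qed

text \<open>A Cauchy sequence converges at every point of the space because the scalars are
  complete. The Cauchy estimate passes to the limit and shows both that the limit is dominated by
  \<open>p\<close> and that the convergence is in norm.\<close>

lemma banach_on_dominated_dual:
  "banach_on (fscale (*)) (dominated_dual s T p) (dominated_norm s T p)"
proof (rule banach_onI)
  interpret V: vector_space "fscale (*) :: 'k \<Rightarrow> ('v \<Rightarrow> 'k) \<Rightarrow> 'v \<Rightarrow> 'k"
    by (intro vector_space_fscale vector_space_field)
  let ?X = "dominated_dual s T p" and ?N = "dominated_norm s T p"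
  have XD: "\<phi> \<in> dual s T" if "\<phi> \<in> ?X" for \<phi> using that by (simp add: dominated_dual_def)
  note le = norm_le_dominated_norm and sub = subspace_dominated_dual
  have vs: "vector_space s" using lc by (simp add: lcHs_def)
  note ppos = continuous_seminorm_nonneg(2)[OF vs p]
  show "vector_space (fscale (*) :: 'k \<Rightarrow> ('v \<Rightarrow> 'k) \<Rightarrow> 'v \<Rightarrow> 'k)" by (fact V.vector_space_axioms)
  show "module.subspace (fscale (*)) ?X" by (fact sub)
  show "?N \<phi> = 0" if "\<phi> \<notin> ?X" for \<phi> using that by (simp add: dominated_norm_def)
  show "0 \<le> ?N \<phi>" for \<phi> by (rule dominated_norm_nonneg)
  show "\<phi> = 0" if "\<phi> \<in> ?X" "?N \<phi> = 0" for \<phi>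
    using le[OF that(1)] that(2) by (simp add: fun_eq_iff)
  show "?N (\<phi> + \<psi>) \<le> ?N \<phi> + ?N \<psi>" if \<phi>: "\<phi> \<in> ?X" "\<psi> \<in> ?X" for \<phi> \<psi>
  proof (rule dominated_norm_le(2))
    show "\<phi> + \<psi> \<in> dual s T" by (intro XD V.subspace_add[OF sub] \<phi>)
    show "norm ((\<phi> + \<psi>) x) \<le> (?N \<phi> + ?N \<psi>) * p x" for x
      using norm_triangle_ineq[of "\<phi> x" "\<psi> x"] le[OF \<phi>(1), of x] le[OF \<phi>(2), of x]
      by (simp add: distrib_right)
  qed (simp add: dominated_norm_nonneg)
  have hom_le: "?N (fscale (*) c \<phi>) \<le> norm c * ?N \<phi>" if \<phi>: "\<phi> \<in> ?X" for c \<phi>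
  proof (rule dominated_norm_le(2))
    show "fscale (*) c \<phi> \<in> dual s T" by (intro XD V.subspace_scale[OF sub] \<phi>)
    show "norm (fscale (*) c \<phi> x) \<le> (norm c * ?N \<phi>) * p x" for x
      using le[OF \<phi>, of x] by (simp add: fscale_def norm_mult mult.assoc mult_left_mono)
  qed (simp add: dominated_norm_nonneg)
  show "?N (fscale (*) c \<phi>) = norm c * ?N \<phi>" if \<phi>: "\<phi> \<in> ?X" for c \<phi>
  proof (cases "c = 0")
    case True
    then show ?thesis using hom_le[OF \<phi>, of 0] dominated_norm_nonneg[of "fscale (*) 0 \<phi>"] by simp
  next
    case False
    then have "?N \<phi> \<le> inverse (norm c) * ?N (fscale (*) c \<phi>)"
      using hom_le[OF V.subspace_scale[OF sub \<phi>], of "inverse c" c] by (simp add: norm_inverse)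
    then have "norm c * ?N \<phi> \<le> ?N (fscale (*) c \<phi>)" using False by (simp add: field_simps)
    then show ?thesis using hom_le[OF \<phi>, of c] by simp
  qed
  fix \<sigma> :: "nat \<Rightarrow> 'v \<Rightarrow> 'k" assume \<sigma>: "range \<sigma> \<subseteq> ?X" and cau: "\<forall>e>0. \<exists>M. \<forall>n\<ge>M. \<forall>m\<ge>M. ?N (\<sigma> n - \<sigma> m) < e"
  have \<sigma>X: "\<sigma> n \<in> ?X" for n using \<sigma> by auto
  have \<sigma>_le: "norm (\<sigma> n x - \<sigma> m x) \<le> ?N (\<sigma> n - \<sigma> m) * p x" for n m x
    using le[OF V.subspace_diff[OF sub \<sigma>X \<sigma>X], of n m x] by simp
  have "Cauchy (\<lambda>n. \<sigma> n x)" for x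
  proof (rule CauchyI)
    fix e :: real assume "e > 0"
    \<comment> \<open>The summand 1 avoids dividing by zero where \<open>p\<close> vanishes.\<close>
    then have e': "e / (p x + 1) > 0" using ppos[of x] by simp
    then obtain M where M: "\<And>n m. n \<ge> M \<Longrightarrow> m \<ge> M \<Longrightarrow> ?N (\<sigma> n - \<sigma> m) < e / (p x + 1)"
      using cau by meson
    have "norm (\<sigma> n x - \<sigma> m x) < e" if "n \<ge> M" "m \<ge> M" for n m
    proof -
      have "norm (\<sigma> n x - \<sigma> m x) \<le> e / (p x + 1) * p x"
        using \<sigma>_le[of n x m] mult_right_mono[OF less_imp_le[OF M[OF that]] ppos[of x]] by linarith
      also have "\<dots> < e" using \<open>e > 0\<close> ppos[of x] by (simp add: field_simps)
      finally show ?thesis .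
    qed
    then show "\<exists>M. \<forall>m\<ge>M. \<forall>n\<ge>M. norm (\<sigma> m x - \<sigma> n x) < e" by blast
  qed
  then have "(\<lambda>n. \<sigma> n x) \<longlonglongrightarrow> lim (\<lambda>n. \<sigma> n x)" for x
    using real_or_complex_Cauchy_convergent convergent_LIMSEQ_iff by blast
  moreover define l where "l x = lim (\<lambda>n. \<sigma> n x)" for x
  ultimately have l: "(\<lambda>n. \<sigma> n x) \<longlonglongrightarrow> l x" for x by simp
  have lin: "linear_on s (*) UNIV l"
    unfolding linear_on_def
  proof (intro conjI ballI allI)
    show "l (x + y) = l x + l y" for x y
    proof (rule LIMSEQ_unique[OF l])
      show "(\<lambda>n. \<sigma> n (x + y)) \<longlonglongrightarrow> l x + l y"
        using tendsto_add[OF l[of x] l[of y]] dualD(1)[OF XD[OF \<sigma>X]] T by simp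
    qed
    show "l (s c x) = c * l x" for c x
    proof (rule LIMSEQ_unique[OF l])
      show "(\<lambda>n. \<sigma> n (s c x)) \<longlonglongrightarrow> c * l x"
        using tendsto_mult_left[OF l[of x], of c] dualD(2)[OF XD[OF \<sigma>X]] T by simp
    qed
  qed
  have close: "norm (\<sigma> n x - l x) \<le> e * p x"
    if M: "\<And>m. m \<ge> M \<Longrightarrow> ?N (\<sigma> n - \<sigma> m) < e" for n M e x
  proof (rule LIMSEQ_le_const2)
    show "(\<lambda>m. norm (\<sigma> n x - \<sigma> m x)) \<longlonglongrightarrow> norm (\<sigma> n x - l x)"
      by (intro tendsto_intros l)
    show "\<exists>M. \<forall>m\<ge>M. norm (\<sigma> n x - \<sigma> m x) \<le> e * p x"
      using \<sigma>_le[of n x] mult_right_mono[OF less_imp_le[OF M] ppos[of x]] by (meson order_trans)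
  qed
  obtain M where M: "\<And>m. m \<ge> M \<Longrightarrow> ?N (\<sigma> M - \<sigma> m) < 1" using cau zero_less_one by (metis order_refl)
  have "norm (l x) \<le> (?N (\<sigma> M) + 1) * p x" for x
  proof -
    have "norm (l x) \<le> norm (\<sigma> M x) + norm (\<sigma> M x - l x)"
      using norm_triangle_ineq4[of "\<sigma> M x" "\<sigma> M x - l x"] by simp
    then show ?thesis
      using close[of M M 1 x, OF M] le[OF \<sigma>X, of M x] by (simp add: distrib_right)
  qed
  then have lX: "l \<in> ?X"
    using dominated_norm_nonneg[of "\<sigma> M"]
    by (intro dominated_norm_le(1)[of l "?N (\<sigma> M) + 1"] bounded_functional_in_dual[OF lc T p lin]) auto
  have "\<exists>M. \<forall>n\<ge>M. ?N (\<sigma> n - l) < e" if "e > 0" for e :: real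
  proof -
    \<comment> \<open>The limit yields only a weak inequality, so half of \<open>e\<close> is spent
      here.\<close>
    obtain M where M: "\<And>n m. n \<ge> M \<Longrightarrow> m \<ge> M \<Longrightarrow> ?N (\<sigma> n - \<sigma> m) < e / 2"
      using cau \<open>e > 0\<close> by (metis half_gt_zero)
    have "?N (\<sigma> n - l) \<le> e / 2" if "n \<ge> M" for n
    proof (rule dominated_norm_le(2))
      show "\<sigma> n - l \<in> dual s T" by (intro XD V.subspace_diff[OF sub] \<sigma>X lX)
      show "norm ((\<sigma> n - l) x) \<le> e / 2 * p x" for x
        using close[of M n "e / 2" x] M that by simp
    qed (use \<open>e > 0\<close> in simp)
    then show ?thesis using \<open>e > 0\<close> by force
  qed
  then show "\<exists>l\<in>?X. \<forall>e>0. \<exists>M. \<forall>n\<ge>M. ?N (\<sigma> n - l) < e" using lX by blast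
qed

end


section \<open>Uniform approximation on absolutely convex compact sets\<close>

lemma openin_dual_preimage:
  assumes "\<phi> \<in> dual s T" "open A"
  shows "openin T {x \<in> topspace T. \<phi> x \<in> A}"
  using openin_continuous_map_preimage[OF dualD(3)[OF assms(1)], of A] assms(2) by simp

text \<open>The open set where \<open>norm (y k) < e\<close> contains 0, and every other point has
  some \<open>Z i\<close> of modulus above \<open>1 / (n + 1)\<close> for some \<open>n\<close>.
  Those open sets cover \<open>K\<close>, and a finite subcover names the indices in
  \<open>I\<close>.\<close>

lemma compact_separating_subfamily:
  fixes s :: "'k::real_or_complex \<Rightarrow> 'v::ab_group_add \<Rightarrow> 'v"
  assumes K: "compactin F K" and Z: "\<And>i. i \<in> U \<Longrightarrow> Z i \<in> dual s F"
    and sep: "\<And>k. k \<in> topspace F \<Longrightarrow> \<forall>i\<in>U. Z i k = 0 \<Longrightarrow> k = 0"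
    and y: "y \<in> dual s F" and y0: "y 0 = 0" and e: "e > 0"
  obtains I d where "finite I" "I \<subseteq> U" "d > 0"
    "\<And>k. k \<in> K \<Longrightarrow> \<forall>i\<in>I. norm (Z i k) \<le> d \<Longrightarrow> norm (y k) < e"
proof -
  define A where "A = {k \<in> topspace F. y k \<in> ball 0 e}"
  define B where "B = (\<lambda>(i, n). {k \<in> topspace F. Z i k \<in> - cball 0 (1 / real (Suc n))})"
  have "\<forall>W\<in>insert A (B ` (U \<times> UNIV)). openin F W"
    unfolding A_def B_def
    by (auto simp del: mem_ball_0 mem_ball mem_cball Compl_iff intro!: openin_dual_preimage[OF y] openin_dual_preimage[OF Z])
  moreover have "K \<subseteq> \<Union> (insert A (B ` (U \<times> UNIV)))"
  proof
    fix k assume "k \<in> K"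
    then have k: "k \<in> topspace F" using K compactin_subset_topspace by blast
    show "k \<in> \<Union> (insert A (B ` (U \<times> UNIV)))"
    proof (cases "k = 0")
      case True
      then show ?thesis using k y0 e by (simp add: A_def)
    next
      case False
      then obtain i where i: "i \<in> U" "norm (Z i k) > 0" using sep[OF k] by auto
      then obtain n where "1 / real (Suc n) < norm (Z i k)"
        using reals_Archimedean[OF i(2)] by (auto simp: inverse_eq_divide)
      then have "k \<in> B (i, n)" using k by (simp add: B_def)
      moreover have "B (i, n) \<in> insert A (B ` (U \<times> UNIV))" using i(1) by simp
      ultimately show ?thesis by (rule UnionI[rotated])
    qed
  qed
  ultimately obtain C where C: "finite C" "C \<subseteq> insert A (B ` (U \<times> UNIV))" "K \<subseteq> \<Union>C"
    using K unfolding compactin_def by meson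
  have "C - {A} \<subseteq> B ` (U \<times> UNIV)" using C(2) by blast
  from finite_subset_image[OF _ this] C(1)
  obtain J where J: "J \<subseteq> U \<times> UNIV" "finite J" "C - {A} = B ` J" by auto
  \<comment> \<open>A sum of naturals dominates each of them, so \<open>d\<close> is below every
    threshold \<open>1 / (n + 1)\<close> of the subcover.\<close>
  define d where "d = 1 / real (Suc (sum snd J))"
  have "norm (y k) < e" if k: "k \<in> K" and le: "\<forall>i\<in>fst ` J. norm (Z i k) \<le> d" for k
  proof -
    have "k \<notin> B j" if "j \<in> J" for j
    proof -
      have "snd j \<le> sum snd J" using J(2) that by (intro member_le_sum) auto
      then have "d \<le> 1 / real (Suc (snd j))" unfolding d_def by (intro frac_le) (simp_all del: of_nat_sum)
      moreover have "norm (Z (fst j) k) \<le> d" using le that by blast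
      ultimately show ?thesis by (simp add: B_def case_prod_beta)
    qed
    then have "k \<in> A" using C(3) J(3) k by blast
    then show ?thesis by (simp add: A_def)
  qed
  moreover have "finite (fst ` J)" "fst ` J \<subseteq> U" using J by auto
  moreover have "d > 0" by (simp add: d_def del: of_nat_Suc)
  ultimately show thesis using that by blast
qed

text \<open>
  By compactness finitely many \<open>Z\<^sub>i\<close> control \<open>y\<close> on \<open>K\<close>, in the sense that
  \<open>\<bar>y k\<bar> \<le> e + p(Z k)\<close> for a multiple \<open>p\<close> of the sum norm of the coordinates \<open>Z k = (Z\<^sub>i k)\<^sub>i\<close>.
  The coefficients then come from the Hahn--Banach theorem on the space of coordinates.
\<close>

lemma approximation_on_compact:
  fixes s :: "'k::real_or_complex \<Rightarrow> 'v::ab_group_add \<Rightarrow> 'v" and Z :: "'i \<Rightarrow> 'v \<Rightarrow> 'k"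
  assumes lc: "lcHs s F" and K: "abs_convex_in s K" "compactin F K"
    and Z: "\<And>i. i \<in> U \<Longrightarrow> Z i \<in> dual s F"
    and sep: "\<And>k. k \<in> topspace F \<Longrightarrow> \<forall>i\<in>U. Z i k = 0 \<Longrightarrow> k = 0"
    and y: "y \<in> dual s F" and e: "e > 0"
  obtains I a where "finite I" "I \<subseteq> U" "\<And>k. k \<in> K \<Longrightarrow> norm (y k - (\<Sum>i\<in>I. a i * Z i k)) \<le> e"
proof (cases "K = {}")
  case True
  then show thesis using that[of "{}"] by simp
next
  case False
  interpret vector_space s using lc by (simp add: lcHs_def)
  have F: "subspace (topspace F)" using lc by (simp add: lcHs_def)
  have KF: "k \<in> topspace F" if "k \<in> K" for k using K(2) that compactin_subset_topspace by blast
  have y0: "y 0 = 0" using dualD(2)[OF y subspace_0[OF F], of 0] by simp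
  obtain I d where I: "finite I" "I \<subseteq> U" and d: "d > 0"
    "\<And>k. k \<in> K \<Longrightarrow> \<forall>i\<in>I. norm (Z i k) \<le> d \<Longrightarrow> norm (y k) < e"
    using compact_separating_subfamily[of F K U Z s y e, OF K(2) Z sep y y0 e] by blast
  have KC: "s a x + s b x' \<in> K" if "x \<in> K" "x' \<in> K" "norm a + norm b \<le> 1" for a b x x'
    using K(1) that by (simp add: abs_convex_in_def)
  have K_scale: "s a x \<in> K" if "x \<in> K" "norm a \<le> 1" for a x
    using KC[of x x a 0] that by simp
  define p where "p w = e / d * (\<Sum>i\<in>I. norm (w i))" for w :: "'i \<Rightarrow> 'k"
  have p_scale: "p (fscale (*) c w) = norm c * p w" for c w
    by (simp add: p_def fscale_def norm_mult sum_distrib_left algebra_simps)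
  have p_add: "p (v + w) \<le> p v + p w" for v w
  proof -
    have "(\<Sum>i\<in>I. norm (v i + w i)) \<le> (\<Sum>i\<in>I. norm (v i)) + (\<Sum>i\<in>I. norm (w i))"
      unfolding sum.distrib[symmetric] by (intro sum_mono norm_triangle_ineq)
    then show ?thesis
      unfolding p_def plus_fun_apply distrib_left[symmetric]
      by (rule mult_left_mono) (use e d(1) in simp)
  qed
  \<comment> \<open>The weight \<open>e / d\<close> in \<open>p\<close> gives
    \<open>p (Z k) = e * r\<close>. If \<open>r > 1\<close>, the point \<open>k / r\<close> still
    lies in \<open>K\<close> and has all its coordinates in \<open>I\<close> bounded by
    \<open>d\<close>, so its \<open>y\<close>-value is below \<open>e\<close>; scaling back yields
    \<open>e * r\<close>.\<close>
  have y_le: "norm (y k) \<le> e + p (\<lambda>i. Z i k)" if k: "k \<in> K" for k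
  proof -
    define r where "r = (\<Sum>i\<in>I. norm (Z i k)) / d"
    have Z_le: "norm (Z i k) \<le> r * d" if "i \<in> I" for i
      using member_le_sum[of i I "\<lambda>i. norm (Z i k)"] that I(1) d(1) by (simp add: r_def)
    have r0: "0 \<le> r" using d(1) by (simp add: r_def sum_nonneg)
    have p_r: "p (\<lambda>i. Z i k) = e * r" by (simp add: p_def r_def)
    show ?thesis
    proof (cases "r \<le> 1")
      case True
      then have "r * d \<le> d" using d(1) by simp
      then have "norm (Z i k) \<le> d" if "i \<in> I" for i
        using Z_le[OF that] by simp
      moreover have "0 \<le> e * r" using r0 e by simp
      ultimately show ?thesis using d(2)[OF k] p_r by fastforce
    next
      case False
      then have r: "r > 0" by simp
      define k' where "k' = s (of_real (inverse r)) k"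
      have k': "k' \<in> K" unfolding k'_def using False r by (intro K_scale k) (simp add: norm_inverse inverse_le_1_iff)
      have "norm (Z i k') \<le> d" if "i \<in> I" for i
      proof -
        have "Z i k' = of_real (inverse r) * Z i k"
          using dualD(2)[OF Z KF[OF k]] that I(2) by (auto simp: k'_def)
        then have "norm (Z i k') = inverse r * norm (Z i k)" using r by (simp add: norm_mult norm_inverse)
        also have "\<dots> \<le> inverse r * (r * d)" using Z_le[OF that] r by (intro mult_left_mono) auto
        also have "\<dots> = d" using r by simp
        finally show ?thesis .
      qed
      then have "norm (y k') < e" using d(2)[OF k'] by blast
      then have "norm (y k) < e * r"
        using r dualD(2)[OF y KF[OF k], of "of_real (inverse r)"]
        by (simp add: k'_def norm_mult norm_inverse) (simp add: field_simps)
      then show ?thesis using p_r e by simp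
    qed
  qed
  obtain re :: "'k \<Rightarrow> real" and j where re: "linear re" "re 1 = 1" "j = 0 \<or> j * j = - 1"
    "\<And>z. z = of_real (re z) - of_real (re (j * z)) * j" and re_le: "\<And>z. \<bar>re z\<bar> \<le> norm z"
    using real_part_exists[where 'k = 'k] by metis
  have re_of_real: "re (of_real a * z) = a * re z" for a z
    using linear_scale[OF re(1)] by (metis real_scaleR_def scaleR_conv_of_real)
  let ?s = "\<lambda>t. fscale (*) (of_real t) :: ('i \<Rightarrow> 'k) \<Rightarrow> 'i \<Rightarrow> 'k"
  have vs: "vector_space (fscale (*) :: 'k \<Rightarrow> ('i \<Rightarrow> 'k) \<Rightarrow> 'i \<Rightarrow> 'k)"
    by (intro vector_space_fscale vector_space_field)
  define ev where "ev k = (\<lambda>i. if i \<in> I then Z i k else 0)" for k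
  \<comment> \<open>The demand is a real functional of the coordinates with value at least
    \<open>re (y k) - e\<close> at \<open>ev k\<close> for each \<open>k\<close> in
    \<open>K\<close>, closed up under nonnegative multiples. The estimate \<open>y_le\<close> says
    that \<open>p\<close> permits it.\<close>
  define G where "G = {(?s t (ev k), t * (re (y k) - e)) | t k. t \<ge> 0 \<and> k \<in> K}"
  have GI: "(v, r) \<in> G" if "v = ?s t (ev k)" "r = t * (re (y k) - e)" "t \<ge> 0" "k \<in> K" for v r t k
    using that by (auto simp: G_def)
  have p_ev: "p (ev k) = p (\<lambda>i. Z i k)" for k
    by (simp add: p_def ev_def)
  obtain f where f: "\<And>x y. f (x + y) = f x + f y" "\<And>t x. f (?s t x) = t * f x"
    "\<And>x. f x \<le> p x" "\<And>v r. (v, r) \<in> G \<Longrightarrow> r \<le> f v"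
  proof (rule Hahn_Banach_cone[OF vector_space_of_real[OF vs], of p G])
    show "sublinear ?s p" by (simp add: sublinear_def p_add p_scale)
    obtain k where "k \<in> K" using False by blast
    then show "(0, 0) \<in> G" by (intro GI[of _ 0 k]) (simp_all add: fscale_def zero_fun_def)
    show "(v + w, r + q) \<in> G" if vw: "(v, r) \<in> G" "(w, q) \<in> G" for v r w q
    proof -
      obtain t k where t: "v = ?s t (ev k)" "r = t * (re (y k) - e)" "t \<ge> 0" "k \<in> K"
        using vw(1) by (auto simp: G_def)
      obtain t' k' where t': "w = ?s t' (ev k')" "q = t' * (re (y k') - e)" "t' \<ge> 0" "k' \<in> K"
        using vw(2) by (auto simp: G_def)
      show ?thesis
      proof (cases "t + t' = 0")
        case True
        then have "t = 0" "t' = 0" using t(3) t'(3) by auto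
        then show ?thesis using t t' by (intro GI[of _ 0 k]) (simp_all add: fscale_def fun_eq_iff)
      next
        case False
        \<comment> \<open>A sum of two elements of the cone comes from the convex combination
          \<open>m\<close> of \<open>k\<close> and \<open>k'\<close> with factor
          \<open>t + t'\<close>; the case where that factor vanishes is treated apart to permit the
          division.\<close>
        define l l' where "l = t / (t + t')" and "l' = t' / (t + t')"
        have l: "(t + t') * l = t" "(t + t') * l' = t'" "l \<ge> 0" "l' \<ge> 0" "l + l' \<le> 1"
          using False t(3) t'(3) by (auto simp: l_def l'_def field_simps)
        define m where "m = s (of_real l) k + s (of_real l') k'"
        have "m \<in> K" unfolding m_def using t(4) t'(4) l by (intro KC) auto
        have lin: "\<psi> m = of_real l * \<psi> k + of_real l' * \<psi> k'" if "\<psi> \<in> dual s F" for \<psi>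
          using dualD(1,2)[OF that] KF[OF t(4)] KF[OF t'(4)] subspace_scale[OF F] by (simp add: m_def)
        have eq: "of_real (t + t') * (of_real l * a + of_real l' * b) = of_real t * a + of_real t' * (b :: 'k)" for a b
        proof -
          have "of_real (t + t') * (of_real l * a + of_real l' * b)
              = of_real ((t + t') * l) * a + of_real ((t + t') * l') * b"
            by (simp only: of_real_mult distrib_left mult.assoc)
          then show ?thesis by (simp only: l)
        qed
        show ?thesis
        proof (rule GI[of _ "t + t'" m])
          show "v + w = ?s (t + t') (ev m)"
            using lin[OF Z] I(2) eq by (auto simp: t t' ev_def fscale_def fun_eq_iff simp del: of_real_add)
          have "re (y m) = l * re (y k) + l' * re (y k')"
            using lin[OF y] re_of_real by (simp add: linear_add[OF re(1)])
          then have "(t + t') * re (y m) = t * re (y k) + t' * re (y k')"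
            using l(1,2) by (metis distrib_left mult.assoc)
          then show "r + q = (t + t') * (re (y m) - e)"
            by (simp add: t t' algebra_simps)
        qed (use t(3) t'(3) \<open>m \<in> K\<close> in auto)
      qed
    qed
    show "(?s t v, t * r) \<in> G" if t: "t > 0" and v: "(v, r) \<in> G" for t v r
    proof -
      obtain t' k where "v = ?s t' (ev k)" "r = t' * (re (y k) - e)" "t' \<ge> 0" "k \<in> K"
        using v by (auto simp: G_def)
      then show ?thesis using t by (intro GI[of _ "t * t'" k]) (simp_all add: fscale_def mult.assoc)
    qed
    show "r \<le> p v" if v: "(v, r) \<in> G" for v r
    proof -
      obtain t k where t: "v = ?s t (ev k)" "r = t * (re (y k) - e)" "t \<ge> 0" "k \<in> K"
        using v by (auto simp: G_def)
      have "re (y k) - e \<le> p (ev k)"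
        using y_le[OF t(4)] re_le[of "y k"] by (simp add: p_ev)
      then show ?thesis using t by (simp add: p_scale mult_left_mono)
    qed
  qed blast
  obtain \<phi> where \<phi>: "linear_on (fscale (*)) (*) UNIV \<phi>" "\<And>x. re (\<phi> x) = f x" "\<And>x. norm (\<phi> x) \<le> p x"
    using complexification[where s = "fscale (*)" and f = f and p = p and re = re and i = j, OF vs f(1,2,3) p_scale re] by blast
  have \<phi>_add: "\<phi> (v + w) = \<phi> v + \<phi> w" and \<phi>_scale: "\<phi> (fscale (*) c w) = c * \<phi> w" for v w c
    using \<phi>(1) by (auto simp: linear_on_def)
  \<comment> \<open>The coefficients are the values at the unit vectors. They determine the
    functional on finitely supported vectors, which is why \<open>ev\<close> is cut off outside
    \<open>I\<close>.\<close>
  define a where "a i = \<phi> (\<lambda>i'. if i' = i then 1 else 0)" for i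
  have \<phi>_0: "\<phi> 0 = 0" using \<phi>_add[of 0 0] by simp
  have \<phi>_restrict: "\<phi> (\<lambda>i. if i \<in> J then w i else 0) = (\<Sum>i\<in>J. a i * w i)" if "finite J" for J w
    using that
  proof induction
    case empty
    then show ?case using \<phi>_0 by (simp add: zero_fun_def)
  next
    case (insert i J)
    have "(\<lambda>i'. if i' \<in> insert i J then w i' else 0) =
      fscale (*) (w i) (\<lambda>i'. if i' = i then 1 else 0) + (\<lambda>i. if i \<in> J then w i else 0)"
      using insert.hyps by (auto simp: fscale_def fun_eq_iff)
    then show ?case using insert by (simp add: \<phi>_add \<phi>_scale a_def mult.commute)
  qed
  have \<phi>_ev: "\<phi> (ev k) = (\<Sum>i\<in>I. a i * Z i k)" for k
    unfolding ev_def by (rule \<phi>_restrict[OF I(1)])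
  have re_bound: "re (y k - (\<Sum>i\<in>I. a i * Z i k)) \<le> e" if "k \<in> K" for k
  proof -
    have "(ev k, re (y k) - e) \<in> G"
      using that by (intro GI[of _ 1 k]) (simp_all add: fscale_def)
    then have "re (y k) - e \<le> re (\<phi> (ev k))" using f(4) \<phi>(2) by simp
    then show ?thesis by (simp add: \<phi>_ev linear_diff[OF re(1)])
  qed
  have "norm (y k - (\<Sum>i\<in>I. a i * Z i k)) \<le> e" if k: "k \<in> K" for k
  proof (cases "y k - (\<Sum>i\<in>I. a i * Z i k) = 0")
    case True
    then show ?thesis using e by simp
  next
    case False
    \<comment> \<open>The demands bound only real parts and from one side. Since \<open>K\<close> is
      balanced, \<open>k\<close> may be rotated until the error is its own modulus.\<close>
    define z where "z = y k - (\<Sum>i\<in>I. a i * Z i k)"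
    define c where "c = of_real (norm z) / z"
    have c: "norm c \<le> 1" "c * z = of_real (norm z)"
      using False by (simp_all add: c_def z_def norm_divide)
    have "y (s c k) - (\<Sum>i\<in>I. a i * Z i (s c k)) = c * z"
    proof -
      have "(\<Sum>i\<in>I. a i * Z i (s c k)) = (\<Sum>i\<in>I. c * (a i * Z i k))"
        using dualD(2)[OF Z KF[OF k]] I(2) by (intro sum.cong) auto
      then show ?thesis
        using dualD(2)[OF y KF[OF k]] by (simp add: z_def right_diff_distrib sum_distrib_left)
    qed
    then have "re (c * z) \<le> e" using re_bound[OF K_scale[OF k c(1)]] by simp
    moreover have "re (c * z) = norm z" using c(2) re_of_real[of "norm z" 1] re(2) by simp
    ultimately show ?thesis by (simp add: z_def)
  qed
  then show thesis using that I by blast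
qed


section \<open>Extending along a separating family of functionals\<close>

lemma abs_convex_closure:
  fixes s :: "'k::real_or_complex \<Rightarrow> 'v::ab_group_add \<Rightarrow> 'v"
  assumes lc: "lcHs s F" and A: "abs_convex_in s A" "A \<subseteq> topspace F"
  shows "abs_convex_in s (F closure_of A)"
  unfolding abs_convex_in_def
proof (intro ballI allI impI)
  fix x y and a b :: 'k assume x: "x \<in> F closure_of A" and y: "y \<in> F closure_of A" and ab: "norm a + norm b \<le> 1"
  let ?f = "\<lambda>z. s a (fst z) + s b (snd z)"
  have "continuous_map (prod_topology F F) F ?f"
    by (intro lcHs_add[OF lc] lcHs_scale[OF lc]) (auto intro: continuous_map_fst continuous_map_snd)
  then have "?f ` (prod_topology F F closure_of (A \<times> A)) \<subseteq> F closure_of (?f ` (A \<times> A))"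
    by (rule continuous_map_image_closure_subset)
  also have "\<dots> \<subseteq> F closure_of A"
    using A(1) ab by (intro closure_of_mono) (auto simp: abs_convex_in_def)
  finally show "s a x + s b y \<in> F closure_of A"
    using x y by (force simp: closure_of_Times)
qed

lemma openin_dual_kappa_ball:
  fixes s :: "'k::real_or_complex \<Rightarrow> 'v::ab_group_add \<Rightarrow> 'v"
  assumes K: "abs_convex_in s K" "compactin F K" and y: "y \<in> dual s F" and e: "e > 0"
  obtains W where "openin (dual_kappa s F) W" "y \<in> W" "\<And>v k. v \<in> W \<Longrightarrow> k \<in> K \<Longrightarrow> norm (v k - y k) < e"
proof
  \<comment> \<open>The margin \<open>r < e\<close> leaves room \<open>(e - r) / 2\<close> around
    each member, so openness does not rest on a maximum being attained on \<open>K\<close>.\<close>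
  let ?W = "{v \<in> dual s F. \<exists>r<e. \<forall>k\<in>K. norm (v k - y k) \<le> r}"
  show "openin (dual_kappa s F) ?W"
    unfolding dual_kappa_def openin_unif_topology
  proof (intro conjI ballI)
    fix v assume "v \<in> ?W"
    then obtain r where v: "v \<in> dual s F" and r: "r < e" "\<And>k. k \<in> K \<Longrightarrow> norm (v k - y k) \<le> r"
      by auto
    have "w \<in> ?W" if w: "w \<in> dual s F" "\<And>k. k \<in> K \<Longrightarrow> w k - v k \<in> ball 0 ((e - r) / 2)" for w
    proof -
      have "norm (w k - y k) \<le> (e + r) / 2" if "k \<in> K" for k
      proof -
        have "norm (w k - y k) \<le> norm (w k - v k) + norm (v k - y k)"
          using norm_triangle_ineq[of "w k - v k" "v k - y k"] by simp
        then show ?thesis using r(2)[OF that] w(2)[OF that] by (simp add: field_simps)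
      qed
      moreover have "(e + r) / 2 < e" using r(1) by simp
      ultimately show ?thesis using w(1) by blast
    qed
    then show "\<exists>\<A> V. finite \<A> \<and> \<A> \<subseteq> {C. abs_convex_in s C \<and> compactin F C} \<and>
        openin euclidean V \<and> 0 \<in> V \<and> {w \<in> dual s F. \<forall>x\<in>\<Union>\<A>. w x - v x \<in> V} \<subseteq> ?W"
      using K r(1) by (intro exI[of _ "{K}"] exI[of _ "ball 0 ((e - r) / 2)"]) auto
  qed auto
  show "y \<in> ?W" using y e by (auto intro!: exI[of _ "e / 2"])
  show "norm (v k - y k) < e" if "v \<in> ?W" "k \<in> K" for v k
    using that by force
qed

definition polar_ball ::
  "('k::real_or_complex \<Rightarrow> 'v::ab_group_add \<Rightarrow> 'v) \<Rightarrow> 'v topology \<Rightarrow> ('v \<Rightarrow> real) \<Rightarrow> ('v \<Rightarrow> 'k) set" where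
  "polar_ball s T p = {\<phi> \<in> dual s T. \<forall>x. norm (\<phi> x) \<le> p x}"

text \<open>This converts a bound uniform on the polar ball into a bound in \<open>E\<close>: some
  member of the ball attains \<open>p x\<close>.\<close>

lemma seminorm_le_polar_ball:
  assumes lc: "lcHs s T" and T: "topspace T = UNIV" and p: "continuous_seminorm s T p"
    and le: "\<And>\<phi>. \<phi> \<in> polar_ball s T p \<Longrightarrow> norm (\<phi> x) \<le> c"
  shows "p x \<le> c"
proof -
  obtain \<phi> where "\<phi> \<in> dual s T" "\<And>y. norm (\<phi> y) \<le> p y" "p x \<le> norm (\<phi> x)"
    using norming_functional[OF lc T p] by blast
  moreover from this have "norm (\<phi> x) \<le> c" by (intro le) (simp add: polar_ball_def)
  ultimately show ?thesis by simp
qed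

text \<open>
  \<open>R\<close> is the map \<open>e' \<mapsto> f\<^bsub>e'\<^esub>\<close>; the index set \<open>U\<close> and the functionals \<open>Z\<^sub>i\<close> are the set of
  uniqueness and the \<open>T\<^sub>m\<^sub>,\<^sub>x\<close>.
\<close>

locale weak_lifting =
  fixes sE :: "'k::real_or_complex \<Rightarrow> 'e::ab_group_add \<Rightarrow> 'e" and E :: "'e topology"
    and s :: "'k \<Rightarrow> 'v::ab_group_add \<Rightarrow> 'v" and F :: "'v topology"
    and U :: "'i set" and Z :: "'i \<Rightarrow> 'v \<Rightarrow> 'k" and f :: "'i \<Rightarrow> 'e" and R :: "('e \<Rightarrow> 'k) \<Rightarrow> 'v"
  assumes lcE: "lcHs sE E" and E: "topspace E = UNIV" and lcF: "lcHs s F"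
    and BC: "BC_space s F" and SM: "semi_Montel s F"
    and Z: "i \<in> U \<Longrightarrow> Z i \<in> dual s F"
    and sep: "g \<in> topspace F \<Longrightarrow> \<forall>i\<in>U. Z i g = 0 \<Longrightarrow> g = 0"
    and R: "\<phi> \<in> dual sE E \<Longrightarrow> R \<phi> \<in> topspace F"
    and ZR: "\<phi> \<in> dual sE E \<Longrightarrow> i \<in> U \<Longrightarrow> Z i (R \<phi>) = \<phi> (f i)"
begin

sublocale VE: vector_space sE using lcE by (simp add: lcHs_def)

sublocale VF: vector_space s using lcF by (simp add: lcHs_def)

sublocale D: vector_space "fscale (*) :: 'k \<Rightarrow> ('e \<Rightarrow> 'k) \<Rightarrow> 'e \<Rightarrow> 'k"
  by (intro vector_space_fscale vector_space_field)

section \<open>Linearity, closed graph and compactness of the extension operator\<close>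

lemma subspace_F: "VF.subspace (topspace F)"
  using lcF by (simp add: lcHs_def)

lemma dual_diff:
  assumes "y \<in> dual s F" "g \<in> topspace F" "h \<in> topspace F"
  shows "y (g - h) = y g - y h"
  using dualD(1)[OF assms(1), of "g - h" h] VF.subspace_diff[OF subspace_F assms(2,3)] assms(3)
  by (simp add: eq_diff_eq)

lemma dualE_diff: "\<phi> \<in> dual sE E \<Longrightarrow> \<phi> (x - y) = \<phi> x - \<phi> y"
  using dualD(1)[of \<phi> sE E "x - y" y] E by (simp add: eq_diff_eq)

lemma eqI:
  assumes "g \<in> topspace F" "h \<in> topspace F" "\<And>i. i \<in> U \<Longrightarrow> Z i g = Z i h"
  shows "g = h"
proof -
  have "g - h = 0"
    using assms dual_diff[OF Z] by (intro sep VF.subspace_diff[OF subspace_F]) auto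
  then show ?thesis by simp
qed

lemma R_add:
  assumes "\<phi> \<in> dual sE E" "\<psi> \<in> dual sE E"
  shows "R (\<phi> + \<psi>) = R \<phi> + R \<psi>"
proof (rule eqI)
  have sum: "\<phi> + \<psi> \<in> dual sE E" by (intro D.subspace_add[OF subspace_dual] assms)
  show "R (\<phi> + \<psi>) \<in> topspace F" by (rule R[OF sum])
  show "R \<phi> + R \<psi> \<in> topspace F" by (intro VF.subspace_add[OF subspace_F] R assms)
  show "Z i (R (\<phi> + \<psi>)) = Z i (R \<phi> + R \<psi>)" if "i \<in> U" for i
    using ZR[OF _ that] dualD(1)[OF Z[OF that]] sum assms R by simp
qed

lemma R_scale:
  assumes "\<phi> \<in> dual sE E"
  shows "R (fscale (*) c \<phi>) = s c (R \<phi>)"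
proof (rule eqI)
  have c: "fscale (*) c \<phi> \<in> dual sE E" by (intro D.subspace_scale[OF subspace_dual] assms)
  show "R (fscale (*) c \<phi>) \<in> topspace F" by (rule R[OF c])
  show "s c (R \<phi>) \<in> topspace F" by (intro VF.subspace_scale[OF subspace_F] R assms)
  show "Z i (R (fscale (*) c \<phi>)) = Z i (s c (R \<phi>))" if "i \<in> U" for i
    using ZR[OF _ that] dualD(2)[OF Z[OF that]] c assms R by (simp add: fscale_def)
qed

text \<open>If \<open>g\<close> differs from the image of a functional, some \<open>Z i\<close> with
  \<open>i\<close> in \<open>U\<close> sees the difference. On the graph that \<open>Z i\<close> is
  evaluation at \<open>f i\<close>, which is continuous for the dominated norm, so a whole product
  neighbourhood misses the graph.\<close>

lemma closed_graph_R:
  assumes p: "continuous_seminorm sE E p"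
  shows "closed_graph (dominated_dual sE E p) (dominated_norm sE E p) F R"
proof -
  let ?X = "dominated_dual sE E p" and ?N = "dominated_norm sE E p"
  interpret X: Metric_space ?X "\<lambda>x y. ?N (x - y)"
    by (rule banach_on_Metric_space[OF banach_on_dominated_dual[OF lcE E p]])
  let ?P = "prod_topology X.mtopology F" and ?G = "(\<lambda>\<phi>. (\<phi>, R \<phi>)) ` ?X"
  have XD: "\<phi> \<in> dual sE E" if "\<phi> \<in> ?X" for \<phi> using that by (simp add: dominated_dual_def)
  note ppos = continuous_seminorm_nonneg(2)[OF VE.vector_space_axioms p]
  have "openin ?P (topspace ?P - ?G)"
    unfolding openin_prod_topology_alt
  proof (intro allI impI)
    fix \<phi> g assume "(\<phi>, g) \<in> topspace ?P - ?G"
    then have \<phi>: "\<phi> \<in> ?X" and g: "g \<in> topspace F" "g \<noteq> R \<phi>" by auto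
    obtain i where i: "i \<in> U" "Z i g \<noteq> Z i (R \<phi>)" using eqI[OF g(1) R[OF XD[OF \<phi>]]] g(2) by blast
    define d where "d = norm (Z i g - \<phi> (f i)) / 2"
    have d: "d > 0" using i ZR[OF XD[OF \<phi>]] by (simp add: d_def)
    \<comment> \<open>A change of the functional by less than \<open>r\<close> in norm moves its
      value at \<open>f i\<close> by less than \<open>d\<close>, half of the gap to be kept
      open.\<close>
    define r where "r = d / (p (f i) + 1)"
    have r: "r > 0" "r * p (f i) < d"
      using d ppos[of "f i"] by (auto simp: r_def field_simps)
    define W where "W = {h \<in> topspace F. Z i h \<in> ball (Z i g) d}"
    have "openin F W" unfolding W_def by (rule openin_dual_preimage[OF Z[OF i(1)]]) simp
    moreover have "g \<in> W" using g d by (simp add: W_def)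
    moreover have "R \<psi> \<notin> W" if \<psi>: "\<psi> \<in> ?X" "?N (\<phi> - \<psi>) < r" for \<psi>
    proof
      assume "R \<psi> \<in> W"
      then have "norm (Z i g - \<psi> (f i)) < d"
        using ZR[OF XD[OF \<psi>(1)] i(1)] by (simp add: W_def dist_norm)
      moreover have "norm (\<phi> (f i) - \<psi> (f i)) \<le> ?N (\<phi> - \<psi>) * p (f i)"
        using norm_le_dominated_norm[OF lcE E p D.subspace_diff[OF subspace_dominated_dual[OF lcE E p] \<phi> \<psi>(1)], of "f i"]
        by simp
      moreover have "?N (\<phi> - \<psi>) * p (f i) \<le> r * p (f i)"
        using \<psi>(2) ppos[of "f i"] by (intro mult_right_mono) auto
      moreover have "norm (Z i g - \<phi> (f i)) \<le> norm (Z i g - \<psi> (f i)) + norm (\<phi> (f i) - \<psi> (f i))"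
        using norm_triangle_ineq4[of "Z i g - \<psi> (f i)" "\<phi> (f i) - \<psi> (f i)"] by simp
      ultimately show False using r(2) by (simp add: d_def)
    qed
    then have "X.mball \<phi> r \<times> W \<subseteq> topspace ?P - ?G"
      by (auto simp: W_def)
    moreover have "\<phi> \<in> X.mball \<phi> r" using \<phi> r(1) X.centre_in_mball_iff by blast
    ultimately show "\<exists>A B. openin X.mtopology A \<and> openin F B \<and> \<phi> \<in> A \<and> g \<in> B \<and>
        A \<times> B \<subseteq> topspace ?P - ?G"
      using X.openin_mball by blast
  qed
  moreover have "?G \<subseteq> topspace ?P" using R XD by auto
  ultimately show ?thesis by (simp add: closed_graph_def norm_topology_def closedin_def)
qed

lemma bounded_R_polar_ball:
  assumes p: "continuous_seminorm sE E p"
  shows "bounded_in s F (R ` polar_ball sE E p)"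
proof -
  let ?X = "dominated_dual sE E p" and ?N = "dominated_norm sE E p"
  note ban = banach_on_dominated_dual[OF lcE E p]
  interpret X: Metric_space ?X "\<lambda>x y. ?N (x - y)" by (rule banach_on_Metric_space[OF ban])
  have XD: "\<phi> \<in> dual sE E" if "\<phi> \<in> ?X" for \<phi> using that by (simp add: dominated_dual_def)
  have X0: "0 \<in> ?X" by (rule D.subspace_0[OF subspace_dominated_dual[OF lcE E p]])
  have R0: "R 0 = 0" using R_scale[OF XD[OF X0], of 0] by simp
  have polar: "\<phi> \<in> ?X" "?N \<phi> \<le> 1" if "\<phi> \<in> polar_ball sE E p" for \<phi>
    using that dominated_norm_le[OF lcE E p, of \<phi> 1] by (auto simp: polar_ball_def)
  have cont: "continuous_map (norm_topology ?X ?N) F R"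
  \<comment> \<open>The Banach space consists of functionals on \<open>E\<close> and does not live
    in the ambient space of \<open>F\<close>, so the closed graph property is used for a carrier of
    another type.\<close>
  proof (rule BC_space_closed_graph[OF BC VF.vector_space_axioms ban])
    show "linear_on (fscale (*)) s ?X R"
      using R_add R_scale XD by (auto simp: linear_on_def)
    show "R ` ?X \<subseteq> topspace F" using R XD by auto
    show "closed_graph ?X ?N F R" by (rule closed_graph_R[OF p])
  qed
  show ?thesis
    unfolding bounded_in_def
  proof (intro conjI allI impI)
    show "R ` polar_ball sE E p \<subseteq> topspace F" using R XD polar by auto
    fix W assume "openin F W \<and> 0 \<in> W"
    then have W: "openin F W" "0 \<in> W" by auto
    have "openin X.mtopology {\<phi> \<in> ?X. R \<phi> \<in> W}"
      using openin_continuous_map_preimage[OF cont W(1)] by (simp add: norm_topology_def)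
    moreover have "0 \<in> {\<phi> \<in> ?X. R \<phi> \<in> W}" using X0 R0 W(2) by simp
    ultimately obtain d where d: "d > 0" "X.mball 0 d \<subseteq> {\<phi> \<in> ?X. R \<phi> \<in> W}"
      unfolding X.openin_mtopology by blast
    \<comment> \<open>The polar ball lies in the unit ball, so division by \<open>c\<close> with
      \<open>norm c \<ge> 2 / d\<close> brings it to norm at most \<open>d / 2\<close>, strictly
      inside the ball that \<open>R\<close> maps into \<open>W\<close>.\<close>
    have "R \<phi> \<in> s c ` W" if c: "2 / d \<le> norm c" and \<phi>: "\<phi> \<in> polar_ball sE E p" for c \<phi>
    proof -
      have "norm c > 0" using c d(1) by (meson divide_pos_pos less_le_trans zero_less_numeral)
      then have c0: "c \<noteq> 0" "norm c > 0" by auto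
      define \<psi> where "\<psi> = fscale (*) (inverse c) \<phi>"
      have \<psi>X: "\<psi> \<in> ?X"
        unfolding \<psi>_def by (intro D.subspace_scale[OF subspace_dominated_dual[OF lcE E p]] polar \<phi>)
      have "?N (fscale (*) (inverse c) \<phi>) = norm (inverse c) * ?N \<phi>"
        using ban polar(1)[OF \<phi>] unfolding banach_on_def by blast
      also have "\<dots> \<le> norm (inverse c) * 1" using polar(2)[OF \<phi>] by (intro mult_left_mono) auto
      also have "\<dots> < d" using c c0(2) d(1) by (simp only: norm_inverse) (simp add: field_simps)
      finally have "?N \<psi> < d" by (simp add: \<psi>_def)
      then have "\<psi> \<in> X.mball 0 d" using X0 \<psi>X X.commute[of 0 \<psi>] by simp
      then have "R \<psi> \<in> W" using d(2) by blast
      moreover have "R \<phi> = s c (R \<psi>)"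
        using R_scale[OF XD[OF polar(1)[OF \<phi>]], of "inverse c"] c0(1) by (simp add: \<psi>_def)
      ultimately show ?thesis by blast
    qed
    then show "\<exists>r>0. \<forall>c. r \<le> norm c \<longrightarrow> R ` polar_ball sE E p \<subseteq> s c ` W"
      using d(1) by (intro exI[of _ "2 / d"]) auto
  qed
qed

text \<open>The compact set is the closure of the image. It has to be absolutely convex as well,
  because \<open>dual_kappa\<close> controls only such compact sets.\<close>

lemma compact_R_polar_ball:
  assumes p: "continuous_seminorm sE E p"
  obtains K where "abs_convex_in s K" "compactin F K" "\<And>\<phi>. \<phi> \<in> polar_ball sE E p \<Longrightarrow> R \<phi> \<in> K"
proof
  let ?A = "R ` polar_ball sE E p"
  note bdd = bounded_R_polar_ball[OF p]
  have sub: "?A \<subseteq> topspace F" using bdd by (simp add: bounded_in_def)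
  note ppos = continuous_seminorm_nonneg(2)[OF VE.vector_space_axioms p]
  have polarD: "\<phi> \<in> dual sE E" if "\<phi> \<in> polar_ball sE E p" for \<phi> using that by (simp add: polar_ball_def)
  have "abs_convex_in s ?A"
    unfolding abs_convex_in_def
  proof (intro ballI allI impI)
    fix g h and a b :: 'k assume "g \<in> ?A" "h \<in> ?A" and ab: "norm a + norm b \<le> 1"
    then obtain \<phi> \<psi> where \<phi>: "\<phi> \<in> polar_ball sE E p" "g = R \<phi>" and \<psi>: "\<psi> \<in> polar_ball sE E p" "h = R \<psi>"
      by auto
    define \<theta> where "\<theta> = fscale (*) a \<phi> + fscale (*) b \<psi>"
    have "norm (\<theta> x) \<le> p x" for x
    proof -
      have "norm (\<theta> x) \<le> norm a * norm (\<phi> x) + norm b * norm (\<psi> x)"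
        using norm_triangle_ineq[of "a * \<phi> x" "b * \<psi> x"] by (simp add: \<theta>_def fscale_def norm_mult)
      also have "\<dots> \<le> norm a * p x + norm b * p x"
        using \<phi>(1) \<psi>(1) by (intro add_mono mult_left_mono) (auto simp: polar_ball_def)
      also have "\<dots> \<le> 1 * p x"
        unfolding distrib_right[symmetric] using ab ppos[of x] by (rule mult_right_mono)
      finally show ?thesis by simp
    qed
    moreover have aD: "fscale (*) a \<phi> \<in> dual sE E" and bD: "fscale (*) b \<psi> \<in> dual sE E"
      using polarD[OF \<phi>(1)] polarD[OF \<psi>(1)] by (auto intro: D.subspace_scale[OF subspace_dual])
    moreover have "\<theta> \<in> dual sE E"
      unfolding \<theta>_def by (intro D.subspace_add[OF subspace_dual] aD bD)
    ultimately have "\<theta> \<in> polar_ball sE E p" by (simp add: polar_ball_def)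
    moreover have "R \<theta> = s a g + s b h"
      using R_add[OF aD bD] R_scale[OF polarD[OF \<phi>(1)]] R_scale[OF polarD[OF \<psi>(1)]]
      by (simp add: \<theta>_def \<phi>(2) \<psi>(2))
    ultimately show "s a g + s b h \<in> ?A" by (metis imageI)
  qed
  then show "abs_convex_in s (F closure_of ?A)" using sub by (rule abs_convex_closure[OF lcF])
  show "compactin F (F closure_of ?A)" using SM bdd by (simp add: semi_Montel_def)
  show "R \<phi> \<in> F closure_of ?A" if "\<phi> \<in> polar_ball sE E p" for \<phi>
    using closure_of_subset[OF sub] that by blast
qed

section \<open>Points of \<open>E\<close> that represent the functionals obtained by composition
  with the extension operator\<close>

lemma approximation:
  assumes p: "continuous_seminorm sE E p" and y: "y \<in> dual s F"
  shows "\<exists>x. \<forall>\<phi>\<in>polar_ball sE E p. norm (\<phi> x - y (R \<phi>)) \<le> 1"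
proof -
  obtain K where K: "abs_convex_in s K" "compactin F K" "\<And>\<phi>. \<phi> \<in> polar_ball sE E p \<Longrightarrow> R \<phi> \<in> K"
    using compact_R_polar_ball[OF p] by blast
  \<comment> \<open>The tolerance 1 is enough: smaller tolerances are obtained by replacing
    \<open>p\<close> with a multiple.\<close>
  obtain I a where I: "finite I" "I \<subseteq> U" "\<And>k. k \<in> K \<Longrightarrow> norm (y k - (\<Sum>i\<in>I. a i * Z i k)) \<le> 1"
    using approximation_on_compact[of s F K U Z y 1, OF lcF K(1,2) Z sep y zero_less_one] by blast
  have "norm (\<phi> (\<Sum>i\<in>I. sE (a i) (f i)) - y (R \<phi>)) \<le> 1" if \<phi>: "\<phi> \<in> polar_ball sE E p" for \<phi>
  proof -
    have \<phi>D: "\<phi> \<in> dual sE E" using \<phi> by (simp add: polar_ball_def)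
    have \<phi>0: "\<phi> 0 = 0" using dualD(2)[OF \<phi>D, of 0 0] E by simp
    have "\<phi> (\<Sum>i\<in>I. sE (a i) (f i)) = (\<Sum>i\<in>I. \<phi> (sE (a i) (f i)))"
      by (rule sum_comp_morphism[unfolded comp_def, symmetric]) (use \<phi>0 dualD(1)[OF \<phi>D] E in auto)
    also have "\<dots> = (\<Sum>i\<in>I. a i * Z i (R \<phi>))"
      using I(2) ZR[OF \<phi>D] dualD(2)[OF \<phi>D] E by (intro sum.cong) auto
    finally show ?thesis
      using I(3)[OF K(3)[OF \<phi>]] by (simp add: norm_minus_commute)
  qed
  then show ?thesis by blast
qed

text \<open>Common end of the complete and the sequentially complete case: the intermediate point
  may depend on the functional and on \<open>e\<close>, only \<open>l\<close> is fixed.\<close>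

lemma representation_if_close:
  assumes y: "y \<in> dual s F"
    and close: "\<And>\<phi> e. \<phi> \<in> dual sE E \<Longrightarrow> e > 0 \<Longrightarrow>
      \<exists>x. norm (\<phi> x - \<phi> l) < e \<and> norm (\<phi> x - y (R \<phi>)) \<le> e"
  shows "\<forall>\<phi>\<in>dual sE E. \<phi> l = y (R \<phi>)"
proof
  fix \<phi> assume \<phi>: "\<phi> \<in> dual sE E"
  have "norm (\<phi> l - y (R \<phi>)) \<le> 0 + e" if e: "e > 0" for e
  proof -
    obtain x where "norm (\<phi> x - \<phi> l) < e / 2" "norm (\<phi> x - y (R \<phi>)) \<le> e / 2"
      using close[OF \<phi>, of "e / 2"] e by auto
    then show ?thesis
      using norm_triangle_ineq4[of "\<phi> x - y (R \<phi>)" "\<phi> x - \<phi> l"] by simp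
  qed
  then have "norm (\<phi> l - y (R \<phi>)) \<le> 0" by (rule field_le_epsilon)
  then show "\<phi> l = y (R \<phi>)" by simp
qed

lemma openin_dual_ball:
  assumes "\<phi> \<in> dual sE E" "e > 0"
  shows "openin E {x. norm (\<phi> x - \<phi> l) < e}"
  using openin_dual_preimage[OF assms(1), of "ball (\<phi> l) e"] E
  by (simp add: dist_norm norm_minus_commute)

lemma representation_complete:
  assumes compl: "complete_in E" and y: "y \<in> dual s F"
  shows "\<exists>x. \<forall>\<phi>\<in>dual sE E. \<phi> x = y (R \<phi>)"
proof -
  define A where "A p = {x. \<forall>\<phi>\<in>polar_ball sE E p. norm (\<phi> x - y (R \<phi>)) \<le> 1}" for p
  let ?P = "{p. continuous_seminorm sE E p}"
  \<comment> \<open>A larger seminorm has a larger polar ball and hence a smaller set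
    \<open>A p\<close>; taking maxima of seminorms makes these sets a filter base.\<close>
  define \<F> where "\<F> = (INF p\<in>?P. principal (A p))"
  have ne: "?P \<noteq> {}"
    using continuous_seminorm_below[OF lcE E openin_topspace] E by (metis UNIV_I empty_iff mem_Collect_eq)
  have ev: "(\<forall>\<^sub>F x in \<F>. Q x) \<longleftrightarrow> (\<exists>p\<in>?P. \<forall>x\<in>A p. Q x)" for Q
    unfolding \<F>_def eventually_principal[symmetric]
  proof (rule eventually_INF_base[OF ne])
    fix p q assume pq: "p \<in> ?P" "q \<in> ?P"
    show "\<exists>r\<in>?P. principal (A r) \<le> inf (principal (A p)) (principal (A q))"
    proof
      show "(\<lambda>x. max (p x) (q x)) \<in> ?P" using pq by (simp add: continuous_seminorm_max)
      show "principal (A (\<lambda>x. max (p x) (q x))) \<le> inf (principal (A p)) (principal (A q))"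
        by (auto simp: A_def polar_ball_def le_max_iff_disj)
    qed
  qed
  have A_ne: "A p \<noteq> {}" if "p \<in> ?P" for p
    using approximation[OF _ y] that by (auto simp: A_def)
  have nbot: "\<F> \<noteq> bot"
    unfolding trivial_limit_def ev using A_ne by blast
  have "Cauchy_filter_in E \<F>"
    unfolding Cauchy_filter_in_def
  proof (intro conjI allI impI)
    show "\<F> \<noteq> bot" by (fact nbot)
    show "\<forall>\<^sub>F x in \<F>. x \<in> topspace E" by (simp add: E)
    fix W assume "openin E W \<and> 0 \<in> W"
    then have W: "openin E W" "0 \<in> W" by auto
    obtain p where p: "continuous_seminorm sE E p" "{x. p x < 1} \<subseteq> W"
      using continuous_seminorm_below[OF lcE E W] by blast
    \<comment> \<open>Two points of \<open>A q\<close> differ by at most 2 in \<open>q\<close>,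
      hence by at most \<open>2/3\<close> in \<open>p\<close>, which is below 1.\<close>
    define q where "q = (\<lambda>x. 3 * p x)"
    have q: "continuous_seminorm sE E q" unfolding q_def using p(1) by (rule continuous_seminorm_mult) simp
    have "x - x' \<in> W" if x: "x \<in> A q" "x' \<in> A q" for x x'
    proof -
      have "q (x - x') \<le> 2"
      proof (rule seminorm_le_polar_ball[OF lcE E q])
        fix \<phi> assume \<phi>: "\<phi> \<in> polar_ball sE E q"
        then have "norm (\<phi> x - y (R \<phi>)) \<le> 1" "norm (\<phi> x' - y (R \<phi>)) \<le> 1"
          using x by (auto simp: A_def)
        moreover have "\<phi> (x - x') = \<phi> x - \<phi> x'"
          using \<phi> by (intro dualE_diff) (simp add: polar_ball_def)
        ultimately show "norm (\<phi> (x - x')) \<le> 2"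
          using norm_triangle_ineq4[of "\<phi> x - y (R \<phi>)" "\<phi> x' - y (R \<phi>)"] by simp
      qed
      then show ?thesis using p(2) by (auto simp: q_def)
    qed
    moreover have "\<forall>\<^sub>F x in \<F>. x \<in> A q" unfolding ev using q by blast
    ultimately show "\<exists>A. (\<forall>\<^sub>F x in \<F>. x \<in> A) \<and> (\<forall>x\<in>A. \<forall>x'\<in>A. x - x' \<in> W)" by blast
  qed
  then obtain l where l: "limitin E (\<lambda>x. x) l \<F>" using compl by (auto simp: complete_in_def)
  have "\<exists>x. norm (\<phi> x - \<phi> l) < e \<and> norm (\<phi> x - y (R \<phi>)) \<le> e" if \<phi>: "\<phi> \<in> dual sE E" and e: "e > 0" for \<phi> e
  proof -
    \<comment> \<open>For this seminorm the polar ball contains the functional divided by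
      \<open>e\<close>, so tolerance 1 on \<open>A p\<close> becomes tolerance \<open>e\<close> for
      the functional itself.\<close>
    define p where "p = (\<lambda>x. 1 / e * norm (\<phi> x))"
    have p: "continuous_seminorm sE E p"
      unfolding p_def using e by (intro continuous_seminorm_mult dual_seminorm[OF E \<phi>]) simp
    define \<psi> where "\<psi> = fscale (*) (of_real (1 / e)) \<phi>"
    have "\<psi> \<in> polar_ball sE E p"
      unfolding polar_ball_def
    proof (intro CollectI conjI allI)
      show "\<psi> \<in> dual sE E" unfolding \<psi>_def by (intro D.subspace_scale[OF subspace_dual] \<phi>)
      show "norm (\<psi> x) \<le> p x" for x
        using e by (simp add: \<psi>_def p_def fscale_def norm_divide)
    qed
    moreover have "\<psi> x - y (R \<psi>) = of_real (1 / e) * (\<phi> x - y (R \<phi>))" for x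
    proof -
      have "y (R \<psi>) = of_real (1 / e) * y (R \<phi>)"
        unfolding \<psi>_def R_scale[OF \<phi>] by (rule dualD(2)[OF y R[OF \<phi>]])
      then show ?thesis by (simp only: \<psi>_def fscale_def right_diff_distrib)
    qed
    ultimately have "norm (of_real (1 / e) * (\<phi> x - y (R \<phi>))) \<le> 1" if "x \<in> A p" for x
      using that by (metis (mono_tags, lifting) A_def mem_Collect_eq)
    then have "norm (\<phi> x - y (R \<phi>)) \<le> e" if "x \<in> A p" for x
      using that e by (fastforce simp: norm_mult norm_divide field_simps)
    then have "\<forall>\<^sub>F x in \<F>. norm (\<phi> x - y (R \<phi>)) \<le> e" unfolding ev using p by blast
    moreover have "\<forall>\<^sub>F x in \<F>. x \<in> {x. norm (\<phi> x - \<phi> l) < e}"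
      using \<phi> e dualD(1)[OF \<phi>] by (intro limitinD[OF l] openin_dual_ball) auto
    ultimately have "\<forall>\<^sub>F x in \<F>. norm (\<phi> x - \<phi> l) < e \<and> norm (\<phi> x - y (R \<phi>)) \<le> e"
      by eventually_elim simp
    then show ?thesis using eventually_happens nbot by blast
  qed
  from representation_if_close[OF y this] show ?thesis by blast
qed

lemma representation_sequential:
  fixes ys :: "nat \<Rightarrow> 'v \<Rightarrow> 'k"
  assumes compl: "sequentially_complete_in E" and y: "y \<in> dual s F"
    and ys: "range ys \<subseteq> dual s F" "limitin (dual_kappa s F) ys y sequentially"
    and ex: "\<And>n. \<exists>x. \<forall>\<phi>\<in>dual sE E. \<phi> x = ys n (R \<phi>)"
  shows "\<exists>x. \<forall>\<phi>\<in>dual sE E. \<phi> x = y (R \<phi>)"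
proof -
  obtain xs where xs: "\<And>n \<phi>. \<phi> \<in> dual sE E \<Longrightarrow> \<phi> (xs n) = ys n (R \<phi>)" using ex by metis
  \<comment> \<open>The polar ball is sent by \<open>R\<close> into one absolutely convex compact
    set, on which convergence in \<open>dual_kappa\<close> is uniform.\<close>
  have unif: "\<forall>\<^sub>F n in sequentially. \<forall>\<phi>\<in>polar_ball sE E p. norm (\<phi> (xs n) - y (R \<phi>)) < e"
    if p: "continuous_seminorm sE E p" and e: "e > 0" for p e
  proof -
    obtain K where K: "abs_convex_in s K" "compactin F K" "\<And>\<phi>. \<phi> \<in> polar_ball sE E p \<Longrightarrow> R \<phi> \<in> K"
      using compact_R_polar_ball[OF p] by blast
    obtain W where W: "openin (dual_kappa s F) W" "y \<in> W"
      "\<And>v k. v \<in> W \<Longrightarrow> k \<in> K \<Longrightarrow> norm (v k - y k) < e"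
      using openin_dual_kappa_ball[OF K(1,2) y e] by blast
    from limitinD[OF ys(2) W(1,2)] show ?thesis
    proof eventually_elim
      case (elim n)
      show ?case
      proof
        fix \<phi> assume \<phi>: "\<phi> \<in> polar_ball sE E p"
        then have "\<phi> \<in> dual sE E" by (simp add: polar_ball_def)
        then show "norm (\<phi> (xs n) - y (R \<phi>)) < e" using W(3)[OF elim K(3)[OF \<phi>]] xs by simp
      qed
    qed
  qed
  have "Cauchy_seq_in E xs"
    unfolding Cauchy_seq_in_def
  proof (intro conjI allI impI)
    show "range xs \<subseteq> topspace E" by (simp add: E)
    fix W assume "openin E W \<and> 0 \<in> W"
    then have W: "openin E W" "0 \<in> W" by auto
    obtain p where p: "continuous_seminorm sE E p" "{x. p x < 1} \<subseteq> W"
      using continuous_seminorm_below[OF lcE E W] by blast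
    \<comment> \<open>Two errors of \<open>1/4\<close> give \<open>p \<le> 1/2\<close>; the bound
      through the polar ball is weak, and it must end strictly below 1.\<close>
    have "(1/4::real) > 0" by simp
    from unif[OF p(1) this] obtain N where
      N: "\<And>n \<phi>. n \<ge> N \<Longrightarrow> \<phi> \<in> polar_ball sE E p \<Longrightarrow> norm (\<phi> (xs n) - y (R \<phi>)) < 1/4"
      unfolding eventually_sequentially by blast
    have "xs m - xs n \<in> W" if mn: "m \<ge> N" "n \<ge> N" for m n
    proof -
      have "p (xs m - xs n) \<le> 1/2"
      proof (rule seminorm_le_polar_ball[OF lcE E p(1)])
        fix \<phi> assume \<phi>: "\<phi> \<in> polar_ball sE E p"
        have "\<phi> (xs m - xs n) = \<phi> (xs m) - \<phi> (xs n)"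
          using \<phi> by (intro dualE_diff) (simp add: polar_ball_def)
        then show "norm (\<phi> (xs m - xs n)) \<le> 1/2"
          using norm_triangle_ineq4[of "\<phi> (xs m) - y (R \<phi>)" "\<phi> (xs n) - y (R \<phi>)"]
            N[OF mn(1) \<phi>] N[OF mn(2) \<phi>] by simp
      qed
      then show ?thesis using p(2) by auto
    qed
    then show "\<exists>N. \<forall>m\<ge>N. \<forall>n\<ge>N. xs m - xs n \<in> W" by blast
  qed
  then obtain l where l: "limitin E xs l sequentially"
    using compl by (auto simp: sequentially_complete_in_def)
  have "\<exists>x. norm (\<phi> x - \<phi> l) < e \<and> norm (\<phi> x - y (R \<phi>)) \<le> e" if \<phi>: "\<phi> \<in> dual sE E" and e: "e > 0" for \<phi> e
  proof -
    have "\<forall>\<^sub>F n in sequentially. xs n \<in> {x. norm (\<phi> x - \<phi> l) < e}"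
      using \<phi> e by (intro limitinD[OF l] openin_dual_ball) auto
    moreover have "\<forall>\<^sub>F n in sequentially. norm (\<phi> (xs n) - y (R \<phi>)) < e"
      using unif[OF dual_seminorm[OF E \<phi>] e] by eventually_elim (use \<phi> in \<open>auto simp: polar_ball_def\<close>)
    ultimately have "\<forall>\<^sub>F n in sequentially. norm (\<phi> (xs n) - \<phi> l) < e \<and> norm (\<phi> (xs n) - y (R \<phi>)) \<le> e"
      by eventually_elim simp
    then show ?thesis using eventually_happens by fastforce
  qed
  from representation_if_close[OF y this] show ?thesis by blast
qed

text \<open>Linearity is tested against the dual of \<open>E\<close>, which separates points. For
  continuity, functionals within \<open>1/2\<close> of \<open>y\<close> on the compact set attached
  to \<open>p\<close> have images within \<open>1/2\<close> of \<open>u y\<close> in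
  \<open>p\<close>.\<close>

lemma representing_operator:
  assumes ex: "\<And>y. y \<in> dual s F \<Longrightarrow> \<exists>x. \<forall>\<phi>\<in>dual sE E. \<phi> x = y (R \<phi>)"
  obtains u where "u \<in> eps_carrier s F sE E"
    "\<And>y \<phi>. y \<in> dual s F \<Longrightarrow> \<phi> \<in> dual sE E \<Longrightarrow> \<phi> (u y) = y (R \<phi>)"
proof -
  obtain u0 where u0: "\<And>y \<phi>. y \<in> dual s F \<Longrightarrow> \<phi> \<in> dual sE E \<Longrightarrow> \<phi> (u0 y) = y (R \<phi>)"
    using ex by metis
  define u where "u = zero_ext (dual s F) u0"
  have u: "\<phi> (u y) = y (R \<phi>)" if "y \<in> dual s F" "\<phi> \<in> dual sE E" for y \<phi>
    using u0 that by (simp add: u_def zero_ext_def)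
  interpret DF: vector_space "fscale (*) :: 'k \<Rightarrow> ('v \<Rightarrow> 'k) \<Rightarrow> 'v \<Rightarrow> 'k"
    by (intro vector_space_fscale vector_space_field)
  have "linear_on (fscale (*)) sE (dual s F) u"
    unfolding linear_on_def
  proof (intro conjI ballI allI)
    fix y z assume yz: "y \<in> dual s F" "z \<in> dual s F"
    have "y + z \<in> dual s F" by (intro DF.subspace_add[OF subspace_dual] yz)
    then show "u (y + z) = u y + u z"
      using yz by (intro dual_separates[OF lcE E]) (simp add: u dualD(1) E)
  next
    fix c y assume y: "y \<in> dual s F"
    have "fscale (*) c y \<in> dual s F" by (intro DF.subspace_scale[OF subspace_dual] y)
    then show "u (fscale (*) c y) = sE c (u y)"
      using y by (intro dual_separates[OF lcE E]) (simp add: u dualD(2) E fscale_def)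
  qed
  moreover have "continuous_map (dual_kappa s F) E u"
  proof -
    have top: "topspace (dual_kappa s F) = dual s F"
      by (simp add: dual_kappa_def topspace_unif_topology)
    have "openin (dual_kappa s F) {y \<in> dual s F. u y \<in> W}" if W: "openin E W" for W
    proof (subst openin_subopen, intro ballI)
      fix y assume "y \<in> {y \<in> dual s F. u y \<in> W}"
      then have y: "y \<in> dual s F" "u y \<in> W" by auto
      have "continuous_map E E (\<lambda>x. x + u y)" using E by (intro lcHs_add[OF lcE]) auto
      from openin_continuous_map_preimage[OF this W]
      have "openin E {x. x + u y \<in> W}" by (simp add: E)
      then obtain p where p: "continuous_seminorm sE E p" "{x. p x < 1} \<subseteq> {x. x + u y \<in> W}"
        using continuous_seminorm_below[OF lcE E, of "{x. x + u y \<in> W}"] y(2) by auto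
      obtain K where K: "abs_convex_in s K" "compactin F K" "\<And>\<phi>. \<phi> \<in> polar_ball sE E p \<Longrightarrow> R \<phi> \<in> K"
        using compact_R_polar_ball[OF p(1)] by blast
      obtain V where V: "openin (dual_kappa s F) V" "y \<in> V"
        "\<And>v k. v \<in> V \<Longrightarrow> k \<in> K \<Longrightarrow> norm (v k - y k) < 1/2"
        using openin_dual_kappa_ball[OF K(1,2) y(1), of "1/2"] by auto
      have "v \<in> {y \<in> dual s F. u y \<in> W}" if v: "v \<in> V" for v
      proof -
        have vD: "v \<in> dual s F" using openin_subset[OF V(1)] top v by blast
        have "p (u v - u y) \<le> 1/2"
        proof (rule seminorm_le_polar_ball[OF lcE E p(1)])
          fix \<phi> assume \<phi>: "\<phi> \<in> polar_ball sE E p"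
          then have \<phi>D: "\<phi> \<in> dual sE E" by (simp add: polar_ball_def)
          show "norm (\<phi> (u v - u y)) \<le> 1/2"
            using V(3)[OF v K(3)[OF \<phi>]] dualE_diff[OF \<phi>D] u[OF vD \<phi>D] u[OF y(1) \<phi>D] by simp
        qed
        then have "u v - u y \<in> {x. p x < 1}" by simp
        with p(2) have "u v - u y \<in> {x. x + u y \<in> W}" by (rule subsetD)
        then show ?thesis using vD by simp
      qed
      then show "\<exists>A. openin (dual_kappa s F) A \<and> y \<in> A \<and> A \<subseteq> {y \<in> dual s F. u y \<in> W}"
        using V(1,2) by blast
    qed
    then show ?thesis by (simp add: continuous_map_def top E)
  qed
  moreover have "\<forall>y. y \<notin> dual s F \<longrightarrow> u y = 0" by (simp add: u_def zero_ext_def)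
  ultimately show thesis using that[of u] u by (simp add: eps_carrier_def)
qed

end


section \<open>Surjectivity of the restriction map\<close>

lemma T_at_eq: "g \<in> topspace F \<Longrightarrow> T_at F TK m x g = TK m g x"
  by (simp add: T_at_def zero_ext_def)

text \<open>The definite description needs uniqueness: two extensions differ by an element of
  \<open>F\<close> killed by every \<open>T_at\<close> indexed by \<open>U\<close>. Additivity is
  read off from the membership of \<open>T_at\<close> in the dual.\<close>

lemma weak_extension_extends:
  fixes F :: "('w \<Rightarrow> 'k::real_or_complex) topology"
  assumes lc: "lcHs (fscale (*)) F" and uniq: "set_of_uniqueness F M \<omega> TK U"
    and ex: "\<exists>g. extends_weakly F TK U f e' g"
  shows "extends_weakly F TK U f e' (weak_extension F TK U f e')"
  unfolding weak_extension_def
proof (rule theI'[of "extends_weakly F TK U f e'"])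
  have "g = h" if g: "extends_weakly F TK U f e' g" and h: "extends_weakly F TK U f e' h" for g h
  proof -
    interpret vector_space "fscale (*) :: 'k \<Rightarrow> ('w \<Rightarrow> 'k) \<Rightarrow> 'w \<Rightarrow> 'k"
      using lc by (simp add: lcHs_def)
    have gh: "g \<in> topspace F" "h \<in> topspace F" using g h by (auto simp: extends_weakly_def)
    have diff: "g - h \<in> topspace F"
      using lc gh by (intro subspace_diff) (auto simp: lcHs_def)
    have TK: "TK m g x = (e' \<circ> f) (m, x)" if "extends_weakly F TK U f e' g" "(m, x) \<in> U" for g m x
      using that unfolding extends_weakly_def by blast
    have "TK m (g - h) x = 0" if mx: "(m, x) \<in> U" for m x
    proof -
      have T: "T_at F TK m x \<in> fun_dual F" using uniq mx by (auto simp: set_of_uniqueness_def)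
      have "T_at F TK m x g = T_at F TK m x (g - h) + T_at F TK m x h"
        using dualD(1)[OF T diff gh(2)] by simp
      then show ?thesis using gh diff TK[OF g mx] TK[OF h mx] by (simp add: T_at_eq)
    qed
    then have "g - h = 0" using uniq diff by (auto simp: set_of_uniqueness_def)
    then show ?thesis by simp
  qed
  then show "\<exists>!g. extends_weakly F TK U f e' g" using ex by blast
qed

lemma weak_lifting_weak_extension:
  assumes "lcHs sE E" "topspace E = UNIV" and lc: "lcHs (fscale (*)) F"
    and "BC_space (fscale (*)) F" "semi_Montel (fscale (*)) F"
    and uniq: "set_of_uniqueness F M \<omega> TK U" and f: "f \<in> weak_function_space sE E F TK U"
  shows "weak_lifting sE E (fscale (*)) F U (\<lambda>(m, x). T_at F TK m x) f (weak_extension F TK U f)"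
proof
  have ext: "extends_weakly F TK U f e' (weak_extension F TK U f e')" if "e' \<in> dual sE E" for e'
    using f that by (intro weak_extension_extends[OF lc uniq]) (auto simp: weak_function_space_def)
  show "(case i of (m, x) \<Rightarrow> T_at F TK m x) \<in> fun_dual F" if "i \<in> U" for i
    using uniq that by (auto simp: set_of_uniqueness_def)
  show "g = 0" if g: "g \<in> topspace F" "\<forall>i\<in>U. (case i of (m, x) \<Rightarrow> T_at F TK m x) g = 0" for g
  proof -
    have "\<forall>(m, x)\<in>U. TK m g x = 0" using g by (auto simp: T_at_eq)
    then show ?thesis using uniq g(1) unfolding set_of_uniqueness_def by blast
  qed
  show "weak_extension F TK U f e' \<in> topspace F" if "e' \<in> dual sE E" for e'
    using ext[OF that] by (simp add: extends_weakly_def)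
  then show "(case i of (m, x) \<Rightarrow> T_at F TK m x) (weak_extension F TK U f e') = e' (f i)"
    if "e' \<in> dual sE E" "i \<in> U" for e' i
    using ext[OF that(1)] that by (auto simp: extends_weakly_def T_at_eq)
qed (use assms in auto)

lemma restriction_in_weak_function_space:
  fixes F :: "('w \<Rightarrow> 'k::real_or_complex) topology"
  assumes E: "topspace E = UNIV" and lc: "lcHs (fscale (*)) F"
    and strong: "strong_family sE E F FE M \<omega> TK TE" and uniq: "set_of_uniqueness F M \<omega> TK U"
    and h: "h \<in> topspace FE"
  shows "restriction_map TE U h \<in> weak_function_space sE E F TK U"
proof -
  have U: "m \<in> M \<and> x \<in> \<omega> m" if "(m, x) \<in> U" for m x
    using uniq that by (auto simp: set_of_uniqueness_def)
  have "\<exists>g. extends_weakly F TK U (restriction_map TE U h) e' g" if e': "e' \<in> dual sE E" for e'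
  \<comment> \<open>Strength places \<open>e' \<circ> h\<close> in \<open>F\<close> only in the
    presence of some index \<open>(m, x)\<close>; without indices any element of \<open>F\<close>
    extends, for instance 0.\<close>
  proof (cases "U = {}")
    case True
    interpret vector_space "fscale (*) :: 'k \<Rightarrow> ('w \<Rightarrow> 'k) \<Rightarrow> 'w \<Rightarrow> 'k"
      by (intro vector_space_fscale vector_space_field)
    have "0 \<in> topspace F" using lc by (intro subspace_0) (simp add: lcHs_def)
    then show ?thesis using True by (auto simp: extends_weakly_def)
  next
    case False
    have *: "e' \<circ> h \<in> topspace F \<and> TK m (e' \<circ> h) x = e' (TE m h x)" if "(m, x) \<in> U" for m x
      using strong e' h U[OF that] unfolding strong_family_def by blast
    then have "e' \<circ> h \<in> topspace F" using False by fastforce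
    then have "extends_weakly F TK U (restriction_map TE U h) e' (e' \<circ> h)"
      using * by (auto simp: extends_weakly_def restriction_map_def)
    then show ?thesis by blast
  qed
  then show ?thesis
    using E by (auto simp: weak_function_space_def restriction_map_def)
qed

theorem theorem5p2p15:
  fixes sE :: "'k::real_or_complex \<Rightarrow> 'e::ab_group_add \<Rightarrow> 'e"
    and E :: "'e topology"
    and F :: "('w \<Rightarrow> 'k) topology"
    and FE :: "('w \<Rightarrow> 'e) topology"
    and M :: "'m set"
    and \<omega> :: "'m \<Rightarrow> 'x set"
    and domK :: "'m \<Rightarrow> ('w \<Rightarrow> 'k) set"
    and TK :: "'m \<Rightarrow> ('w \<Rightarrow> 'k) \<Rightarrow> 'x \<Rightarrow> 'k"
    and domE :: "'m \<Rightarrow> ('w \<Rightarrow> 'e) set"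
    and TE :: "'m \<Rightarrow> ('w \<Rightarrow> 'e) \<Rightarrow> 'x \<Rightarrow> 'e"
    and U :: "('m \<times> 'x) set"
  assumes "lcHs sE E" and "topspace E = UNIV"
    and "eps_into_compatible sE E F FE"
    and "\<And>m. m \<in> M \<Longrightarrow> \<omega> m \<noteq> {}"
    and "linear_family (*) M \<omega> domK TK" and "\<And>m. m \<in> M \<Longrightarrow> topspace F \<subseteq> domK m"
    and "linear_family sE M \<omega> domE TE" and "\<And>m. m \<in> M \<Longrightarrow> topspace FE \<subseteq> domE m"
    and "strong_family sE E F FE M \<omega> TK TE"
    and "consistent_family sE E F FE M \<omega> TK TE"
    and "semi_Montel (fscale (*)) F" and "BC_space (fscale (*)) F"
    and "set_of_uniqueness F M \<omega> TK U"
    and "complete_in E \<or>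
         sequentially_complete_in E \<and>
         (\<forall>f\<in>weak_function_space sE E F TK U. \<forall>f'\<in>fun_dual F.
            \<exists>fs :: nat \<Rightarrow> ('w \<Rightarrow> 'k) \<Rightarrow> 'k.
              range fs \<subseteq> fun_dual F \<and>
              limitin (dual_kappa (fscale (*)) F) fs f' sequentially \<and>
              (\<forall>n. R_transpose sE E F TK U f (fs n) \<in> J_map sE E ` topspace E))"
  shows "restriction_map TE U ` (S_map F ` topspace (fun_eps F sE E)) =
           weak_function_space sE E F TK U"
proof (intro equalityI subsetI)
  note lcE = assms(1) and E = assms(2) and compat = assms(3) and strong = assms(9)
    and consistent = assms(10) and uniq = assms(13)
  have lcF: "lcHs (fscale (*)) F" using compat by (simp add: eps_into_compatible_def)
  have top: "topspace (fun_eps F sE E) = eps_carrier (fscale (*)) F sE E"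
    using E by (simp add: eps_product_def topspace_unif_topology)
  {
    fix g assume "g \<in> restriction_map TE U ` (S_map F ` topspace (fun_eps F sE E))"
    then obtain u where u: "u \<in> topspace (fun_eps F sE E)" and g: "g = restriction_map TE U (S_map F u)"
      by blast
    have "embedding_map (fun_eps F sE E) FE (S_map F)"
      using compat by (simp add: eps_into_compatible_def)
    then have "S_map F u \<in> topspace FE"
      using u by (auto simp: embedding_map_def dest!: homeomorphic_imp_surjective_map)
    then show "g \<in> weak_function_space sE E F TK U"
      unfolding g by (rule restriction_in_weak_function_space[OF E lcF strong uniq])
  }
  fix f assume f: "f \<in> weak_function_space sE E F TK U"
  let ?R = "weak_extension F TK U f"
  interpret weak_lifting sE E "fscale (*)" F U "\<lambda>(m, x). T_at F TK m x" f ?R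
    by (rule weak_lifting_weak_extension[OF lcE E lcF assms(12,11) uniq f])
  have "\<exists>x. \<forall>e'\<in>dual sE E. e' x = y (?R e')" if y: "y \<in> fun_dual F" for y
  proof (cases "complete_in E")
    case True
    then show ?thesis using y by (rule representation_complete)
  next
    case False
    then obtain fs where seq: "sequentially_complete_in E"
      and fs: "range fs \<subseteq> fun_dual F" "limitin (dual_kappa (fscale (*)) F) fs y sequentially"
        "\<And>n :: nat. R_transpose sE E F TK U f (fs n) \<in> J_map sE E ` topspace E"
      using assms(14) f y by blast
    have "\<exists>x. \<forall>e'\<in>dual sE E. e' x = fs n (?R e')" for n
    proof -
      \<comment> \<open>Membership in the image of \<open>J_map\<close> says that
        \<open>fs n\<close> after the extension operator is evaluation at a point of
        \<open>E\<close>.\<close>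
      obtain x where "R_transpose sE E F TK U f (fs n) = J_map sE E x" using fs(3) by blast
      then have "fs n (?R e') = e' x" if "e' \<in> dual sE E" for e'
        using that unfolding R_transpose_def J_map_def zero_ext_def by metis
      then show ?thesis by metis
    qed
    then show ?thesis by (rule representation_sequential[OF seq y fs(1,2)])
  qed
  from representing_operator[OF this] obtain u where u: "u \<in> eps_carrier (fscale (*)) F sE E"
    and u_eq: "\<And>y e'. y \<in> fun_dual F \<Longrightarrow> e' \<in> dual sE E \<Longrightarrow> e' (u y) = y (?R e')"
    by blast
  \<comment> \<open>Consistency turns the left side into \<open>u\<close> at
    \<open>T_at F TK m x\<close>. Under \<open>e'\<close> this becomes \<open>T_at F TK m x\<close>
    applied to the weak extension for \<open>e'\<close>, which is
    \<open>e' (f (m, x))\<close>.\<close>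
  have "TE m (S_map F u) x = f (m, x)" if mx: "(m, x) \<in> U" for m x
  proof (rule dual_separates[OF lcE E])
    fix e' assume e': "e' \<in> dual sE E"
    have "m \<in> M" "x \<in> \<omega> m" using uniq mx by (auto simp: set_of_uniqueness_def)
    then have "TE m (S_map F u) x = u (T_at F TK m x)"
      using consistent u top unfolding consistent_family_def by blast
    then show "e' (TE m (S_map F u) x) = e' (f (m, x))"
      using u_eq[OF Z[OF mx] e'] ZR[OF e' mx] by simp
  qed
  \<comment> \<open>Off \<open>U\<close> both functions take the value \<open>undefined\<close>, so
    they agree as functions on the whole type.\<close>
  then have "restriction_map TE U (S_map F u) i = f i" for i
    using f by (cases i) (auto simp: restriction_map_def weak_function_space_def PiE_def extensional_def)
  then have "f = restriction_map TE U (S_map F u)" by (simp add: fun_eq_iff)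
  then show "f \<in> restriction_map TE U ` (S_map F ` topspace (fun_eps F sE E))"
    using u top by blast
qed

end
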